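(* Let $Q$ be a quiver without oriented cycles and $\beta\in\mathbb{N}^{Q_0}$ a dimension vector. Let $a\in Q_1$ be a 1-source or 1-sink arrow; number its vertices by $1,2$, where $1$ is the vertex that is not a vertex of any arrow other than $a$ ($1=ta$ if $a$ is a 1-source, $1=ha$ if $a$ is a 1-sink), and assume $\beta_1\leq\beta_2$. The slice at the arrow $a$ is the representation space $\operatorname{Rep}(Q_a,\beta_a)$ with the action of $\operatorname{GL}(\beta_a)$, where $Q_a$ is obtained from $Q$ by deleting $a$, keeping all other arrows, and adding for every arrow $2\to x$ of $Q$ (different from $a$) a new arrow $1\to x$ and for every arrow $y\to 2$ of $Q$ (different from $a$) a new arrow $y\to 1$; and $\beta_a$ agrees with $\beta$ except that $(\beta_a)_2=\beta_2-\beta_1$. Let $f$ be a non-zero semi-invariant on $\operatorname{Rep}(Q,\beta)$ of weight $\sigma=\langle\alpha,\cdot\rangle$ and let $f_a$ be the induced semi-invariant on $\operatorname{Rep}(Q_a,\beta_a)$, of weight $\sigma_a=\langle\alpha_a,\cdot\rangle$. Under the natural correspondence of vertices between $Q$ and $Q_a$, $\sigma_a$ differs from $\sigma$ only at vertex $1$, with $\sigma_a(1)=\sigma(1)+\sigma(2)$. Moreover, if $\sigma_a$ is a multiplicity-free weight on $\operatorname{Rep}(Q_a,\beta_a)$, then $\sigma$ is multiplicity-free as well and (up to a non-zero constant factor) $$b_f(s)=b_{f_a}(s)\cdot[s]^{|\sigma(1)|}_{\beta_2-\beta_1,\beta_2}.$$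
   Context: Everything is over $\mathbb{C}$. A quiver $Q=(Q_0,Q_1)$ has vertices $Q_0$ and arrows $a:ta\to ha$. An arrow $a$ is a 1-source (resp. 1-sink) if $ta$ (resp. $ha$) is not a vertex of any arrow other than $a$. $\operatorname{Rep}(Q,\beta)=\bigoplus_{a\in Q_1}\operatorname{Hom}(\mathbb{C}^{\beta_{ta}},\mathbb{C}^{\beta_{ha}})$, with the base-change action of $\operatorname{GL}(\beta)=\prod_x\operatorname{GL}(\beta_x)$. The Euler form is $\langle\alpha,\beta\rangle=\sum_{x\in Q_0}\alpha_x\beta_x-\sum_{a\in Q_1}\alpha_{ta}\beta_{ha}$ (for $\sigma_a=\langle\alpha_a,\cdot\rangle$ the Euler form of $Q_a$ is used). A group acts on polynomial functions by $(g\cdot f)(x)=f(g^{-1}x)$; $f$ is a semi-invariant of weight $\sigma$ if $g\cdot f=\sigma(g)f$. A function $\sigma:Q_0\to\mathbb{Z}$ is identified with the character $\prod_x\det_x^{\sigma(x)}$ of $\operatorname{GL}(\beta)$, and with the linear function $\beta\mapsto\sum_x\sigma(x)\beta_x$ on $\mathbb{Z}^{Q_0}$. A weight $\sigma$ is multiplicity-free if, for every $k\in\mathbb{N}$, the space of semi-invariants of weight $\sigma^k$ is one-dimensional. Induced semi-invariant $f_a$: let $v\in\operatorname{Hom}(\mathbb{C}^{\beta_{ta}},\mathbb{C}^{\beta_{ha}})\subset\operatorname{Rep}(Q,\beta)$ be the matrix of maximal rank $\beta_1$ given by the identity block $I_{\beta_1}$ in the first $\beta_1$ coordinates of $\mathbb{C}^{\beta_2}$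 and zero elsewhere (all other arrows zero). Splitting $\mathbb{C}^{\beta_2}=\mathbb{C}^{\beta_1}\oplus\mathbb{C}^{\beta_2-\beta_1}$ identifies the sum $F$ of the Hom-spaces for the arrows of $Q$ other than $a$ with $\operatorname{Rep}(Q_a,\beta_a)$, and $f_a(w)=f(v+w)$ for $w\in F$. $b_f(s)$ denotes the Bernstein-Sato polynomial: the monic generator of the ideal of $b(s)\in\mathbb{C}[s]$ for which there is $P(s)\in D[s]$ ($D$ the Weyl algebra) with $P(s)f^{s+1}=b(s)f^s$. For $a\le b$ and $d$ in $\mathbb{N}$: $[s]^d_{a,b}=\prod_{i=a+1}^b\prod_{j=0}^{d-1}(ds+i+j)$. *)

theory Defs
  imports
    "HOL-Analysis.Derivative"
    "HOL-Library.Function_Algebras"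
    "HOL-Algebra.Product_Groups"
    "Graph_Theory.Arc_Walk"
    "Jordan_Normal_Form.Determinant"
begin

text \<open>
  A finite quiver is a \<open>pre_digraph\<close> record satisfying \<open>fin_digraph\<close> (multiple arcs and loops are
  allowed there), with tail and head as \<open>ta\<close> and \<open>ha\<close>.
\<close>

definition no_oriented_cycles :: "('v, 'a) pre_digraph \<Rightarrow> bool" where
  "no_oriented_cycles Q \<longleftrightarrow> (\<nexists>p. pre_digraph.cycle Q p)"

definition one_source :: "('v, 'a) pre_digraph \<Rightarrow> 'a \<Rightarrow> bool" where
  "one_source Q a \<longleftrightarrow>
     a \<in> arcs Q \<and> (\<forall>b\<in>arcs Q. b \<noteq> a \<longrightarrow> tail Q b \<noteq> tail Q a \<and> head Q b \<noteq> tail Q a)"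

definition one_sink :: "('v, 'a) pre_digraph \<Rightarrow> 'a \<Rightarrow> bool" where
  "one_sink Q a \<longleftrightarrow>
     a \<in> arcs Q \<and> (\<forall>b\<in>arcs Q. b \<noteq> a \<longrightarrow> tail Q b \<noteq> head Q a \<and> head Q b \<noteq> head Q a)"

definition euler_form :: "('v, 'a) pre_digraph \<Rightarrow> ('v \<Rightarrow> int) \<Rightarrow> ('v \<Rightarrow> int) \<Rightarrow> int" where
  "euler_form Q \<alpha> \<beta> =
     (\<Sum>x\<in>verts Q. \<alpha> x * \<beta> x) - (\<Sum>b\<in>arcs Q. \<alpha> (tail Q b) * \<beta> (head Q b))"

text \<open>
  The weight \<open>\<langle>\<alpha>,\<cdot>\<rangle>\<close> as a function on vertices: a linear form \<open>\<beta> \<mapsto> (\<Sum>x. \<sigma> x * \<beta> x)\<close> is identified with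
  its coefficient function \<open>\<sigma>\<close>, i.e. with its values on the unit vectors.
\<close>

definition euler_weight :: "('v, 'a) pre_digraph \<Rightarrow> ('v \<Rightarrow> int) \<Rightarrow> 'v \<Rightarrow> int" where
  "euler_weight Q \<alpha> x = euler_form Q \<alpha> (\<lambda>y. of_bool (y = x))"

lemma euler_form_eq_weight:
  assumes "fin_digraph Q"
  shows "euler_form Q \<alpha> \<beta> = (\<Sum>x\<in>verts Q. euler_weight Q \<alpha> x * \<beta> x)"
proof -
  interpret fin_digraph Q by fact
  let ?e = "\<lambda>y x :: 'v. if y = x then 1 else 0 :: int"
  have ew: "euler_weight Q \<alpha> x =
      \<alpha> x - (\<Sum>b\<in>arcs Q. \<alpha> (tail Q b) * ?e (head Q b) x)" if "x \<in> verts Q" for x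
    using that by (simp add: euler_weight_def euler_form_def of_bool_def
        if_distrib[of "\<lambda>z. _ * z"] sum.delta del: sum_mult_of_bool_eq cong: if_cong)
  have 2: "(\<Sum>x\<in>verts Q. ?e (head Q b) x * \<beta> x) = \<beta> (head Q b)" if "b \<in> arcs Q" for b
    using that by (simp add: if_distrib[of "\<lambda>z. z * _"] sum.delta' cong: if_cong)
  have "(\<Sum>x\<in>verts Q. euler_weight Q \<alpha> x * \<beta> x) = (\<Sum>x\<in>verts Q. \<alpha> x * \<beta> x)
          - (\<Sum>x\<in>verts Q. \<Sum>b\<in>arcs Q. \<alpha> (tail Q b) * (?e (head Q b) x * \<beta> x))"
    unfolding sum_subtractf[symmetric]
    by (intro sum.cong refl) (simp only: ew left_diff_distrib sum_distrib_right mult.assoc)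
  also have "(\<Sum>x\<in>verts Q. \<Sum>b\<in>arcs Q. \<alpha> (tail Q b) * (?e (head Q b) x * \<beta> x))
          = (\<Sum>b\<in>arcs Q. \<alpha> (tail Q b) * \<beta> (head Q b))"
    by (subst sum.swap, intro sum.cong refl) (simp only: sum_distrib_left[symmetric] 2)
  finally show ?thesis
    by (simp add: euler_form_def)
qed

type_synonym 'a rep = "'a \<Rightarrow> complex mat"

definition Rep :: "('v, 'a) pre_digraph \<Rightarrow> ('v \<Rightarrow> nat) \<Rightarrow> 'a rep set" where
  "Rep Q \<beta> = (\<Pi>\<^sub>E b\<in>arcs Q. carrier_mat (\<beta> (head Q b)) (\<beta> (tail Q b)))"

definition rep_plus :: "('v, 'a) pre_digraph \<Rightarrow> 'a rep \<Rightarrow> 'a rep \<Rightarrow> 'a rep" where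
  "rep_plus Q V W = (\<lambda>b\<in>arcs Q. V b + W b)"

abbreviation GLn :: "nat \<Rightarrow> complex mat monoid" where
  "GLn n \<equiv> units_of (ring_mat TYPE(complex) n ())"

abbreviation GL :: "('v, 'a) pre_digraph \<Rightarrow> ('v \<Rightarrow> nat) \<Rightarrow> ('v \<Rightarrow> complex mat) monoid" where
  "GL Q \<beta> \<equiv> product_group (verts Q) (\<lambda>x. GLn (\<beta> x))"

definition rep_act ::
  "('v, 'a) pre_digraph \<Rightarrow> ('v \<Rightarrow> nat) \<Rightarrow> ('v \<Rightarrow> complex mat) \<Rightarrow> 'a rep \<Rightarrow> 'a rep" where
  "rep_act Q \<beta> g W =
     (\<lambda>b\<in>arcs Q. g (head Q b) * W b * inv\<^bsub>GLn (\<beta> (tail Q b))\<^esub> g (tail Q b))"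

definition weight_char :: "('v, 'a) pre_digraph \<Rightarrow> ('v \<Rightarrow> int) \<Rightarrow> ('v \<Rightarrow> complex mat) \<Rightarrow> complex" where
  "weight_char Q \<sigma> g = (\<Prod>x\<in>verts Q. det (g x) powi \<sigma> x)"

type_synonym 'a coord = "'a \<times> nat \<times> nat"

definition coords :: "('v, 'a) pre_digraph \<Rightarrow> ('v \<Rightarrow> nat) \<Rightarrow> 'a coord set" where
  "coords Q \<beta> = {(b, i, j). b \<in> arcs Q \<and> i < \<beta> (head Q b) \<and> j < \<beta> (tail Q b)}"

definition coord_fun :: "'a coord \<Rightarrow> 'a rep \<Rightarrow> complex" where
  "coord_fun = (\<lambda>(b, i, j) W. W b $$ (i, j))"

inductive_set poly_expr :: "('v, 'a) pre_digraph \<Rightarrow> ('v \<Rightarrow> nat) \<Rightarrow> ('a rep \<Rightarrow> complex) set"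
  for Q :: "('v, 'a) pre_digraph" and \<beta> :: "'v \<Rightarrow> nat" where
  const: "(\<lambda>W. c) \<in> poly_expr Q \<beta>"
| coord: "x \<in> coords Q \<beta> \<Longrightarrow> coord_fun x \<in> poly_expr Q \<beta>"
| add: "p \<in> poly_expr Q \<beta> \<Longrightarrow> q \<in> poly_expr Q \<beta> \<Longrightarrow> p + q \<in> poly_expr Q \<beta>"
| mult: "p \<in> poly_expr Q \<beta> \<Longrightarrow> q \<in> poly_expr Q \<beta> \<Longrightarrow> p * q \<in> poly_expr Q \<beta>"

text \<open>
  Functions on \<open>Rep Q \<beta>\<close> are total functions that vanish off \<open>Rep Q \<beta>\<close>, so that equality of functions
  on the representation space is HOL equality and they form a subspace of the space of all functions.
\<close>

definition on_Rep ::
  "('v, 'a) pre_digraph \<Rightarrow> ('v \<Rightarrow> nat) \<Rightarrow> ('a rep \<Rightarrow> complex) \<Rightarrow> 'a rep \<Rightarrow> complex" where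
  "on_Rep Q \<beta> p = (\<lambda>W. if W \<in> Rep Q \<beta> then p W else 0)"

definition poly_funs :: "('v, 'a) pre_digraph \<Rightarrow> ('v \<Rightarrow> nat) \<Rightarrow> ('a rep \<Rightarrow> complex) set" where
  "poly_funs Q \<beta> = on_Rep Q \<beta> ` poly_expr Q \<beta>"

definition semi_invariants ::
  "('v, 'a) pre_digraph \<Rightarrow> ('v \<Rightarrow> nat) \<Rightarrow> ('v \<Rightarrow> int) \<Rightarrow> ('a rep \<Rightarrow> complex) set" where
  "semi_invariants Q \<beta> \<sigma> =
     {f \<in> poly_funs Q \<beta>. \<forall>g\<in>carrier (GL Q \<beta>). \<forall>W\<in>Rep Q \<beta>.
        f (rep_act Q \<beta> (inv\<^bsub>GL Q \<beta>\<^esub> g) W) = weight_char Q \<sigma> g * f W}"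

abbreviation fun_scale :: "complex \<Rightarrow> ('c \<Rightarrow> complex) \<Rightarrow> 'c \<Rightarrow> complex" where
  "fun_scale \<equiv> \<lambda>c f x. c * f x"

lemma vector_space_fun_scale: "vector_space fun_scale"
  by standard (simp_all add: fun_eq_iff algebra_simps)

text \<open>The character \<open>\<sigma>\<^sup>k\<close> is \<open>k * \<sigma>\<close> in additive notation.\<close>

definition multiplicity_free ::
  "('v, 'a) pre_digraph \<Rightarrow> ('v \<Rightarrow> nat) \<Rightarrow> ('v \<Rightarrow> int) \<Rightarrow> bool" where
  "multiplicity_free Q \<beta> \<sigma> \<longleftrightarrow>
     (\<forall>k::nat. vector_space.dim fun_scale (semi_invariants Q \<beta> (\<lambda>x. int k * \<sigma> x)) = 1)"

text \<open>
  Below, \<open>a\<close> is the distinguished arrow, \<open>p\<close> its vertex called 1 (which lies on no other arrow) and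
  \<open>q\<close> the vertex called 2.  The slice quiver keeps the vertices; \<open>Inl b\<close> is the arrow \<open>b \<noteq> a\<close> of \<open>Q\<close>, and
  \<open>Inr b\<close> is the new arrow at \<open>p\<close> added for an arrow \<open>b \<noteq> a\<close> at \<open>q\<close>.
\<close>

definition slice_quiver ::
  "('v, 'a) pre_digraph \<Rightarrow> 'a \<Rightarrow> 'v \<Rightarrow> 'v \<Rightarrow> ('v, 'a + 'a) pre_digraph" where
  "slice_quiver Q a p q =
     \<lparr> verts = verts Q,
       arcs = Inl ` (arcs Q - {a}) \<union> Inr ` {b \<in> arcs Q - {a}. tail Q b = q \<or> head Q b = q},
       tail = case_sum (tail Q) (\<lambda>b. if tail Q b = q then p else tail Q b),
       head = case_sum (head Q) (\<lambda>b. if head Q b = q then p else head Q b) \<rparr>"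

definition slice_dim :: "('v \<Rightarrow> nat) \<Rightarrow> 'v \<Rightarrow> 'v \<Rightarrow> 'v \<Rightarrow> nat" where
  "slice_dim \<beta> p q = \<beta>(q := \<beta> q - \<beta> p)"

text \<open>The matrix at \<open>a\<close> is \<open>(I, 0)\<close> or its transpose, according to whether \<open>a\<close> points to \<open>p\<close> or to \<open>q\<close>.\<close>

definition slice_base :: "('v, 'a) pre_digraph \<Rightarrow> ('v \<Rightarrow> nat) \<Rightarrow> 'a \<Rightarrow> 'a rep" where
  "slice_base Q \<beta> a =
     (\<lambda>b\<in>arcs Q. if b = a then mat (\<beta> (head Q a)) (\<beta> (tail Q a)) (\<lambda>(i, j). of_bool (i = j))
                 else 0\<^sub>m (\<beta> (head Q b)) (\<beta> (tail Q b)))"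

text \<open>
  The identification of \<open>Rep Q\<^sub>a \<beta>\<^sub>a\<close> with the sum of the Hom-spaces of the arrows other than \<open>a\<close>, given by
  the splitting of the space at \<open>q\<close> into its first \<open>\<beta> p\<close> coordinates (now living at \<open>p\<close>) and the rest.
\<close>

definition slice_embed ::
  "('v, 'a) pre_digraph \<Rightarrow> ('v \<Rightarrow> nat) \<Rightarrow> 'a \<Rightarrow> 'v \<Rightarrow> ('a + 'a) rep \<Rightarrow> 'a rep" where
  "slice_embed Q \<beta> a q w =
     (\<lambda>b\<in>arcs Q.
        if b = a then 0\<^sub>m (\<beta> (head Q a)) (\<beta> (tail Q a))
        else if tail Q b = q then
          four_block_mat (w (Inr b)) (w (Inl b))
            (0\<^sub>m 0 (dim_col (w (Inr b)))) (0\<^sub>m 0 (dim_col (w (Inl b))))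
        else if head Q b = q then w (Inr b) @\<^sub>r w (Inl b)
        else w (Inl b))"

definition slice_fun ::
  "('v, 'a) pre_digraph \<Rightarrow> ('v \<Rightarrow> nat) \<Rightarrow> 'a \<Rightarrow> 'v \<Rightarrow> 'v
     \<Rightarrow> ('a rep \<Rightarrow> complex) \<Rightarrow> ('a + 'a) rep \<Rightarrow> complex" where
  "slice_fun Q \<beta> a p q f =
     on_Rep (slice_quiver Q a p q) (slice_dim \<beta> p q)
       (\<lambda>w. f (rep_plus Q (slice_base Q \<beta> a) (slice_embed Q \<beta> a q w)))"

text \<open>
  Bernstein-Sato polynomials.  An element \<open>u f\<^sup>s\<close> of the free module \<open>\<complex>[V]\<^sub>f[s] f\<^sup>s\<close> on the formal symbol \<open>f\<^sup>s\<close>,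
  with \<open>V = Rep Q \<beta>\<close>, is represented by its coefficient \<open>u\<close>, viewed as a function of \<open>s \<in> \<complex>\<close> and \<open>W \<in> V\<close>
  with \<open>f W \<noteq> 0\<close>.  The Weyl algebra acts by \<open>\<partial>(u f\<^sup>s) = (\<partial>u + s u \<partial>f / f) f\<^sup>s\<close>.  As \<open>D[s]\<close> is the algebra
  generated by \<open>s\<close>, the coordinates and the partial derivatives, the set \<open>weyl_s_ops Q \<beta> f\<close> is
  the set of all operators by which elements \<open>P(s)\<close> of \<open>D[s]\<close> act on this module.
\<close>

definition pd :: "'a coord \<Rightarrow> ('a rep \<Rightarrow> complex) \<Rightarrow> 'a rep \<Rightarrow> complex" where
  "pd = (\<lambda>(b, i, j) u W. deriv (\<lambda>z. u (W(b := (W b) |\<^sub>m (i, j) \<mapsto> z))) (W b $$ (i, j)))"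

inductive_set weyl_s_ops ::
  "('v, 'a) pre_digraph \<Rightarrow> ('v \<Rightarrow> nat) \<Rightarrow> ('a rep \<Rightarrow> complex)
     \<Rightarrow> ((complex \<Rightarrow> 'a rep \<Rightarrow> complex) \<Rightarrow> complex \<Rightarrow> 'a rep \<Rightarrow> complex) set"
  for Q :: "('v, 'a) pre_digraph" and \<beta> :: "'v \<Rightarrow> nat" and f :: "'a rep \<Rightarrow> complex" where
  scalar: "(\<lambda>u s W. c * u s W) \<in> weyl_s_ops Q \<beta> f"
| svar: "(\<lambda>u s W. s * u s W) \<in> weyl_s_ops Q \<beta> f"
| coord: "x \<in> coords Q \<beta> \<Longrightarrow> (\<lambda>u s W. coord_fun x W * u s W) \<in> weyl_s_ops Q \<beta> f"
| deriv: "x \<in> coords Q \<beta> \<Longrightarrow>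
    (\<lambda>u s W. pd x (u s) W + s * u s W * pd x f W / f W) \<in> weyl_s_ops Q \<beta> f"
| add: "P \<in> weyl_s_ops Q \<beta> f \<Longrightarrow> R \<in> weyl_s_ops Q \<beta> f \<Longrightarrow>
    P + R \<in> weyl_s_ops Q \<beta> f"
| comp: "P \<in> weyl_s_ops Q \<beta> f \<Longrightarrow> R \<in> weyl_s_ops Q \<beta> f \<Longrightarrow>
    P \<circ> R \<in> weyl_s_ops Q \<beta> f"

text \<open>
  \<open>P(s) f\<^sup>s\<^sup>+\<^sup>1 = b(s) f\<^sup>s\<close>: the coefficients of \<open>f\<^sup>s\<^sup>+\<^sup>1 = f f\<^sup>s\<close> and of \<open>b(s) f\<^sup>s\<close> are \<open>f\<close> and \<open>b(s)\<close>.
\<close>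

definition bernstein_sato_ideal ::
  "('v, 'a) pre_digraph \<Rightarrow> ('v \<Rightarrow> nat) \<Rightarrow> ('a rep \<Rightarrow> complex) \<Rightarrow> complex poly set" where
  "bernstein_sato_ideal Q \<beta> f =
     {b. \<exists>P\<in>weyl_s_ops Q \<beta> f. \<forall>s. \<forall>W\<in>Rep Q \<beta>. f W \<noteq> 0 \<longrightarrow> P (\<lambda>s W. f W) s W = poly b s}"

definition bernstein_sato_poly ::
  "('v, 'a) pre_digraph \<Rightarrow> ('v \<Rightarrow> nat) \<Rightarrow> ('a rep \<Rightarrow> complex) \<Rightarrow> complex poly" where
  "bernstein_sato_poly Q \<beta> f =
     (THE b. lead_coeff b = 1 \<and> bernstein_sato_ideal Q \<beta> f = {c. b dvd c})"

text \<open>\<open>[s]\<^sup>d\<^sub>a\<^sub>,\<^sub>b\<close>\<close>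

definition bracket_poly :: "nat \<Rightarrow> nat \<Rightarrow> nat \<Rightarrow> complex poly" where
  "bracket_poly d a b = (\<Prod>i\<in>{a + 1..b}. \<Prod>j<d. [:of_nat (i + j), of_nat d:])"

end

(*
  The Fischer inner product <p, q> = sum of e! p_e conj(q_e), for which multiplication by a coordinate is
  adjoint to the partial derivative, replaces all analysis.  If sigma is multiplicity-free, the dual operator
  f*(d) satisfies f*(d) f^(k+1) = b(k) f^k with b(k) = |f^(k+1)|^2 / |f^k|^2.  This b generates the
  Bernstein-Sato ideal: if P(s) f^(s+1) = c(s) f^s, then c(k) |f^k|^2 = <f^(k+1), P(k)* f^k>, and since
  P(s)* f^s = H(s) f^(s-N) with H polynomial in s, moving f^(k-N) across shows that c / b is a polynomial.

  So the b-functions of f and f_a are compared through norms.  For a semi-invariant h of weight +-D at the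
  vertex p, one has |h|^2 = |h_a|^2 prod_{i = beta_q - beta_p + 1}^{beta_q} i (i+1) ... (i+D-1).
  This is proved one column x of the matrix at the arrow a at a time: h has degree D in x = (x_1, ..., x_n)
  and is killed by the infinitesimal row operations x_j d_i + R_ij, where R_ij and R_ji are adjoint, and
  this forces (k+1) |d_j d_1^k h|^2 = |d_1^(k+1) h|^2, so that Euler's formula compares the norm of h with
  the norm of its coefficient of x_1^D.
*)

theory Submission
  imports Defs "HOL-Library.Poly_Mapping"
begin

text \<open>The obstacle is that \<open>weyl_s_ops\<close> consists of operators on arbitrary
  functions of \<open>s\<close> and \<open>W\<close>, while norms only see polynomials. Every
  operator is therefore used in two ways. At \<open>s = k\<close> it acts on honest polynomials,
  where adjoints exist; for general \<open>s\<close> it keeps a coefficient in the form of a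
  fraction, with a power of \<open>f\<close> below and a polynomial in \<open>s\<close> above, so
  that identities found at natural numbers extend to all \<open>s\<close>. The factor of the theorem
  arises because \<open>f ^ k\<close> has degree k D in each column: consecutive norms contribute
  rising factorials of lengths k D and (k + 1) D, and their quotient at i is the product of i + k D
  + j over j < D. The norm formula also yields the multiplicity claim. It shows that a
  semi-invariant with zero slice is zero, so a semi-invariant is determined by its slice, and the
  dimensions of the weight spaces can only grow in passing to the slice. Acyclicity excludes loops
  and makes every weight an Euler weight, which provides the dimension-like vector of the new
  weight.\<close>

abbreviation lookup :: "('k \<Rightarrow>\<^sub>0 'b :: zero) \<Rightarrow> 'k \<Rightarrow> 'b" where "lookup \<equiv> Poly_Mapping.lookup"
abbreviation keys :: "('k \<Rightarrow>\<^sub>0 'b :: zero) \<Rightarrow> 'k set" where "keys \<equiv> Poly_Mapping.keys"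
abbreviation single :: "'k \<Rightarrow> 'b \<Rightarrow> 'k \<Rightarrow>\<^sub>0 'b :: zero" where "single \<equiv> Poly_Mapping.single"

section \<open>Polynomial rings as finitely supported functions on exponents\<close>

type_synonym 'c mpoly = "('c \<Rightarrow>\<^sub>0 nat) \<Rightarrow>\<^sub>0 complex"

definition cst :: "complex \<Rightarrow> 'c mpoly" where
  "cst c = single 0 c"

definition var :: "'c \<Rightarrow> 'c mpoly" where
  "var x = single (single x 1) 1"

text \<open>The ring of a finite coordinate set is a subset of \<open>mpoly\<close> and not a type
  of its own, because the coordinate sets depend on the quiver and on the dimension vector.\<close>

definition mpolys_in :: "'c set \<Rightarrow> 'c mpoly set" where
  "mpolys_in C = {p. \<forall>e\<in>keys p. keys e \<subseteq> C}"

lemma cst_0 [simp]: "cst 0 = 0"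
  and cst_1 [simp]: "cst 1 = 1"
  and cst_add: "cst (a + b) = cst a + cst b"
  and cst_mult: "cst (a * b) = cst a * cst b"
  and cst_uminus: "cst (- a) = - cst a"
  by (simp_all add: cst_def single_add mult_single single_uminus)

lemma cst_power: "cst (a ^ n) = cst a ^ n"
  by (induction n) (simp_all add: cst_mult)

lemma cst_of_nat: "cst (of_nat n) = of_nat n"
  by (simp add: cst_def)

lemma cst_mult_single: "cst c * single e d = single e (c * d)"
  by (simp add: cst_def mult_single)

lemma poly_mapping_sum_single:
  "p = (\<Sum>e\<in>keys p. single e (lookup p e))"
proof (rule poly_mapping_eqI)
  fix k
  have "(\<Sum>e\<in>keys p. lookup (single e (lookup p e)) k)
      = (\<Sum>e\<in>keys p. if e = k then lookup p k else 0)"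
    by (intro sum.cong) (auto simp: lookup_single)
  also have "\<dots> = lookup p k"
    by (auto simp: in_keys_iff)
  finally show "lookup p k =
      lookup (\<Sum>e\<in>keys p. single e (lookup p e)) k"
    by (simp add: lookup_sum)
qed

lemma poly_mapping_single_induct [case_names zero single add]:
  assumes "P 0"
    and "\<And>e c. P (single e c)"
    and "\<And>p q. P p \<Longrightarrow> P q \<Longrightarrow> P (p + q)"
  shows "P (p :: 'a \<Rightarrow>\<^sub>0 'b :: comm_monoid_add)"
proof -
  have "P (\<Sum>e\<in>A. single e (lookup p e))" if "finite A" for A
    using that by induction (auto intro: assms)
  from this[of "keys p"] show ?thesis
    using poly_mapping_sum_single[of p] by simp
qed

lemma exponent_split:
  assumes "x \<in> keys e"
  shows "e = single x 1 + (e - single x (1::nat))"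
  using assms
  by (intro poly_mapping_eqI) (auto simp: lookup_add lookup_minus lookup_single when_def in_keys_iff)

lemma keys_add_nat: "keys (e + f) = keys e \<union> keys f"
  for e f :: "'c \<Rightarrow>\<^sub>0 nat"
  by (auto simp: in_keys_iff lookup_add)

text \<open>Multiplication enters only through single variables, which is the step where an
  adjointness or a Leibniz rule applies. Monomials are reached by induction on the total degree,
  which drops when one factor is split off.\<close>

lemma mpoly_induct [consumes 1, case_names cst var add]:
  assumes "p \<in> mpolys_in C"
    and c: "\<And>c. P (cst c)"
    and v: "\<And>x p. x \<in> C \<Longrightarrow> p \<in> mpolys_in C \<Longrightarrow> P p \<Longrightarrow> P (var x * p)"
    and a: "\<And>p q. p \<in> mpolys_in C \<Longrightarrow> q \<in> mpolys_in C \<Longrightarrow> P p \<Longrightarrow> P q \<Longrightarrow> P (p + q)"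
  shows "P p"
proof -
  have mono: "P (single e c)" if "keys e \<subseteq> C" for e c
    using that
  proof (induction "\<Sum>x\<in>keys e. lookup e x" arbitrary: e rule: less_induct)
    case less
    show ?case
    proof (cases "e = 0")
      case True
      then show ?thesis using c by (simp add: cst_def)
    next
      case False
      then obtain x where x: "x \<in> keys e"
        by (metis all_not_in_conv in_keys_iff lookup_zero poly_mapping_eqI)
      define e' where "e' = e - single x 1"
      have e: "e = single x 1 + e'"
        using exponent_split[OF x] by (simp add: e'_def)
      have sub: "keys e' \<subseteq> keys e"
        by (subst e, subst keys_add_nat) auto
      have "(\<Sum>y\<in>keys e'. lookup e' y)
          = (\<Sum>y\<in>keys e. lookup e' y)"
        by (rule sum.mono_neutral_left) (use sub in \<open>auto simp: in_keys_iff\<close>)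
      also have "\<dots> < (\<Sum>y\<in>keys e. lookup e y)"
      proof (rule sum_strict_mono_ex1)
        show "\<forall>y\<in>keys e. lookup e' y \<le> lookup e y"
          by (simp add: e'_def lookup_minus)
        show "\<exists>y\<in>keys e. lookup e' y < lookup e y"
          using x by (intro bexI[of _ x]) (auto simp: e'_def lookup_minus in_keys_iff)
      qed simp
      finally have "P (single e' c)"
        using sub less.prems by (intro less.hyps) auto
      then have "P (var x * single e' c)"
        using x less.prems sub by (intro v) (auto simp: mpolys_in_def split: if_splits)
      then show ?thesis
        by (subst e) (simp add: var_def mult_single)
    qed
  qed
  have "P (\<Sum>e\<in>A. single e (lookup p e))
     \<and> (\<Sum>e\<in>A. single e (lookup p e)) \<in> mpolys_in C"
    if "finite A" "A \<subseteq> keys p" for A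
    using that
  proof induction
    case empty
    then show ?case using c[of 0] by (simp add: mpolys_in_def)
  next
    case (insert e A)
    have e: "keys e \<subseteq> C"
      using insert.prems assms(1) by (auto simp: mpolys_in_def)
    then have s: "single e (lookup p e) \<in> mpolys_in C"
      by (auto simp: mpolys_in_def split: if_splits)
    have t: "single e (lookup p e)
        + (\<Sum>e\<in>A. single e (lookup p e)) \<in> mpolys_in C"
      using s insert Poly_Mapping.keys_add by (fastforce simp: mpolys_in_def)
    from a[OF s _ mono[OF e]] t insert show ?case by simp
  qed
  from this[of "keys p"] show ?thesis
    using poly_mapping_sum_single[of p] by simp
qed

lemma mpolys_in_UNIV [simp]: "p \<in> mpolys_in UNIV"
  by (simp add: mpolys_in_def)

lemma mpoly_UNIV_induct [case_names cst var add]: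
  assumes "\<And>c. P (cst c)" "\<And>x p. P p \<Longrightarrow> P (var x * p)" "\<And>p q. P p \<Longrightarrow> P q \<Longrightarrow> P (p + q)"
  shows "P p"
  using mpolys_in_UNIV[of p] by (induction rule: mpoly_induct) (auto intro: assms)

lemma mpolys_in_cst [simp]: "cst c \<in> mpolys_in C"
  by (auto simp: mpolys_in_def cst_def)

lemma mpolys_in_var [simp]: "x \<in> C \<Longrightarrow> var x \<in> mpolys_in C"
  by (auto simp: mpolys_in_def var_def)

lemma mpolys_in_add [simp]: "p \<in> mpolys_in C \<Longrightarrow> q \<in> mpolys_in C \<Longrightarrow> p + q \<in> mpolys_in C"
  using Poly_Mapping.keys_add by (fastforce simp: mpolys_in_def)

lemma mpolys_in_mult [simp]: "p \<in> mpolys_in C \<Longrightarrow> q \<in> mpolys_in C \<Longrightarrow> p * q \<in> mpolys_in C"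
proof -
  assume *: "p \<in> mpolys_in C" "q \<in> mpolys_in C"
  show ?thesis unfolding mpolys_in_def
  proof (clarify)
    fix e x assume "e \<in> keys (p * q)" and x: "x \<in> keys e"
    then obtain a b where "a \<in> keys p" "b \<in> keys q" "e = a + b"
      using Poly_Mapping.keys_mult by blast
    with * x show "x \<in> C" by (auto simp: mpolys_in_def keys_add_nat)
  qed
qed

lemma mpolys_in_0 [simp]: "0 \<in> mpolys_in C"
  and mpolys_in_1 [simp]: "1 \<in> mpolys_in C"
  using mpolys_in_cst[of 0 C] mpolys_in_cst[of 1 C] by simp_all

lemma mpolys_in_uminus [simp]: "p \<in> mpolys_in C \<Longrightarrow> - p \<in> mpolys_in C"
  using mpolys_in_mult[OF mpolys_in_cst[of "-1" C], of p] by (simp add: cst_uminus)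

lemma mpolys_in_diff [simp]: "p \<in> mpolys_in C \<Longrightarrow> q \<in> mpolys_in C \<Longrightarrow> p - q \<in> mpolys_in C"
  using mpolys_in_add[of p C "- q"] by simp

lemma mpolys_in_sum: "(\<And>i. i \<in> I \<Longrightarrow> f i \<in> mpolys_in C) \<Longrightarrow> sum f I \<in> mpolys_in C"
  by (induction I rule: infinite_finite_induct) auto

lemma mpolys_in_power [simp]: "p \<in> mpolys_in C \<Longrightarrow> p ^ n \<in> mpolys_in C"
  by (induction n) auto

subsection \<open>Homomorphisms out of polynomial rings\<close>

text \<open>Three rings serve as targets: the complex numbers for evaluation, polynomials for
  substitution, and univariate polynomials for restriction to a line.\<close>

definition scalar_embedding :: "(complex \<Rightarrow> 'r :: comm_ring_1) \<Rightarrow> bool" where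
  "scalar_embedding \<iota> \<longleftrightarrow> \<iota> 0 = 0 \<and> \<iota> 1 = 1 \<and>
     (\<forall>a b. \<iota> (a + b) = \<iota> a + \<iota> b) \<and> (\<forall>a b. \<iota> (a * b) = \<iota> a * \<iota> b)"

definition mpoly_hom :: "(complex \<Rightarrow> 'r :: comm_ring_1) \<Rightarrow> ('c \<Rightarrow> 'r) \<Rightarrow> 'c mpoly \<Rightarrow> 'r" where
  "mpoly_hom \<iota> \<phi> p = (\<Sum>e\<in>keys p. \<iota> (lookup p e) *
      (\<Prod>x\<in>keys e. \<phi> x ^ lookup e x))"

context
  fixes \<iota> :: "complex \<Rightarrow> 'r :: comm_ring_1"
  assumes \<iota>: "scalar_embedding \<iota>"
begin

lemma mpoly_hom_superset:
  assumes "finite K" "keys p \<subseteq> K"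
  shows "mpoly_hom \<iota> \<phi> p = (\<Sum>e\<in>K. \<iota> (lookup p e) *
      (\<Prod>x\<in>keys e. \<phi> x ^ lookup e x))"
  unfolding mpoly_hom_def using assms \<iota>
  by (intro sum.mono_neutral_left) (auto simp: in_keys_iff scalar_embedding_def)

lemma mpoly_hom_add: "mpoly_hom \<iota> \<phi> (p + q) = mpoly_hom \<iota> \<phi> p + mpoly_hom \<iota> \<phi> q"
proof -
  let ?K = "keys p \<union> keys q"
  show ?thesis
    using \<iota> Poly_Mapping.keys_add[of p q]
    by (subst (1 2 3) mpoly_hom_superset[of ?K])
       (auto simp: lookup_add scalar_embedding_def sum.distrib algebra_simps)
qed

lemma mpoly_hom_single: "mpoly_hom \<iota> \<phi> (single e c) =
    \<iota> c * (\<Prod>x\<in>keys e. \<phi> x ^ lookup e x)"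
  using \<iota> by (subst mpoly_hom_superset[of "{e}"]) auto

lemma mpoly_hom_cst [simp]: "mpoly_hom \<iota> \<phi> (cst c) = \<iota> c"
  by (simp add: cst_def mpoly_hom_single)

lemma mpoly_hom_var [simp]: "mpoly_hom \<iota> \<phi> (var x) = \<phi> x"
  using \<iota> by (simp add: var_def mpoly_hom_single scalar_embedding_def)

lemma mpoly_hom_0 [simp]: "mpoly_hom \<iota> \<phi> 0 = 0"
  by (simp add: mpoly_hom_def)

lemma mpoly_hom_1 [simp]: "mpoly_hom \<iota> \<phi> 1 = 1"
  using mpoly_hom_cst[of \<phi> 1] \<iota> by (simp add: scalar_embedding_def)

lemma mpoly_hom_mult: "mpoly_hom \<iota> \<phi> (p * q) = mpoly_hom \<iota> \<phi> p * mpoly_hom \<iota> \<phi> q"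
proof (induction p rule: poly_mapping_single_induct)
  case (single e c)
  show ?case
  proof (induction q rule: poly_mapping_single_induct)
    case (single f d)
    let ?m = "\<lambda>K e. \<Prod>x\<in>K. \<phi> x ^ lookup e x"
    have sup: "?m (keys e) e = ?m K e"
      if "finite K" "keys e \<subseteq> K" for e K
      using that by (intro prod.mono_neutral_left) (auto simp: in_keys_iff)
    let ?K = "keys e \<union> keys f"
    have "?m (keys (e + f)) (e + f) = ?m (keys e) e * ?m (keys f) f"
      by (simp add: sup[of ?K e] sup[of ?K f] keys_add_nat lookup_add power_add prod.distrib)
    then show ?case
      using \<iota> by (simp add: mult_single mpoly_hom_single scalar_embedding_def)
  qed (simp_all add: mpoly_hom_add algebra_simps)
qed (simp_all add: mpoly_hom_add algebra_simps)

lemma mpoly_hom_uminus: "mpoly_hom \<iota> \<phi> (- p) = - mpoly_hom \<iota> \<phi> p"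
  using mpoly_hom_add[of \<phi> p "- p"] by (simp add: eq_neg_iff_add_eq_0 add.commute)

lemma mpoly_hom_diff: "mpoly_hom \<iota> \<phi> (p - q) = mpoly_hom \<iota> \<phi> p - mpoly_hom \<iota> \<phi> q"
  using mpoly_hom_add[of \<phi> p "- q"] by (simp add: mpoly_hom_uminus)

lemma mpoly_hom_sum: "mpoly_hom \<iota> \<phi> (sum f I) = (\<Sum>i\<in>I. mpoly_hom \<iota> \<phi> (f i))"
  by (induction I rule: infinite_finite_induct) (auto simp: mpoly_hom_add)

lemma mpoly_hom_power: "mpoly_hom \<iota> \<phi> (p ^ n) = mpoly_hom \<iota> \<phi> p ^ n"
  by (induction n) (auto simp: mpoly_hom_mult)

end

lemma mpoly_hom_cong:
  assumes "p \<in> mpolys_in C" "\<And>x. x \<in> C \<Longrightarrow> \<phi> x = \<psi> x"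
  shows "mpoly_hom \<iota> \<phi> p = mpoly_hom \<iota> \<psi> p"
proof -
  have "\<phi> x = \<psi> x" if "e \<in> keys p" "x \<in> keys e" for e x
    using that assms by (auto simp: mpolys_in_def)
  then show ?thesis
    unfolding mpoly_hom_def
    by (intro sum.cong prod.cong arg_cong2[of _ _ _ _ "(*)"] refl) simp
qed

lemma scalar_embedding_id [simp]: "scalar_embedding (\<lambda>c. c)"
  by (simp add: scalar_embedding_def)

lemma scalar_embedding_cst [simp]: "scalar_embedding cst"
  by (simp add: scalar_embedding_def cst_add cst_mult)

lemma scalar_embedding_pCons [simp]: "scalar_embedding (\<lambda>c. [:c:])"
  by (simp add: scalar_embedding_def)

abbreviation mpoly_eval :: "('c \<Rightarrow> complex) \<Rightarrow> 'c mpoly \<Rightarrow> complex" where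
  "mpoly_eval \<equiv> mpoly_hom (\<lambda>c. c)"

abbreviation mpoly_subst :: "('c \<Rightarrow> 'd mpoly) \<Rightarrow> 'c mpoly \<Rightarrow> 'd mpoly" where
  "mpoly_subst \<equiv> mpoly_hom cst"

lemmas mpoly_hom_simps = mpoly_hom_add mpoly_hom_mult mpoly_hom_uminus mpoly_hom_diff
  mpoly_hom_sum mpoly_hom_power

lemma mpoly_eval_subst: "mpoly_eval v (mpoly_subst \<phi> p) = mpoly_eval (\<lambda>x. mpoly_eval v (\<phi> x)) p"
  by (induction p rule: mpoly_UNIV_induct) (simp_all add: mpoly_hom_simps)

lemma mpoly_subst_in:
  assumes "p \<in> mpolys_in C" "\<And>x. x \<in> C \<Longrightarrow> \<phi> x \<in> mpolys_in C'"
  shows "mpoly_subst \<phi> p \<in> mpolys_in C'"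
  using assms(1) by (induction rule: mpoly_induct) (simp_all add: mpoly_hom_simps assms)

subsection \<open>Partial derivatives\<close>

text \<open>Truncated subtraction of exponents does no harm: where it truncates, the factor
  \<open>lookup e x\<close> is zero.\<close>

definition pderiv_mp :: "'c \<Rightarrow> 'c mpoly \<Rightarrow> 'c mpoly" where
  "pderiv_mp x p = (\<Sum>e\<in>keys p. single (e - single x 1)
      (lookup p e * of_nat (lookup e x)))"

lemma pderiv_mp_superset:
  assumes "finite K" "keys p \<subseteq> K"
  shows "pderiv_mp x p = (\<Sum>e\<in>K. single (e - single x 1)
      (lookup p e * of_nat (lookup e x)))"
  unfolding pderiv_mp_def using assms by (intro sum.mono_neutral_left) (auto simp: in_keys_iff)

lemma pderiv_mp_add: "pderiv_mp x (p + q) = pderiv_mp x p + pderiv_mp x q"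
proof -
  let ?K = "keys p \<union> keys q"
  show ?thesis
    using Poly_Mapping.keys_add[of p q]
    by (subst (1 2 3) pderiv_mp_superset[of ?K])
       (auto simp: lookup_add distrib_right single_add sum.distrib)
qed

lemma pderiv_mp_single: "pderiv_mp x (single e c) =
    single (e - single x 1) (c * of_nat (lookup e x))"
  by (subst pderiv_mp_superset[of "{e}"]) auto

lemma pderiv_mp_0 [simp]: "pderiv_mp x 0 = 0"
  by (simp add: pderiv_mp_def)

lemma pderiv_mp_cst [simp]: "pderiv_mp x (cst c) = 0"
  by (simp add: cst_def pderiv_mp_single)

lemma pderiv_mp_var: "pderiv_mp x (var y) = (if x = y then 1 else 0)"
  by (auto simp: var_def pderiv_mp_single lookup_single when_def)

lemma pderiv_mp_mult: "pderiv_mp x (p * q) = pderiv_mp x p * q + p * pderiv_mp x q"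
proof (induction p rule: poly_mapping_single_induct)
  case (single e c)
  show ?case
  proof (induction q rule: poly_mapping_single_induct)
    case (single f d)
    let ?x = "single x (1::nat)"
    \<comment> \<open>The two exponents may differ if \<open>x\<close> does not divide the first
      monomial, but then both coefficients are zero.\<close>
    have 1: "single (e - ?x + f) (c * of_nat (lookup e x) * d)
        = single (e + f - ?x) (c * of_nat (lookup e x) * d)"
    proof (cases "lookup e x = 0")
      case False
      then have "e - ?x + f = e + f - ?x"
        by (intro poly_mapping_eqI) (auto simp: lookup_add lookup_minus lookup_single when_def)
      then show ?thesis by simp
    qed simp
    have 2: "single (e + (f - ?x)) (c * (d * of_nat (lookup f x)))
        = single (e + f - ?x) (c * (d * of_nat (lookup f x)))"
    proof (cases "lookup f x = 0")
      case False
      then have "e + (f - ?x) = e + f - ?x"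
        by (intro poly_mapping_eqI) (auto simp: lookup_add lookup_minus lookup_single when_def)
      then show ?thesis by simp
    qed simp
    show ?case
      unfolding mult_single pderiv_mp_single 1 2
      by (simp add: lookup_add algebra_simps flip: single_add)
  qed (simp_all add: pderiv_mp_add algebra_simps)
qed (simp_all add: pderiv_mp_add algebra_simps)

lemma pderiv_mp_1 [simp]: "pderiv_mp x 1 = 0"
  using pderiv_mp_cst[of x 1] by simp

lemma pderiv_mp_cst_mult: "pderiv_mp x (cst c * p) = cst c * pderiv_mp x p"
  by (simp add: pderiv_mp_mult)

lemma pderiv_mp_uminus: "pderiv_mp x (- p) = - pderiv_mp x p"
  using pderiv_mp_add[of x p "- p"] by (simp add: eq_neg_iff_add_eq_0 add.commute)

lemma pderiv_mp_sum: "pderiv_mp x (sum f I) = (\<Sum>i\<in>I. pderiv_mp x (f i))"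
  by (induction I rule: infinite_finite_induct) (auto simp: pderiv_mp_add)

lemma pderiv_mp_commute: "pderiv_mp x (pderiv_mp y p) = pderiv_mp y (pderiv_mp x p)"
  by (induction p rule: mpoly_UNIV_induct)
     (auto simp: pderiv_mp_add pderiv_mp_mult pderiv_mp_var algebra_simps)

lemma pderiv_mp_in [simp]: "p \<in> mpolys_in C \<Longrightarrow> pderiv_mp x p \<in> mpolys_in C"
  by (induction rule: mpoly_induct) (simp_all add: pderiv_mp_add pderiv_mp_mult pderiv_mp_var)

text \<open>In characteristic zero a monomial divisible by \<open>x\<close> has a nonzero
  derivative, and distinct such monomials have derivatives with distinct exponents, so nothing
  cancels.\<close>

lemma mpolys_in_pderiv_eq_0:
  assumes "p \<in> mpolys_in C" "\<And>x. x \<in> X \<Longrightarrow> pderiv_mp x p = 0"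
  shows "p \<in> mpolys_in (C - X)"
proof -
  have "lookup e x = 0" if x: "x \<in> X" and e: "e \<in> keys p" for x e
  proof (rule ccontr)
    assume nz: "lookup e x \<noteq> 0"
    let ?x = "single x (1::nat)"
    have eq: "lookup (single (f - ?x)
          (lookup p f * of_nat (lookup f x))) (e - ?x)
        = (if f = e then lookup p e * of_nat (lookup e x) else 0)"
      (is "?l = ?r") for f
    proof (cases "lookup f x = 0 \<or> f = e")
      case False
      then have "f - ?x \<noteq> e - ?x"
        using nz exponent_split[of x e] exponent_split[of x f] by (auto simp: in_keys_iff)
      with False show ?thesis by (auto simp: lookup_single when_def)
    qed (use nz in auto)
    have "lookup (pderiv_mp x p) (e - ?x) =
        lookup p e * of_nat (lookup e x)"
      using e by (simp add: pderiv_mp_def lookup_sum eq del: One_nat_def)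
    with assms(2)[OF x] nz e show False by (simp add: in_keys_iff)
  qed
  with assms(1) show ?thesis
    by (auto simp: mpolys_in_def in_keys_iff)
qed

lemma has_field_derivative_mpoly_eval:
  "((\<lambda>z. mpoly_eval (v(x := z)) p) has_field_derivative mpoly_eval v (pderiv_mp x p)) (at (v x))"
proof (induction p rule: mpoly_UNIV_induct)
  case (cst c)
  then show ?case by simp
next
  case (add p q)
  then show ?case by (simp add: mpoly_hom_simps pderiv_mp_add DERIV_add)
next
  case (var y p)
  have "((\<lambda>z. (v(x := z)) y) has_field_derivative (if x = y then 1 else 0)) (at (v x))"
    by (auto intro!: derivative_eq_intros)
  from DERIV_mult[OF this var] show ?case
    by (auto simp: mpoly_hom_simps pderiv_mp_mult pderiv_mp_var algebra_simps)
qed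

subsection \<open>The Fischer inner product\<close>

definition exponent_fact :: "('c \<Rightarrow>\<^sub>0 nat) \<Rightarrow> real" where
  "exponent_fact e = (\<Prod>x\<in>keys e. fact (lookup e x))"

definition fischer :: "'c mpoly \<Rightarrow> 'c mpoly \<Rightarrow> complex" where
  "fischer p q = (\<Sum>e\<in>keys p. of_real (exponent_fact e) *
      lookup p e * cnj (lookup q e))"

definition fischer_norm :: "'c mpoly \<Rightarrow> real" where
  "fischer_norm p = Re (fischer p p)"

lemma exponent_fact_pos: "exponent_fact e > 0"
  by (auto simp: exponent_fact_def intro: prod_pos)

lemma exponent_fact_superset:
  assumes "finite K" "keys e \<subseteq> K"
  shows "exponent_fact e = (\<Prod>x\<in>K. fact (lookup e x))"
  unfolding exponent_fact_def using assms by (intro prod.mono_neutral_left) (auto simp: in_keys_iff)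

text \<open>This recursion of the weights is what makes multiplication by \<open>x\<close> adjoint
  to the derivative.\<close>

lemma exponent_fact_Suc:
  "exponent_fact (single x 1 + e) = (of_nat (lookup e x) + 1) * exponent_fact e"
proof -
  let ?K = "insert x (keys e)"
  have "exponent_fact (single x 1 + e)
      = (\<Prod>y\<in>?K. fact (lookup (single x 1 + e) y))"
    by (rule exponent_fact_superset) (auto simp: keys_add_nat)
  also have "\<dots> = (\<Prod>y\<in>?K. (if y = x then of_nat (lookup e x) + 1 else 1) *
      fact (lookup e y))"
    by (intro prod.cong refl) (auto simp: lookup_add lookup_single when_def algebra_simps)
  also have "\<dots> = (of_nat (lookup e x) + 1) * exponent_fact e"
    unfolding prod.distrib by (subst exponent_fact_superset[of ?K e]) (auto simp: prod.delta)
  finally show ?thesis .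
qed

lemma fischer_superset:
  assumes "finite K" "keys p \<subseteq> K"
  shows "fischer p q = (\<Sum>e\<in>K. of_real (exponent_fact e) *
      lookup p e * cnj (lookup q e))"
  unfolding fischer_def using assms by (intro sum.mono_neutral_left) (auto simp: in_keys_iff)

lemma fischer_cnj: "cnj (fischer p q) = fischer q p"
proof -
  let ?K = "keys p \<union> keys q"
  show ?thesis
    by (subst (1 2) fischer_superset[of ?K]) (auto simp: mult_ac)
qed

lemma fischer_add_left: "fischer (p + p') q = fischer p q + fischer p' q"
proof -
  let ?K = "keys p \<union> keys p'"
  show ?thesis
    using Poly_Mapping.keys_add[of p p']
    by (subst (1 2 3) fischer_superset[of ?K]) (auto simp: lookup_add sum.distrib algebra_simps)
qed

lemma fischer_add_right: "fischer p (q + q') = fischer p q + fischer p q'"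
  using fischer_add_left[of q q' p] by (metis fischer_cnj complex_cnj_add)

lemma fischer_0_left [simp]: "fischer 0 q = 0"
  by (simp add: fischer_def)

lemma fischer_0_right [simp]: "fischer p 0 = 0"
  by (simp add: fischer_def)

lemma fischer_single_left: "fischer (single e c) q =
    of_real (exponent_fact e) * c * cnj (lookup q e)"
  by (subst fischer_superset[of "{e}"]) auto

lemma fischer_cst_left: "fischer (cst c * p) q = c * fischer p q"
  by (induction p rule: poly_mapping_single_induct)
     (simp_all add: fischer_add_left cst_mult_single fischer_single_left algebra_simps)

lemma fischer_cst_right: "fischer p (cst c * q) = cnj c * fischer p q"
  using fischer_cst_left[of c q p] by (metis fischer_cnj complex_cnj_mult)

lemma fischer_uminus_left: "fischer (- p) q = - fischer p q"
  using fischer_cst_left[of "-1" p q] by (simp add: cst_uminus)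

lemma fischer_uminus_right: "fischer p (- q) = - fischer p q"
  using fischer_cst_right[of p "-1" q] by (simp add: cst_uminus)

lemma fischer_diff_left: "fischer (p - p') q = fischer p q - fischer p' q"
  using fischer_add_left[of p "- p'" q] by (simp add: fischer_uminus_left)

lemma fischer_diff_right: "fischer p (q - q') = fischer p q - fischer p q'"
  using fischer_add_right[of p q "- q'"] by (simp add: fischer_uminus_right)

lemma fischer_sum_left: "fischer (sum f I) q = (\<Sum>i\<in>I. fischer (f i) q)"
  by (induction I rule: infinite_finite_induct) (auto simp: fischer_add_left)

lemma fischer_sum_right: "fischer p (sum f I) = (\<Sum>i\<in>I. fischer p (f i))"
  by (induction I rule: infinite_finite_induct) (auto simp: fischer_add_right)

lemma fischer_var_left: "fischer (var x * p) q = fischer p (pderiv_mp x q)"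
proof (induction p rule: poly_mapping_single_induct)
  case (single e c)
  show ?case
  proof (induction q rule: poly_mapping_single_induct)
    case (single f d)
    let ?x = "single x (1::nat)"
    show ?case
    proof (cases "x \<in> keys f")
      case False
      then have "?x + e \<noteq> f" by (auto simp: keys_add_nat)
      with False show ?thesis
        by (auto simp: var_def mult_single pderiv_mp_single fischer_single_left lookup_single
            in_keys_iff when_def)
    next
      case True
      define g where "g = f - ?x"
      have f: "f = ?x + g" using exponent_split[OF True] by (simp add: g_def)
      show ?thesis
        unfolding var_def mult_single pderiv_mp_single fischer_single_left g_def[symmetric]
        unfolding f exponent_fact_Suc
        by (auto simp: lookup_single lookup_add when_def algebra_simps)
    qed
  qed (simp_all add: fischer_add_right pderiv_mp_add)
qed (simp_all add: fischer_add_left algebra_simps)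

lemma fischer_var_right: "fischer p (var x * q) = fischer (pderiv_mp x p) q"
  using fischer_var_left[of x q p] by (metis fischer_cnj)

lemma fischer_self: "fischer p p = of_real (fischer_norm p)"
  using fischer_cnj[of p p] unfolding fischer_norm_def
  by (metis Reals_cnj_iff of_real_Re)

lemma fischer_norm_eq: "fischer_norm p =
    (\<Sum>e\<in>keys p. exponent_fact e * (cmod (lookup p e))\<^sup>2)"
  unfolding fischer_norm_def fischer_def Re_sum
  by (intro sum.cong refl) (simp add: mult.assoc complex_norm_square[symmetric] del: of_real_power)

lemma fischer_norm_nonneg [simp]: "fischer_norm p \<ge> 0"
  unfolding fischer_norm_eq by (intro sum_nonneg mult_nonneg_nonneg) (auto simp: exponent_fact_pos less_imp_le)

lemma fischer_norm_0 [simp]: "fischer_norm 0 = 0"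
  by (simp add: fischer_norm_eq)

lemma fischer_norm_eq_0_iff [simp]: "fischer_norm p = 0 \<longleftrightarrow> p = 0"
proof
  assume "fischer_norm p = 0"
  then have "\<forall>e\<in>keys p. exponent_fact e * (cmod (lookup p e))\<^sup>2 = 0"
    unfolding fischer_norm_eq
    by (subst (asm) sum_nonneg_eq_0_iff) (auto simp: exponent_fact_pos less_imp_le)
  then have "lookup p e = 0" for e
    using exponent_fact_pos[of e] by (cases "e \<in> keys p") (auto simp: in_keys_iff)
  then show "p = 0" by (intro poly_mapping_eqI) simp
qed simp

lemma fischer_norm_pos_iff [simp]: "fischer_norm p > 0 \<longleftrightarrow> p \<noteq> 0"
  using fischer_norm_nonneg[of p] fischer_norm_eq_0_iff[of p] by linarith

text \<open>The difference is itself an admissible test polynomial. Restricting the tests to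
  \<open>C\<close> matters for linear substitutions, whose adjoint is computed on polynomials in the
  given coordinates.\<close>

lemma fischer_eqI_in:
  assumes "\<And>p. p \<in> mpolys_in C \<Longrightarrow> fischer p q = fischer p q'" "q \<in> mpolys_in C" "q' \<in> mpolys_in C"
  shows "q = q'"
proof -
  have "fischer (q - q') (q - q') = 0"
    using assms by (simp add: fischer_diff_right)
  then show ?thesis by (simp add: fischer_self)
qed

lemmas fischer_eqI = fischer_eqI_in[OF _ mpolys_in_UNIV mpolys_in_UNIV]

lemma fischer_norm_cst_mult: "fischer_norm (cst c * p) = (cmod c)\<^sup>2 * fischer_norm p"
proof -
  have "complex_of_real (fischer_norm (cst c * p)) = of_real ((cmod c)\<^sup>2 * fischer_norm p)"
    unfolding of_real_mult fischer_self[symmetric] fischer_cst_left fischer_cst_right complex_norm_square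
    by (simp add: mult_ac)
  then show ?thesis by (simp only: of_real_eq_iff)
qed

lemma fischer_cst: "fischer (cst c) q = c * cnj (mpoly_eval (\<lambda>_. 0) q)"
proof (induction q rule: mpoly_UNIV_induct)
  case (cst d)
  then show ?case by (simp add: cst_def fischer_single_left mpoly_hom_single exponent_fact_def)
next
  case (add p q)
  then show ?case by (simp add: fischer_add_right mpoly_hom_simps algebra_simps)
next
  case (var x p)
  then show ?case by (simp add: fischer_var_right mpoly_hom_simps)
qed

subsection \<open>Polynomials as functions\<close>

text \<open>A polynomial that vanishes as a function has derivatives that vanish as functions. In a
  pairing the variables of the other factor move across as derivatives until only a value at the
  origin is left, so the pairing of \<open>p\<close> with itself is zero.\<close>

lemma mpoly_eq_0I:
  assumes "\<And>v. mpoly_eval v p = 0"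
  shows "p = 0"
proof -
  have "fischer q p = 0" for q
    using assms
  proof (induction q arbitrary: p rule: mpoly_UNIV_induct)
    case (var x q)
    have "mpoly_eval v (pderiv_mp x p) = 0" for v
      using has_field_derivative_mpoly_eval[of v x p] var.prems
      by (auto intro: DERIV_unique[OF _ DERIV_const])
    then show ?case by (simp add: fischer_var_left var.IH)
  qed (simp_all add: fischer_cst fischer_add_left)
  from this[of p] show ?thesis by (simp add: fischer_self)
qed

lemma mpoly_eqI:
  assumes "\<And>v. mpoly_eval v p = mpoly_eval v q"
  shows "p = q"
  using mpoly_eq_0I[of "p - q"] assms by (simp add: mpoly_hom_simps)

lemma poly_mpoly_line:
  "poly (mpoly_hom (\<lambda>c. [:c:]) (\<lambda>x. [:v x, w x:]) p) t = mpoly_eval (\<lambda>x. v x + t * w x) p"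
  by (induction p rule: mpoly_UNIV_induct) (simp_all add: mpoly_hom_simps algebra_simps)

text \<open>Restriction to the line from a point where \<open>p\<close> is nonzero (parameter 0) to
  one where \<open>q\<close> is nonzero (parameter 1) reduces the claim to univariate
  polynomials.\<close>

lemma mpoly_mult_eq_0_iff [simp]: "p * q = 0 \<longleftrightarrow> p = 0 \<or> q = (0 :: 'c mpoly)"
proof
  assume pq: "p * q = 0"
  show "p = 0 \<or> q = 0"
  proof (rule ccontr)
    assume "\<not> ?thesis"
    then obtain v u where v: "mpoly_eval v p \<noteq> 0" and u: "mpoly_eval u q \<noteq> 0"
      using mpoly_eq_0I by metis
    let ?h = "mpoly_hom (\<lambda>c. [:c:]) (\<lambda>x. [:v x, u x - v x:])"
    have "?h p \<noteq> 0" using v poly_mpoly_line[of v "\<lambda>x. u x - v x" p 0] by auto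
    moreover have "?h q \<noteq> 0" using u poly_mpoly_line[of v "\<lambda>x. u x - v x" q 1] by auto
    moreover have "?h p * ?h q = 0" using pq by (simp flip: mpoly_hom_mult)
    ultimately show False by simp
  qed
qed auto

lemma mpoly_power_eq_0_iff [simp]: "p ^ n = 0 \<longleftrightarrow> p = (0 :: 'c mpoly) \<and> n > 0"
  by (induction n) auto

lemma mpoly_mult_left_cancel: "r \<noteq> 0 \<Longrightarrow> r * p = r * q \<longleftrightarrow> p = (q :: 'c mpoly)"
  using mpoly_mult_eq_0_iff[of r "p - q"] by (auto simp: right_diff_distrib)

text \<open>Multiplying by \<open>r\<close> removes the points where nothing is known, and
  \<open>r\<close> can be cancelled.\<close>

lemma mpoly_eqI_off_zeros:
  assumes "r \<noteq> 0" "\<And>v. mpoly_eval v r \<noteq> 0 \<Longrightarrow> mpoly_eval v p = mpoly_eval v q"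
  shows "p = q"
proof -
  have "r * p = r * q"
    by (rule mpoly_eqI) (use assms(2) in \<open>auto simp: mpoly_hom_simps\<close>)
  then show ?thesis using assms(1) by (simp add: mpoly_mult_left_cancel)
qed

subsection \<open>Linear substitutions and linear vector fields\<close>

definition lin_subst :: "('c \<Rightarrow> 'd \<Rightarrow> complex) \<Rightarrow> 'd set \<Rightarrow> 'c mpoly \<Rightarrow> 'd mpoly" where
  "lin_subst a D = mpoly_subst (\<lambda>x. \<Sum>y\<in>D. cst (a x y) * var y)"

lemma mpoly_eval_lin_subst:
  "mpoly_eval v (lin_subst a D p) = mpoly_eval (\<lambda>x. \<Sum>y\<in>D. a x y * v y) p"
  by (simp add: lin_subst_def mpoly_eval_subst mpoly_hom_simps)

lemma lin_subst_simps:
  "lin_subst a D (cst c) = cst c"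
  "lin_subst a D 0 = 0"
  "lin_subst a D 1 = 1"
  "lin_subst a D (p + q) = lin_subst a D p + lin_subst a D q"
  "lin_subst a D (p * q) = lin_subst a D p * lin_subst a D q"
  "lin_subst a D (p ^ n) = lin_subst a D p ^ n"
  "lin_subst a D (var x) = (\<Sum>y\<in>D. cst (a x y) * var y)"
  by (simp_all add: lin_subst_def mpoly_hom_simps)

lemma lin_subst_in: "lin_subst a D p \<in> mpolys_in D"
  unfolding lin_subst_def
  by (rule mpoly_subst_in[OF mpolys_in_UNIV]) (auto intro!: mpolys_in_sum)

lemma pderiv_lin_subst:
  assumes "p \<in> mpolys_in C" "finite C" "finite D" "y \<in> D"
  shows "pderiv_mp y (lin_subst a D p) = (\<Sum>x\<in>C. cst (a x y) * lin_subst a D (pderiv_mp x p))"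
  using assms(1)
proof (induction rule: mpoly_induct)
  case (cst c)
  then show ?case by (simp add: lin_subst_simps lin_subst_def)
next
  case (add p q)
  then show ?case by (simp add: lin_subst_simps pderiv_mp_add sum.distrib algebra_simps)
next
  case (var x p)
  have d: "pderiv_mp y (\<Sum>y\<in>D. cst (a x y) * var y) = cst (a x y)"
  proof -
    have "pderiv_mp y (\<Sum>y\<in>D. cst (a x y) * var y) = (\<Sum>z\<in>D. if z = y then cst (a x z) else 0)"
      unfolding pderiv_mp_sum by (intro sum.cong refl) (auto simp: pderiv_mp_mult pderiv_mp_var)
    also have "\<dots> = cst (a x y)" using assms by (simp add: sum.delta)
    finally show ?thesis .
  qed
  have "(\<Sum>z\<in>C. cst (a z y) * lin_subst a D (pderiv_mp z (var x * p))) =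
     (\<Sum>z\<in>C. if z = x then cst (a z y) * lin_subst a D p else 0) +
     lin_subst a D (var x) * (\<Sum>z\<in>C. cst (a z y) * lin_subst a D (pderiv_mp z p))"
    unfolding sum_distrib_left sum.distrib[symmetric]
    by (intro sum.cong refl)
       (auto simp: pderiv_mp_mult pderiv_mp_var lin_subst_simps algebra_simps)
  also have "\<dots> = cst (a x y) * lin_subst a D p + lin_subst a D (var x) * pderiv_mp y (lin_subst a D p)"
    using assms(2) var by (simp add: sum.delta)
  also have "\<dots> = pderiv_mp y (lin_subst a D (var x * p))"
    unfolding lin_subst_simps pderiv_mp_mult d ..
  finally show ?case ..
qed

text \<open>Induction on \<open>p\<close>: a variable on the left becomes a derivative on the right,
  and the chain rule distributes it over the new variables with the conjugate coefficients.\<close>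

lemma fischer_lin_subst:
  assumes "p \<in> mpolys_in C" "q \<in> mpolys_in D" "finite C" "finite D"
  shows "fischer (lin_subst a D p) q = fischer p (lin_subst (\<lambda>y x. cnj (a x y)) C q)"
  using assms(1,2)
proof (induction arbitrary: q rule: mpoly_induct)
  case (cst c)
  then show ?case by (simp add: lin_subst_simps fischer_cst mpoly_eval_lin_subst)
next
  case (add p p')
  then show ?case by (simp add: lin_subst_simps fischer_add_left)
next
  case (var x p)
  have "fischer (lin_subst a D (var x * p)) q
      = (\<Sum>y\<in>D. a x y * fischer (lin_subst a D p) (pderiv_mp y q))"
    by (simp add: lin_subst_simps sum_distrib_right fischer_sum_left mult.assoc fischer_cst_left
        fischer_var_left)
  also have "\<dots> = (\<Sum>y\<in>D. a x y * fischer p (lin_subst (\<lambda>y x. cnj (a x y)) C (pderiv_mp y q)))"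
    using var by simp
  also have "\<dots> = fischer p (\<Sum>y\<in>D. cst (cnj (a x y)) *
      lin_subst (\<lambda>y x. cnj (a x y)) C (pderiv_mp y q))"
    by (simp add: fischer_sum_right fischer_cst_right)
  also have "\<dots> = fischer p (pderiv_mp x (lin_subst (\<lambda>y x. cnj (a x y)) C q))"
    using var assms by (subst pderiv_lin_subst[of q D]) auto
  finally show ?case by (simp add: fischer_var_left)
qed

text \<open>The linear vector field with matrix \<open>N\<close>, that is, the derivative at t = 0
  of the substitution by \<open>1 + t N\<close>.\<close>

definition lin_field :: "('c \<Rightarrow> 'c \<Rightarrow> complex) \<Rightarrow> 'c set \<Rightarrow> 'c mpoly \<Rightarrow> 'c mpoly" where
  "lin_field N C p = (\<Sum>u\<in>C. \<Sum>w\<in>C. cst (N u w) * (var w * pderiv_mp u p))"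

lemma fischer_lin_field:
  "fischer (lin_field N C p) q = fischer p (lin_field (\<lambda>u w. cnj (N w u)) C q)"
proof -
  have "fischer (lin_field N C p) q = (\<Sum>u\<in>C. \<Sum>w\<in>C. N u w * fischer (pderiv_mp u p) (pderiv_mp w q))"
    by (simp add: lin_field_def fischer_sum_left fischer_cst_left fischer_var_left)
  also have "\<dots> = (\<Sum>w\<in>C. \<Sum>u\<in>C. N u w * fischer (pderiv_mp u p) (pderiv_mp w q))"
    by (rule sum.swap)
  also have "\<dots> = fischer p (lin_field (\<lambda>u w. cnj (N w u)) C q)"
    by (simp add: lin_field_def fischer_sum_right fischer_cst_right fischer_var_right)
  finally show ?thesis .
qed

lemma pderiv_lin_field:
  assumes "\<And>u. u \<in> C \<Longrightarrow> N u x = 0"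
  shows "pderiv_mp x (lin_field N C p) = lin_field N C (pderiv_mp x p)"
  unfolding lin_field_def pderiv_mp_sum using assms
  by (intro sum.cong refl)
     (auto simp: pderiv_mp_mult pderiv_mp_var pderiv_mp_commute[of x])

lemma has_field_derivative_mpoly_eval_line:
  assumes "p \<in> mpolys_in C" "finite C"
  shows "((\<lambda>t. mpoly_eval (\<lambda>x. v x + t * w x) p) has_field_derivative
      (\<Sum>u\<in>C. w u * mpoly_eval v (pderiv_mp u p))) (at 0)"
  using assms(1)
proof (induction rule: mpoly_induct)
  case (cst c)
  then show ?case by simp
next
  case (add p q)
  then show ?case
    by (auto simp: mpoly_hom_simps pderiv_mp_add algebra_simps sum.distrib intro!: DERIV_add)
next
  case (var y p)
  have "((\<lambda>t. v y + t * w y) has_field_derivative w y) (at 0)"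
    by (auto intro!: derivative_eq_intros)
  from DERIV_mult[OF this var.IH]
  have *: "((\<lambda>t. mpoly_eval (\<lambda>x. v x + t * w x) (var y * p)) has_field_derivative
      w y * mpoly_eval v p + (\<Sum>u\<in>C. w u * mpoly_eval v (pderiv_mp u p)) * v y) (at 0)"
    by (simp add: mpoly_hom_simps)
  have "(\<Sum>u\<in>C. w u * mpoly_eval v (pderiv_mp u (var y * p))) =
     (\<Sum>u\<in>C. (if u = y then w u * mpoly_eval v p else 0)) + v y * (\<Sum>u\<in>C. w u * mpoly_eval v (pderiv_mp u p))"
    unfolding sum_distrib_left sum.distrib[symmetric]
    by (intro sum.cong refl) (auto simp: mpoly_hom_simps pderiv_mp_mult pderiv_mp_var algebra_simps)
  then show ?case using * assms(2) var(1) by (simp add: sum.delta mult.commute)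
qed

text \<open>Differentiate the transformation law at t = 0. The value t = -1 is left out because
  there a diagonal elementary matrix is singular.\<close>

lemma lin_field_eq_cst_mult:
  assumes "p \<in> mpolys_in C" "finite C"
    and inv: "\<And>t v. t \<noteq> -1 \<Longrightarrow> mpoly_eval (\<lambda>x. v x + t * (\<Sum>w\<in>C. N x w * v w)) p = \<kappa> t * mpoly_eval v p"
    and \<kappa>: "(\<kappa> has_field_derivative k) (at 0)"
  shows "lin_field N C p = cst k * p"
proof (rule mpoly_eqI)
  fix v :: "'a \<Rightarrow> complex"
  let ?w = "\<lambda>x. \<Sum>w\<in>C. N x w * v w"
  have d: "((\<lambda>t. \<kappa> t * mpoly_eval v p) has_field_derivative k * mpoly_eval v p) (at 0)"
    using DERIV_cmult_right[OF \<kappa>] .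
  have e: "eventually (\<lambda>t. mpoly_eval (\<lambda>x. v x + t * ?w x) p = \<kappa> t * mpoly_eval v p) (nhds 0)"
    using inv by (intro eventually_nhds_in_open[of "- {-1}" 0, THEN eventually_mono]) auto
  from d have "((\<lambda>t. mpoly_eval (\<lambda>x. v x + t * ?w x) p) has_field_derivative k * mpoly_eval v p) (at 0)"
    by (subst DERIV_cong_ev[OF refl e refl])
  with has_field_derivative_mpoly_eval_line[OF assms(1,2), of v ?w]
  have "(\<Sum>u\<in>C. ?w u * mpoly_eval v (pderiv_mp u p)) = k * mpoly_eval v p"
    by (rule DERIV_unique)
  then show "mpoly_eval v (lin_field N C p) = mpoly_eval v (cst k * p)"
    by (simp add: lin_field_def mpoly_hom_simps sum_distrib_right mult.assoc)
qed

subsection \<open>Vectors: reducing a homogeneous polynomial to its leading coefficient\<close>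

text \<open>A polarization operator in the sense of Capelli, the infinitesimal form of adding one
  row or column of variables to another. With equal arguments it is an Euler operator, whose
  eigenvectors are the homogeneous polynomials.\<close>

definition polarize :: "'i set \<Rightarrow> ('i \<Rightarrow> 'c) \<Rightarrow> ('i \<Rightarrow> 'c) \<Rightarrow> 'c mpoly \<Rightarrow> 'c mpoly" where
  "polarize S a b p = (\<Sum>k\<in>S. var (a k) * pderiv_mp (b k) p)"

abbreviation euler_op :: "'c set \<Rightarrow> 'c mpoly \<Rightarrow> 'c mpoly" where
  "euler_op I \<equiv> polarize I (\<lambda>x. x) (\<lambda>x. x)"

lemma pderiv_polarize:
  "pderiv_mp y (polarize S a b p) =
     polarize S a b (pderiv_mp y p) + (\<Sum>k\<in>S. if a k = y then pderiv_mp (b k) p else 0)"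
  unfolding polarize_def pderiv_mp_sum sum.distrib[symmetric]
  by (intro sum.cong refl) (auto simp: pderiv_mp_mult pderiv_mp_var pderiv_mp_commute[of y])

lemma pderiv_polarize_commute:
  assumes "\<And>k. k \<in> S \<Longrightarrow> a k \<noteq> y"
  shows "pderiv_mp y (polarize S a b p) = polarize S a b (pderiv_mp y p)"
  unfolding pderiv_polarize using assms by (simp add: sum.neutral)

lemma fischer_polarize: "fischer (polarize S a b p) q = fischer p (polarize S b a q)"
  by (simp add: polarize_def fischer_sum_left fischer_sum_right fischer_var_left fischer_var_right)

lemma cst_diff: "cst (a - b) = cst a - cst b"
  by (simp add: cst_def single_diff)

lemma funpow_commute:
  assumes "\<And>p. f (L p) = L (f p)"
  shows "(f ^^ k) (L p) = L ((f ^^ k) p)"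
  by (induction k) (simp_all add: assms)

lemma pderiv_mp_funpow_commute:
  "(pderiv_mp x ^^ k) (pderiv_mp y p) = pderiv_mp y ((pderiv_mp x ^^ k) p)"
  by (rule funpow_commute) (rule pderiv_mp_commute)

lemma pderiv_mp_funpow_uminus: "(pderiv_mp x ^^ k) (- p) = - (pderiv_mp x ^^ k) p"
  by (rule funpow_commute) (rule pderiv_mp_uminus)

lemma pderiv_mp_funpow_0 [simp]: "(pderiv_mp x ^^ k) 0 = 0"
  by (induction k) simp_all

lemma pderiv_mp_funpow_in [simp]: "p \<in> mpolys_in C \<Longrightarrow> (pderiv_mp x ^^ k) p \<in> mpolys_in C"
  by (induction k) simp_all

lemma pderiv_mp_funpow_add:
  "(pderiv_mp x ^^ k) (p + q) = (pderiv_mp x ^^ k) p + (pderiv_mp x ^^ k) q"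
  by (induction k) (simp_all add: pderiv_mp_add)

lemma pderiv_mp_funpow_cst_mult: "(pderiv_mp x ^^ k) (cst c * p) = cst c * (pderiv_mp x ^^ k) p"
  by (rule funpow_commute) (rule pderiv_mp_cst_mult)

text \<open>Differentiation by \<open>a k\<close> commutes with every summand except the one that
  contains \<open>a k\<close>, and injectivity leaves just one such summand. The truncated
  \<open>m - 1\<close> is harmless at \<open>m = 0\<close>, where its coefficient is zero.\<close>

lemma pderiv_mp_funpow_polarize:
  assumes "finite S" "inj_on a S" "k \<in> S"
  shows "(pderiv_mp (a k) ^^ m) (polarize S a b p) =
     polarize S a b ((pderiv_mp (a k) ^^ m) p) +
     cst (of_nat m) * pderiv_mp (b k) ((pderiv_mp (a k) ^^ (m - 1)) p)"
proof (induction m)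
  case (Suc m)
  have s: "(\<Sum>j\<in>S. if a j = a k then pderiv_mp (b j) q else 0) = pderiv_mp (b k) q" for q
  proof -
    have "(\<Sum>j\<in>S. if a j = a k then pderiv_mp (b j) q else 0)
        = (\<Sum>j\<in>S. if j = k then pderiv_mp (b j) q else 0)"
      using assms by (intro sum.cong refl) (auto dest: inj_onD)
    then show ?thesis using assms by (simp add: sum.delta)
  qed
  have "cst (of_nat m) * pderiv_mp (a k) (pderiv_mp (b k) ((pderiv_mp (a k) ^^ (m - 1)) p))
      = cst (of_nat m) * pderiv_mp (b k) ((pderiv_mp (a k) ^^ m) p)"
    by (cases m) (simp_all add: pderiv_mp_commute[of "a k"])
  then show ?case
    by (simp add: Suc pderiv_mp_add pderiv_polarize s pderiv_mp_cst_mult cst_add distrib_right)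
qed simp

lemma fischer_euler_op:
  "fischer (euler_op I p) p = of_real (\<Sum>x\<in>I. fischer_norm (pderiv_mp x p))"
  by (simp add: polarize_def fischer_sum_left fischer_var_left fischer_self)

text \<open>Paired with \<open>p\<close>, the Euler operator becomes a sum of squared norms. So a
  nonzero polynomial cannot have negative degree, and degree zero makes all derivatives vanish;
  degrees are controlled this way without expanding into monomials.\<close>

lemma euler_op_eigen:
  assumes "euler_op I p = cst (of_int d) * p"
  shows "of_int d * fischer_norm p = (\<Sum>x\<in>I. fischer_norm (pderiv_mp x p))"
proof -
  have "complex_of_real (of_int d * fischer_norm p) = of_real (\<Sum>x\<in>I. fischer_norm (pderiv_mp x p))"
    using fischer_euler_op[of I p] by (simp add: assms fischer_cst_left fischer_self)
  then show ?thesis by (simp only: of_real_eq_iff)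
qed

lemma euler_op_neg_eigen:
  assumes "euler_op I p = cst (of_int d) * p" "d < 0"
  shows "p = 0"
proof (rule ccontr)
  assume "p \<noteq> 0"
  then have "of_int d * fischer_norm p < 0"
    using assms(2) by (simp add: mult_neg_pos)
  moreover have "(\<Sum>x\<in>I. fischer_norm (pderiv_mp x p)) \<ge> 0"
    by (intro sum_nonneg) simp
  ultimately show False using euler_op_eigen[OF assms(1)] by linarith
qed

lemma euler_op_zero_eigen:
  assumes "euler_op I p = 0" "x \<in> I" "finite I"
  shows "pderiv_mp x p = 0"
proof -
  have "(\<Sum>x\<in>I. fischer_norm (pderiv_mp x p)) = 0"
    using euler_op_eigen[of I p 0] assms(1) by simp
  then show ?thesis
    using assms by (subst (asm) sum_nonneg_eq_0_iff) auto
qed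

text \<open>Each derivative lowers the degree by one. Degrees are integers here, so that one
  derivative too many leads to a negative degree and hence to zero.\<close>

lemma euler_op_pderiv_funpow:
  assumes "euler_op I p = cst (of_int d) * p" "x \<in> I" "finite I"
  shows "euler_op I ((pderiv_mp x ^^ k) p) = cst (of_int (d - int k)) * (pderiv_mp x ^^ k) p"
proof -
  have *: "cst (of_nat k) * pderiv_mp x ((pderiv_mp x ^^ (k - 1)) p)
      = cst (of_nat k) * (pderiv_mp x ^^ k) p"
    by (cases k) auto
  have "cst (of_int d) * (pderiv_mp x ^^ k) p = (pderiv_mp x ^^ k) (euler_op I p)"
    by (simp add: assms pderiv_mp_funpow_cst_mult)
  also have "\<dots> = euler_op I ((pderiv_mp x ^^ k) p) + cst (of_nat k) * (pderiv_mp x ^^ k) p"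
    using pderiv_mp_funpow_polarize[of I "\<lambda>x. x" x k "\<lambda>x. x" p] assms * by simp
  finally have "euler_op I ((pderiv_mp x ^^ k) p)
      = cst (of_int d) * (pderiv_mp x ^^ k) p - cst (of_nat k) * (pderiv_mp x ^^ k) p"
    by (simp add: eq_diff_eq)
  then show ?thesis by (simp add: cst_diff left_diff_distrib)
qed

text \<open>For an infinitesimal row operation on a column containing \<open>x\<close> and \<open>y\<close>, \<open>R\<close> is the part that does not
  involve the column.\<close>

lemma fischer_norm_pderiv_swap:
  assumes R: "\<And>p q. fischer (R p) q = fischer p (R' q)"
    and Rx: "\<And>p. pderiv_mp x (R p) = R (pderiv_mp x p)"
    and R'x: "\<And>p. pderiv_mp x (R' p) = R' (pderiv_mp x p)"
    and R'y: "\<And>p. pderiv_mp y (R' p) = R' (pderiv_mp y p)"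
    and f: "var x * pderiv_mp y f + R f = 0" "var y * pderiv_mp x f + R' f = 0"
    and "x \<noteq> y"
  shows "(real k + 1) * fischer_norm (pderiv_mp y ((pderiv_mp x ^^ k) f)) =
     fischer_norm ((pderiv_mp x ^^ Suc k) f)"
proof -
  let ?D = "\<lambda>k. pderiv_mp x ^^ k"
  define g where "g = ?D (Suc k) f"
  define h where "h = pderiv_mp y (?D k f)"
  have xh: "pderiv_mp x h = pderiv_mp y g"
    by (simp add: g_def h_def pderiv_mp_commute)
  have Rf: "R f = - (var x * pderiv_mp y f)" and R'f: "R' f = - (var y * pderiv_mp x f)"
    using f by (simp_all add: eq_neg_iff_add_eq_0 add.commute)
  have "?D m (var x * q) = var x * ?D m q + cst (of_nat m) * ?D (m - 1) q" for m q
  proof (induction m)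
    case (Suc m)
    have "cst (of_nat m) * pderiv_mp x (?D (m - 1) q) = cst (of_nat m) * ?D m q"
      by (cases m) auto
    with Suc show ?case
      by (simp add: pderiv_mp_add pderiv_mp_mult pderiv_mp_var cst_add distrib_right)
  qed simp
  note leibniz = this
  have "R g = ?D (Suc k) (R f)"
    unfolding g_def by (rule funpow_commute[of "pderiv_mp x" R, OF Rx, symmetric])
  also have "\<dots> = - (var x * ?D (Suc k) (pderiv_mp y f)) - cst (of_nat (Suc k)) * ?D k (pderiv_mp y f)"
    unfolding Rf pderiv_mp_funpow_uminus leibniz by (simp del: funpow.simps)
  finally have 1: "R g = - (var x * pderiv_mp y g) - cst (of_nat (Suc k)) * h"
    unfolding g_def h_def pderiv_mp_funpow_commute .
  have "R' h = pderiv_mp y (R' (?D k f))"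
    unfolding h_def by (rule R'y[symmetric])
  also have "R' (?D k f) = ?D k (R' f)"
    by (rule funpow_commute[of "pderiv_mp x" R', OF R'x, symmetric])
  also have "pderiv_mp y (?D k (R' f)) = - pderiv_mp y (var y * g)"
  proof -
    have "?D k (var y * pderiv_mp x f) = var y * ?D k (pderiv_mp x f)"
      by (rule funpow_commute) (use \<open>x \<noteq> y\<close> in \<open>simp add: pderiv_mp_mult pderiv_mp_var\<close>)
    also have "?D k (pderiv_mp x f) = g"
      by (simp add: g_def funpow_swap1)
    finally show ?thesis by (simp add: R'f pderiv_mp_funpow_uminus pderiv_mp_uminus)
  qed
  also have "\<dots> = - g - var y * pderiv_mp y g"
    by (simp add: pderiv_mp_mult pderiv_mp_var)
  finally have 2: "R' h = - g - var y * pderiv_mp y g" .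
  \<comment> \<open>\<open>R\<close> and \<open>R'\<close> are adjoint, so the formulas for
    \<open>R g\<close> and \<open>R' h\<close> give two values of one pairing. As the
    \<open>x\<close>-derivative of \<open>h\<close> is the \<open>y\<close>-derivative of
    \<open>g\<close>, the squared norm of the latter occurs in both and cancels.\<close>
  have "- fischer (pderiv_mp y g) (pderiv_mp y g) - of_nat (Suc k) * fischer h h = fischer (R g) h"
    unfolding 1 fischer_diff_left fischer_uminus_left fischer_cst_left fischer_var_left xh ..
  also have "\<dots> = fischer g (R' h)" by (rule R)
  also have "\<dots> = - fischer g g - fischer (pderiv_mp y g) (pderiv_mp y g)"
    unfolding 2 fischer_diff_right fischer_uminus_right fischer_var_right ..
  finally have "of_nat (Suc k) * fischer h h = fischer g g" by simp
  then have "complex_of_real ((real k + 1) * fischer_norm h) = of_real (fischer_norm g)"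
    by (simp add: fischer_self add.commute)
  then show ?thesis unfolding g_def h_def of_real_eq_iff .
qed

text \<open>For \<open>f\<close> homogeneous of degree \<open>d\<close> in the variables of
  \<open>I\<close>, the \<open>d\<close>-th derivative by \<open>x\<close> is \<open>fact d\<close>
  times the coefficient of the \<open>d\<close>-th power of \<open>x\<close>. The rising factorial
  thus compares the norm of \<open>f\<close> with that of this coefficient.\<close>

lemma fischer_norm_leading_coeff:
  assumes I: "finite I" "x \<in> I"
    and eu: "euler_op I f = cst (of_nat d) * f"
    and sw: "\<And>y k. y \<in> I \<Longrightarrow> y \<noteq> x \<Longrightarrow>
      (real k + 1) * fischer_norm (pderiv_mp y ((pderiv_mp x ^^ k) f)) =
      fischer_norm ((pderiv_mp x ^^ Suc k) f)"
  shows "fischer_norm ((pderiv_mp x ^^ d) f) * pochhammer (of_nat (card I)) d =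
    (fact d)\<^sup>2 * fischer_norm f"
proof -
  let ?M = "\<lambda>k. fischer_norm ((pderiv_mp x ^^ k) f)"
  \<comment> \<open>Euler's formula for the \<open>k\<close>-th derivative, which has degree d - k.
    After multiplication by k + 1 each other variable contributes \<open>?M (Suc k)\<close>, and
    \<open>x\<close> contributes k + 1 times as much; in total this is (card I - 1) + (k +
    1).\<close>
  have step: "real (d - k) * (real k + 1) * ?M k = (real (card I) + real k) * ?M (Suc k)"
    if "k < d" for k
  proof -
    have eu': "euler_op I f = cst (of_int (int d)) * f" using eu by simp
    have "real (d - k) * ?M k = (\<Sum>y\<in>I. fischer_norm (pderiv_mp y ((pderiv_mp x ^^ k) f)))"
      using euler_op_eigen[OF euler_op_pderiv_funpow[OF eu' I(2,1), of k]] that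
      by (simp add: of_nat_diff)
    then have "real (d - k) * (real k + 1) * ?M k
        = (\<Sum>y\<in>I. (real k + 1) * fischer_norm (pderiv_mp y ((pderiv_mp x ^^ k) f)))"
      unfolding sum_distrib_left[symmetric] by (simp add: mult_ac)
    also have "\<dots> = (\<Sum>y\<in>I. if y = x then (real k + 1) * ?M (Suc k) else ?M (Suc k))"
      using sw by (intro sum.cong refl) auto
    also have "\<dots> = (\<Sum>y\<in>I. ?M (Suc k) + (if y = x then real k * ?M (Suc k) else 0))"
      by (intro sum.cong refl) (auto simp: algebra_simps)
    also have "\<dots> = (real (card I) + real k) * ?M (Suc k)"
      using I by (simp add: sum.distrib sum.delta algebra_simps)
    finally show ?thesis .
  qed
  have "?M k * pochhammer (of_nat (card I)) k = (\<Prod>i<k. real (d - i)) * fact k * ?M 0" if "k \<le> d" for k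
    using that
  proof (induction k)
    case (Suc k)
    have "?M (Suc k) * pochhammer (of_nat (card I)) (Suc k)
        = ((real (card I) + real k) * ?M (Suc k)) * pochhammer (of_nat (card I)) k"
      by (simp add: pochhammer_Suc mult_ac)
    also have "\<dots> = real (d - k) * (real k + 1) * (?M k * pochhammer (of_nat (card I)) k)"
      using step[of k] Suc.prems by (simp add: mult_ac)
    also have "\<dots> = (\<Prod>i<Suc k. real (d - i)) * fact (Suc k) * ?M 0"
      using Suc by (simp add: algebra_simps)
    finally show ?case .
  qed simp
  from this[of d] have "?M d * pochhammer (of_nat (card I)) d = (\<Prod>i<d. real (d - i)) * fact d * ?M 0"
    by simp
  moreover have "(\<Prod>i<d. real (d - i)) = fact d"
    by (simp add: fact_prod_rev atLeast0LessThan)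
  ultimately show ?thesis by (simp add: power2_eq_square)
qed

text \<open>Once \<open>x\<close> is set to 1 and the other variables of \<open>I\<close> to 0, the
  Euler operator becomes the derivative by \<open>x\<close>, so successive derivatives multiply the
  value by d, d - 1, ..., 1.\<close>

lemma mpoly_hom_leading_coeff:
  assumes \<iota>: "scalar_embedding \<iota>"
    and I: "finite I" "x \<in> I"
    and \<phi>: "\<phi> x = 1" "\<And>y. y \<in> I \<Longrightarrow> y \<noteq> x \<Longrightarrow> \<phi> y = 0"
    and eu: "euler_op I f = cst (of_nat d) * f"
  shows "mpoly_hom \<iota> \<phi> ((pderiv_mp x ^^ d) f) = \<iota> (fact d) * mpoly_hom \<iota> \<phi> f"
proof -
  have eu': "euler_op I f = cst (of_int (int d)) * f" using eu by simp
  have step: "mpoly_hom \<iota> \<phi> ((pderiv_mp x ^^ Suc k) f) = \<iota> (of_int (int d - int k)) * mpoly_hom \<iota> \<phi> ((pderiv_mp x ^^ k) f)" for k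
  proof -
    let ?g = "(pderiv_mp x ^^ k) f"
    have "mpoly_hom \<iota> \<phi> (euler_op I ?g) = (\<Sum>y\<in>I. if y = x then mpoly_hom \<iota> \<phi> (pderiv_mp y ?g) else 0)"
      unfolding polarize_def mpoly_hom_sum[OF \<iota>] mpoly_hom_mult[OF \<iota>]
      by (intro sum.cong refl) (auto simp: \<phi> mpoly_hom_var[OF \<iota>])
    also have "\<dots> = mpoly_hom \<iota> \<phi> (pderiv_mp x ?g)"
      using I by (simp add: sum.delta)
    finally show ?thesis
      using euler_op_pderiv_funpow[OF eu' I(2,1), of k]
      by (simp add: mpoly_hom_mult[OF \<iota>] mpoly_hom_cst[OF \<iota>])
  qed
  have "mpoly_hom \<iota> \<phi> ((pderiv_mp x ^^ k) f) = \<iota> (\<Prod>i<k. of_nat (d - i)) * mpoly_hom \<iota> \<phi> f"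
    if "k \<le> d" for k
    using that
  proof (induction k)
    case 0
    then show ?case using \<iota> by (simp add: scalar_embedding_def)
  next
    case (Suc k)
    have "(of_int (int d - int k) :: complex) = of_nat (d - k)"
      using Suc.prems by (simp add: of_nat_diff)
    with Suc step[of k] show ?case
      using \<iota> by (simp add: scalar_embedding_def mult_ac)
  qed
  from this[of d] show ?thesis
    by (simp add: fact_prod_rev atLeast0LessThan)
qed

subsection \<open>Matrices: the norm of a relative invariant and of its slice\<close>

text \<open>This is all that the norm comparison has to know about the quiver. \<open>cols\<close>
  is the infinitesimal form of column operations acting by the \<open>d\<close>-th power of the
  determinant, \<open>rows\<close> that of unipotent row operations acting trivially, and
  \<open>R i j\<close> collects the effect of a row operation on everything outside the matrix
  \<open>\<xi>\<close>.\<close>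

locale column_slice =
  fixes n m d :: nat and \<xi> :: "nat \<Rightarrow> nat \<Rightarrow> 'c"
    and R :: "nat \<Rightarrow> nat \<Rightarrow> 'c mpoly \<Rightarrow> 'c mpoly"
    and f :: "'c mpoly"
  assumes le: "m \<le> n"
    and inj: "i < n \<Longrightarrow> c < m \<Longrightarrow> j < n \<Longrightarrow> e < m \<Longrightarrow> \<xi> i c = \<xi> j e \<longleftrightarrow> i = j \<and> c = e"
    and R_adj: "i < n \<Longrightarrow> j < n \<Longrightarrow> i \<noteq> j \<Longrightarrow> fischer (R i j p) q = fischer p (R j i q)"
    and R_pderiv: "i < n \<Longrightarrow> j < n \<Longrightarrow> i \<noteq> j \<Longrightarrow> k < n \<Longrightarrow> c < m \<Longrightarrow>
      pderiv_mp (\<xi> k c) (R i j p) = R i j (pderiv_mp (\<xi> k c) p)"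
    and rows: "i < n \<Longrightarrow> j < n \<Longrightarrow> i \<noteq> j \<Longrightarrow> polarize {..<m} (\<xi> j) (\<xi> i) f + R i j f = 0"
    and cols: "c < m \<Longrightarrow> e < m \<Longrightarrow>
      polarize {..<n} (\<lambda>i. \<xi> i c) (\<lambda>i. \<xi> i e) f = (if c = e then cst (of_nat d) * f else 0)"
begin

text \<open>Up to the factor \<open>d!\<close>, each step substitutes a unit vector for one more column.\<close>

primrec peel :: "nat \<Rightarrow> 'c mpoly" where
  "peel 0 = f"
| "peel (Suc i) = (pderiv_mp (\<xi> i i) ^^ d) (peel i)"

text \<open>Operations that avoid the rows already used commute with the derivatives taken so
  far.\<close>

lemma peel_rows:
  assumes "k \<le> m" "i < n" "j < n" "i \<noteq> j" "k \<le> i" "k \<le> j"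
  shows "polarize {..<m} (\<xi> j) (\<xi> i) (peel k) + R i j (peel k) = 0"
  using assms
proof (induction k)
  case (Suc k)
  have 1: "(pderiv_mp (\<xi> k k) ^^ d) (polarize {..<m} (\<xi> j) (\<xi> i) p)
      = polarize {..<m} (\<xi> j) (\<xi> i) ((pderiv_mp (\<xi> k k) ^^ d) p)" for p
    by (rule funpow_commute, rule pderiv_polarize_commute) (use Suc.prems le inj in auto)
  have 2: "(pderiv_mp (\<xi> k k) ^^ d) (R i j p) = R i j ((pderiv_mp (\<xi> k k) ^^ d) p)" for p
    by (rule funpow_commute, rule R_pderiv) (use Suc.prems le in auto)
  have "(pderiv_mp (\<xi> k k) ^^ d) (polarize {..<m} (\<xi> j) (\<xi> i) (peel k) + R i j (peel k)) = 0"
    using Suc by simp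
  then show ?case by (simp add: pderiv_mp_funpow_add 1 2)
qed (simp add: rows)

lemma peel_cols:
  assumes "k \<le> m" "c < m" "e < m" "k \<le> c" "k \<le> e"
  shows "polarize {..<n} (\<lambda>i. \<xi> i c) (\<lambda>i. \<xi> i e) (peel k) = (if c = e then cst (of_nat d) * peel k else 0)"
  using assms
proof (induction k)
  case (Suc k)
  have 1: "(pderiv_mp (\<xi> k k) ^^ d) (polarize {..<n} (\<lambda>i. \<xi> i c) (\<lambda>i. \<xi> i e) p)
      = polarize {..<n} (\<lambda>i. \<xi> i c) (\<lambda>i. \<xi> i e) ((pderiv_mp (\<xi> k k) ^^ d) p)" for p
    by (rule funpow_commute, rule pderiv_polarize_commute) (use Suc.prems le inj in auto)
  show ?case
    using arg_cong[OF Suc.IH, of "pderiv_mp (\<xi> k k) ^^ d"] Suc.prems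
    by (auto simp: 1 pderiv_mp_funpow_cst_mult split: if_splits)
qed (simp add: cols)

lemma euler_op_image:
  assumes "finite A" "inj_on g A"
  shows "euler_op (g ` A) p = polarize A g g p"
  by (simp add: polarize_def sum.reindex[OF assms(2)])

lemma peel_full_column:
  assumes "k < m"
  shows "euler_op ((\<lambda>i. \<xi> i k) ` {..<n}) (peel k) = cst (of_nat d) * peel k"
  using peel_cols[of k k k] assms inj
  by (subst euler_op_image) (auto intro!: inj_onI)

text \<open>Each step clears a cross. The new column drops from degree \<open>d\<close> to degree
  zero, so all its entries disappear; the new row disappears because column operations annihilate
  \<open>peel k\<close>.\<close>

lemma peel_pderiv_eq_0:
  assumes "k \<le> m"
  shows "(i < n \<longrightarrow> c < k \<longrightarrow> pderiv_mp (\<xi> i c) (peel k) = 0) \<and>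
         (i < k \<longrightarrow> c < m \<longrightarrow> pderiv_mp (\<xi> i c) (peel k) = 0)"
  using assms
proof (induction k arbitrary: i c)
  case (Suc k)
  let ?o = "\<xi> k k" and ?I = "(\<lambda>i. \<xi> i k) ` {..<n}"
  have k: "k < m" "k < n" using Suc.prems le by auto
  have eu: "euler_op ?I (peel k) = cst (of_int (int d)) * peel k"
    using peel_full_column[OF k(1)] by simp
  have oI: "?o \<in> ?I" using k by auto
  have "euler_op ?I ((pderiv_mp ?o ^^ d) (peel k)) = 0"
    using euler_op_pderiv_funpow[OF eu oI, of d] by simp
  then have col: "pderiv_mp (\<xi> i k) (peel (Suc k)) = 0" if "i < n" for i
    using that by (auto intro!: euler_op_zero_eigen[of ?I])
  have top: "(pderiv_mp ?o ^^ Suc d) (peel k) = 0"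
    by (rule euler_op_neg_eigen[OF euler_op_pderiv_funpow[OF eu oI]]) auto
  \<comment> \<open>Apply d + 1 derivatives to the operation between the columns \<open>k\<close>
    and \<open>c\<close>. By \<open>top\<close> only the commutator survives, and it is a nonzero
    multiple of the derivative in question.\<close>
  have row: "pderiv_mp (\<xi> k c) (peel (Suc k)) = 0" if "c < m" "k < c" for c
  proof -
    have "(pderiv_mp ?o ^^ Suc d) (polarize {..<n} (\<lambda>i. \<xi> i k) (\<lambda>i. \<xi> i c) (peel k)) = 0"
      using peel_cols[of k k c] that k by simp
    moreover have "inj_on (\<lambda>i. \<xi> i k) {..<n}"
      using inj k by (auto intro!: inj_onI)
    ultimately have "polarize {..<n} (\<lambda>i. \<xi> i k) (\<lambda>i. \<xi> i c) ((pderiv_mp ?o ^^ Suc d) (peel k)) +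
        cst (of_nat (Suc d)) * pderiv_mp (\<xi> k c) ((pderiv_mp ?o ^^ d) (peel k)) = 0"
      using pderiv_mp_funpow_polarize[of "{..<n}" "\<lambda>i. \<xi> i k" k "Suc d" "\<lambda>i. \<xi> i c" "peel k"] k
      by simp
    then have "cst (of_nat (Suc d)) * pderiv_mp (\<xi> k c) ((pderiv_mp ?o ^^ d) (peel k)) = 0"
      unfolding top by (simp add: polarize_def)
    moreover have "cst (of_nat (Suc d)) \<noteq> (0 :: 'c mpoly)"
      unfolding cst_of_nat of_nat_eq_0_iff by simp
    ultimately show ?thesis by simp
  qed
  have old: "pderiv_mp (\<xi> i c) (peel (Suc k)) = 0" if "pderiv_mp (\<xi> i c) (peel k) = 0" for i c
    using that by (simp flip: pderiv_mp_funpow_commute)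
  have "k \<le> m" using k by simp
  note IH = Suc.IH[OF this]
  show ?case
  proof (intro conjI impI)
    assume "i < n" "c < Suc k"
    then show "pderiv_mp (\<xi> i c) (peel (Suc k)) = 0"
      using col[of i] old[of i c] IH[of i c] by (cases "c = k") auto
  next
    assume "i < Suc k" "c < m"
    then show "pderiv_mp (\<xi> i c) (peel (Suc k)) = 0"
      using col[of i] row[of c] old[of i c] IH[of i c] k
      by (cases "i = k"; cases "c < k"; cases "c = k") auto
  qed
qed simp

text \<open>Of the \<open>n\<close> entries of column \<open>k\<close> the first \<open>k\<close> no
  longer occur, so Euler's formula runs over the remaining ones. This is the origin of the
  \<open>n - k\<close> in the rising factorials.\<close>

lemma peel_lower_column:
  assumes "k < m"
  shows "euler_op ((\<lambda>i. \<xi> i k) ` {k..<n}) (peel k) = cst (of_nat d) * peel k"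
proof -
  have z: "pderiv_mp (\<xi> i k) (peel k) = 0" if "i < k" for i
    using peel_pderiv_eq_0[of k i k] assms that by simp
  have "polarize {k..<n} (\<lambda>i. \<xi> i k) (\<lambda>i. \<xi> i k) (peel k)
      = polarize {..<n} (\<lambda>i. \<xi> i k) (\<lambda>i. \<xi> i k) (peel k)"
    unfolding polarize_def by (rule sum.mono_neutral_left) (auto simp: z)
  then show ?thesis
    using peel_cols[of k k k] assms inj
    by (subst euler_op_image) (auto intro!: inj_onI)
qed

lemma fischer_norm_peel_step:
  assumes "k < m"
  shows "fischer_norm (peel (Suc k)) * pochhammer (of_nat (n - k)) d = (fact d)\<^sup>2 * fischer_norm (peel k)"
proof -
  let ?I = "(\<lambda>i. \<xi> i k) ` {k..<n}"
  have k: "k < n" using assms le by simp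
  have card: "card ?I = n - k"
    using inj assms by (subst card_image) (auto intro!: inj_onI)
  have sw: "(real l + 1) * fischer_norm (pderiv_mp y ((pderiv_mp (\<xi> k k) ^^ l) (peel k))) =
      fischer_norm ((pderiv_mp (\<xi> k k) ^^ Suc l) (peel k))"
    if y: "y \<in> ?I" "y \<noteq> \<xi> k k" for y l
  proof -
    obtain i where i: "y = \<xi> i k" "k < i" "i < n"
      using y by (auto simp: order_le_less)
    \<comment> \<open>A row operation acts on all columns at once. Its effect on the columns other
      than \<open>k\<close> is put into \<open>L\<close> together with \<open>R\<close>, so that a
      single column is left, as \<open>fischer_norm_pderiv_swap\<close> requires.\<close>
    define S where "S = {..<m} - {k}"
    define L where "L i j p = polarize S (\<xi> j) (\<xi> i) p + R i j p" for i j p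
    have split: "polarize {..<m} (\<xi> j) (\<xi> i) p + R i j p = var (\<xi> j k) * pderiv_mp (\<xi> i k) p + L i j p"
      for i j p
      using assms unfolding L_def S_def polarize_def
      by (subst sum.remove[of "{..<m}" k]) (auto simp: add.assoc)
    have adj: "fischer (L i k p) q = fischer p (L k i q)" for p q
      using R_adj[of i k p q] i k
      by (simp add: L_def fischer_add_left fischer_add_right fischer_polarize)
    have com: "pderiv_mp (\<xi> h k) (L i j p) = L i j (pderiv_mp (\<xi> h k) p)"
      if "h < n" "i < n" "j < n" "i \<noteq> j" for h i j p
    proof -
      have "pderiv_mp (\<xi> h k) (polarize S (\<xi> j) (\<xi> i) p) = polarize S (\<xi> j) (\<xi> i) (pderiv_mp (\<xi> h k) p)"
        by (rule pderiv_polarize_commute) (use that assms inj S_def in auto)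
      then show ?thesis
        using R_pderiv[OF that(2,3,4,1), of k p] assms by (simp add: L_def pderiv_mp_add)
    qed
    show ?thesis
      unfolding i(1)
    proof (rule fischer_norm_pderiv_swap[where R = "L i k" and R' = "L k i"])
      show "var (\<xi> k k) * pderiv_mp (\<xi> i k) (peel k) + L i k (peel k) = 0"
        using peel_rows[of k i k] i assms k by (simp flip: split)
      show "var (\<xi> i k) * pderiv_mp (\<xi> k k) (peel k) + L k i (peel k) = 0"
        using peel_rows[of k k i] i assms k by (simp flip: split)
      show "\<xi> k k \<noteq> \<xi> i k" using y i by simp
    qed (use adj com i k in auto)
  qed
  show ?thesis
    using fischer_norm_leading_coeff[of ?I "\<xi> k k" "peel k" d, OF _ _ peel_lower_column[OF assms] sw] k
    by (simp add: card)
qed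

lemma fischer_norm_peel:
  assumes "k \<le> m"
  shows "fischer_norm (peel k) * (\<Prod>i<k. pochhammer (of_nat (n - i)) d) = (fact d) ^ (2 * k) * fischer_norm f"
  using assms
proof (induction k)
  case (Suc k)
  have "fischer_norm (peel (Suc k)) * (\<Prod>i<Suc k. pochhammer (of_nat (n - i)) d)
     = (fischer_norm (peel (Suc k)) * pochhammer (of_nat (n - k)) d) * (\<Prod>i<k. pochhammer (of_nat (n - i)) d)"
    by (simp add: mult_ac)
  also have "\<dots> = (fact d)\<^sup>2 * (fischer_norm (peel k) * (\<Prod>i<k. pochhammer (of_nat (n - i)) d))"
    using Suc.prems by (subst fischer_norm_peel_step) (auto simp: mult_ac)
  also have "\<dots> = (fact d) ^ (2 * Suc k) * fischer_norm f"
    using Suc by (simp add: power2_eq_square mult_ac)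
  finally show ?case .
qed simp

lemma mpoly_hom_peel:
  assumes \<iota>: "scalar_embedding \<iota>"
    and \<phi>: "\<And>i c. i < n \<Longrightarrow> c < m \<Longrightarrow> \<phi> (\<xi> i c) = of_bool (i = c)"
    and "k \<le> m"
  shows "mpoly_hom \<iota> \<phi> (peel k) = \<iota> (fact d ^ k) * mpoly_hom \<iota> \<phi> f"
  using assms(3)
proof (induction k)
  case 0
  then show ?case using \<iota> by (simp add: scalar_embedding_def)
next
  case (Suc k)
  have k: "k < m" "k < n" using Suc.prems le by auto
  have "mpoly_hom \<iota> \<phi> (peel (Suc k)) = \<iota> (fact d) * mpoly_hom \<iota> \<phi> (peel k)"
    unfolding peel.simps
    by (rule mpoly_hom_leading_coeff[OF \<iota> _ _ _ _ peel_full_column[OF k(1)]]) (use k \<phi> in auto)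
  with Suc show ?case
    using \<iota> by (simp add: scalar_embedding_def mult_ac)
qed

text \<open>\<open>peel m\<close> contains no matrix variable, so substituting into it merely
  renames variables and preserves the norm. The same substitution turns it into
  \<open>fact d ^ m\<close> times the slice, and this power cancels against the one in
  \<open>fischer_norm_peel\<close>.\<close>

lemma fischer_norm_slice:
  fixes \<kappa> :: "'c \<Rightarrow> 'd"
  assumes f: "f \<in> mpolys_in C" and C: "finite C"
    and X: "X = (\<lambda>(i, c). \<xi> i c) ` ({..<n} \<times> {..<m})"
    and \<kappa>: "inj_on \<kappa> (C - X)"
    and \<phi>: "\<And>i c. i < n \<Longrightarrow> c < m \<Longrightarrow> \<phi> (\<xi> i c) = of_bool (i = c)"
      "\<And>x. x \<in> C - X \<Longrightarrow> \<phi> x = var (\<kappa> x)"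
  shows "fischer_norm f = fischer_norm (mpoly_subst \<phi> f) * (\<Prod>i<m. pochhammer (of_nat (n - i)) d)"
proof -
  define g where "g = peel m"
  have gC: "g \<in> mpolys_in C"
    unfolding g_def
  proof -
    have "peel k \<in> mpolys_in C" for k by (induction k) (simp_all add: f)
    then show "peel m \<in> mpolys_in C" .
  qed
  have g: "g \<in> mpolys_in (C - X)"
    by (rule mpolys_in_pderiv_eq_0[OF gC]) (use peel_pderiv_eq_0[of m] in \<open>auto simp: X g_def\<close>)
  define D where "D = \<kappa> ` (C - X)"
  define a where "a x y = (of_bool (y = \<kappa> x) :: complex)" for x y
  have lin: "lin_subst a D p = mpoly_subst \<phi> p" if "p \<in> mpolys_in (C - X)" for p
    unfolding lin_subst_def
  proof (rule mpoly_hom_cong[OF that])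
    fix x assume x: "x \<in> C - X"
    have "(\<Sum>y\<in>D. cst (a x y) * var y) = (\<Sum>y\<in>D. if y = \<kappa> x then var y else 0)"
      by (intro sum.cong refl) (auto simp: a_def)
    also have "\<dots> = var (\<kappa> x)" using x C by (simp add: D_def sum.delta)
    finally show "(\<Sum>y\<in>D. cst (a x y) * var y) = \<phi> x" using \<phi>(2)[OF x] by simp
  qed
  \<comment> \<open>Renaming is a substitution by a 0-1 matrix. Since \<open>\<kappa>\<close> is
    injective, the adjoint substitution undoes it, and this makes it an isometry.\<close>
  have "lin_subst (\<lambda>y x. cnj (a x y)) (C - X) (lin_subst a D g) = g"
  proof (rule mpoly_eqI)
    fix v
    have "mpoly_eval v (lin_subst (\<lambda>y x. cnj (a x y)) (C - X) (lin_subst a D g))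
       = mpoly_eval (\<lambda>x. \<Sum>y\<in>D. a x y * (\<Sum>z\<in>C - X. cnj (a z y) * v z)) g"
      by (simp add: mpoly_eval_lin_subst)
    also have "\<dots> = mpoly_eval v g"
    proof (rule mpoly_hom_cong[OF g])
      fix x assume x: "x \<in> C - X"
      have "(\<Sum>y\<in>D. a x y * (\<Sum>z\<in>C - X. cnj (a z y) * v z))
          = (\<Sum>y\<in>D. if y = \<kappa> x then (\<Sum>z\<in>C - X. cnj (a z y) * v z) else 0)"
        by (intro sum.cong refl) (auto simp: a_def)
      also have "\<dots> = (\<Sum>z\<in>C - X. cnj (a z (\<kappa> x)) * v z)"
        using x C by (simp add: D_def sum.delta)
      also have "\<dots> = (\<Sum>z\<in>C - X. if z = x then v z else 0)"
        by (intro sum.cong refl) (use \<kappa> x in \<open>auto simp: a_def dest: inj_onD\<close>)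
      also have "\<dots> = v x" using x C by (simp add: sum.delta)
      finally show "(\<Sum>y\<in>D. a x y * (\<Sum>z\<in>C - X. cnj (a z y) * v z)) = v x" .
    qed
    finally show "mpoly_eval v (lin_subst (\<lambda>y x. cnj (a x y)) (C - X) (lin_subst a D g)) = mpoly_eval v g" .
  qed
  then have "fischer_norm (lin_subst a D g) = fischer_norm g"
    using fischer_lin_subst[OF g lin_subst_in[of a D g], of a] C
    by (simp add: fischer_norm_def D_def)
  then have "fischer_norm (mpoly_subst \<phi> g) = fischer_norm g"
    by (simp add: lin[OF g])
  moreover have "mpoly_subst \<phi> g = cst (fact d ^ m) * mpoly_subst \<phi> f"
    unfolding g_def by (rule mpoly_hom_peel) (simp_all add: \<phi>)
  ultimately have "(fact d ^ m)\<^sup>2 * fischer_norm (mpoly_subst \<phi> f) = fischer_norm g"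
    by (simp add: fischer_norm_cst_mult norm_power)
  then have "fact d ^ (2 * m) * fischer_norm (mpoly_subst \<phi> f) * (\<Prod>i<m. pochhammer (of_nat (n - i)) d)
     = fact d ^ (2 * m) * fischer_norm f"
    using fischer_norm_peel[of m] by (simp add: g_def power_mult mult.commute[of 2] power2_eq_square)
  then show ?thesis by (simp add: mult.assoc)
qed

end

subsection \<open>Representation spaces in coordinates\<close>

definition rep_of :: "('v, 'a) pre_digraph \<Rightarrow> ('v \<Rightarrow> nat) \<Rightarrow> ('a coord \<Rightarrow> complex) \<Rightarrow> 'a rep" where
  "rep_of Q \<beta> v = (\<lambda>b\<in>arcs Q. mat (\<beta> (head Q b)) (\<beta> (tail Q b)) (\<lambda>(i, j). v (b, i, j)))"

definition represents ::
  "('v, 'a) pre_digraph \<Rightarrow> ('v \<Rightarrow> nat) \<Rightarrow> 'a coord mpoly \<Rightarrow> ('a rep \<Rightarrow> complex) \<Rightarrow> bool" where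
  "represents Q \<beta> P f \<longleftrightarrow> P \<in> mpolys_in (coords Q \<beta>) \<and> (\<forall>v. f (rep_of Q \<beta> v) = mpoly_eval v P)"

lemma rep_of_in [simp]: "rep_of Q \<beta> v \<in> Rep Q \<beta>"
  by (auto simp: rep_of_def Rep_def)

lemma rep_of_coord_fun: "W \<in> Rep Q \<beta> \<Longrightarrow> rep_of Q \<beta> (\<lambda>x. coord_fun x W) = W"
  by (rule ext, rule eq_matI) (auto simp: rep_of_def Rep_def coord_fun_def PiE_def Pi_def extensional_def)

lemma coord_fun_rep_of: "x \<in> coords Q \<beta> \<Longrightarrow> coord_fun x (rep_of Q \<beta> v) = v x"
  by (auto simp: coord_fun_def coords_def rep_of_def)

lemma finite_coords:
  assumes "finite (arcs Q)"
  shows "finite (coords Q \<beta>)"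
proof (rule finite_subset)
  let ?n = "\<Sum>b\<in>arcs Q. \<beta> (head Q b)" and ?m = "\<Sum>b\<in>arcs Q. \<beta> (tail Q b)"
  have "\<beta> (head Q b) \<le> ?n" "\<beta> (tail Q b) \<le> ?m" if "b \<in> arcs Q" for b
    using that assms by (auto intro: member_le_sum)
  then show "coords Q \<beta> \<subseteq> arcs Q \<times> {..<?n} \<times> {..<?m}"
    unfolding coords_def by (auto intro: less_le_trans)
  show "finite (arcs Q \<times> {..<?n} \<times> {..<?m})"
    using assms by simp
qed

lemma poly_expr_represents: "p \<in> poly_expr Q \<beta> \<Longrightarrow> \<exists>P. represents Q \<beta> P p"
proof (induction rule: poly_expr.induct)
  case (const c)
  then show ?case by (intro exI[of _ "cst c"]) (simp add: represents_def)
next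
  case (coord x)
  then show ?case by (intro exI[of _ "var x"]) (simp add: represents_def coord_fun_rep_of)
next
  case (add p q)
  then obtain P R where "represents Q \<beta> P p" "represents Q \<beta> R q" by blast
  then show ?case by (intro exI[of _ "P + R"]) (simp add: represents_def mpoly_hom_simps)
next
  case (mult p q)
  then obtain P R where "represents Q \<beta> P p" "represents Q \<beta> R q" by blast
  then show ?case by (intro exI[of _ "P * R"]) (simp add: represents_def mpoly_hom_simps)
qed

lemma mpoly_eval_in_poly_expr:
  assumes "P \<in> mpolys_in (coords Q \<beta>)"
  shows "(\<lambda>W. mpoly_eval (\<lambda>x. coord_fun x W) P) \<in> poly_expr Q \<beta>"
  using assms
proof (induction rule: mpoly_induct)
  case (cst c)
  then show ?case by (simp add: poly_expr.const)
next
  case (var x p)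
  have "(\<lambda>W. mpoly_eval (\<lambda>x. coord_fun x W) (var x * p)) =
      coord_fun x * (\<lambda>W. mpoly_eval (\<lambda>x. coord_fun x W) p)"
    by (simp add: fun_eq_iff mpoly_hom_simps)
  with var show ?case by (simp add: poly_expr.mult poly_expr.coord)
next
  case (add p q)
  have "(\<lambda>W. mpoly_eval (\<lambda>x. coord_fun x W) (p + q)) =
      (\<lambda>W. mpoly_eval (\<lambda>x. coord_fun x W) p) + (\<lambda>W. mpoly_eval (\<lambda>x. coord_fun x W) q)"
    by (simp add: fun_eq_iff mpoly_hom_simps)
  with add show ?case by (simp add: poly_expr.add)
qed

lemma poly_funs_iff:
  "f \<in> poly_funs Q \<beta> \<longleftrightarrow> (\<exists>P. represents Q \<beta> P f) \<and> (\<forall>W. W \<notin> Rep Q \<beta> \<longrightarrow> f W = 0)"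
proof
  assume "f \<in> poly_funs Q \<beta>"
  then obtain p where p: "p \<in> poly_expr Q \<beta>" "f = on_Rep Q \<beta> p"
    by (auto simp: poly_funs_def)
  from poly_expr_represents[OF p(1)] obtain P where "represents Q \<beta> P p" ..
  with p(2) show "(\<exists>P. represents Q \<beta> P f) \<and> (\<forall>W. W \<notin> Rep Q \<beta> \<longrightarrow> f W = 0)"
    by (auto simp: represents_def on_Rep_def)
next
  assume *: "(\<exists>P. represents Q \<beta> P f) \<and> (\<forall>W. W \<notin> Rep Q \<beta> \<longrightarrow> f W = 0)"
  then obtain P where P: "represents Q \<beta> P f" by blast
  have "f W = on_Rep Q \<beta> (\<lambda>W. mpoly_eval (\<lambda>x. coord_fun x W) P) W" for W
    using P * rep_of_coord_fun[of W Q \<beta>] unfolding represents_def on_Rep_def by metis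
  then have "f = on_Rep Q \<beta> (\<lambda>W. mpoly_eval (\<lambda>x. coord_fun x W) P)" ..
  with P show "f \<in> poly_funs Q \<beta>"
    by (auto simp: poly_funs_def represents_def intro: mpoly_eval_in_poly_expr)
qed

lemma represents_eq_0_iff:
  assumes "represents Q \<beta> P f" "\<And>W. W \<notin> Rep Q \<beta> \<Longrightarrow> f W = 0"
  shows "f = (\<lambda>_. 0) \<longleftrightarrow> P = 0"
proof
  assume "f = (\<lambda>_. 0)"
  then show "P = 0" using assms(1) by (intro mpoly_eq_0I) (simp add: represents_def)
next
  assume "P = 0"
  then have *: "f (rep_of Q \<beta> v) = 0" for v
    using assms(1) by (simp add: represents_def)
  have "f W = 0" for W
    using *[of "\<lambda>x. coord_fun x W"] assms(2)[of W] by (cases "W \<in> Rep Q \<beta>") (simp_all add: rep_of_coord_fun)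
  then show "f = (\<lambda>_. 0)" ..
qed

subsection \<open>Operators on \<open>f\<^sup>s\<close> and operators on polynomials\<close>

lemma pd_rep_of:
  assumes "x \<in> coords Q \<beta>"
  shows "pd x u (rep_of Q \<beta> v) = deriv (\<lambda>z. u (rep_of Q \<beta> (v(x := z)))) (v x)"
proof -
  obtain b i j where x: "x = (b, i, j)" and b: "b \<in> arcs Q" "i < \<beta> (head Q b)" "j < \<beta> (tail Q b)"
    using assms by (auto simp: coords_def)
  have "(rep_of Q \<beta> v)(b := (rep_of Q \<beta> v b) |\<^sub>m (i, j) \<mapsto> z) = rep_of Q \<beta> (v(x := z))" for z
    using b by (intro ext) (auto simp: rep_of_def x update_mat_def intro!: eq_matI)
  moreover have "rep_of Q \<beta> v b $$ (i, j) = v x"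
    using b by (simp add: rep_of_def x)
  ultimately show ?thesis
    by (simp add: pd_def x)
qed

lemma pd_represents:
  assumes "represents Q \<beta> P f" "x \<in> coords Q \<beta>"
  shows "pd x f (rep_of Q \<beta> v) = mpoly_eval v (pderiv_mp x P)"
  using has_field_derivative_mpoly_eval[of v x P] assms
  by (simp add: pd_rep_of represents_def DERIV_imp_deriv)

lemma quotient_rule_numerator:
  fixes p :: complex
  assumes "p \<noteq> 0"
  shows "(f' * p ^ N - f * (of_nat N * (p' * p ^ (N - Suc 0)))) / (p ^ N * p ^ N) * p ^ Suc N =
    p * f' - of_nat N * f * p'"
proof (cases N)
  case (Suc M)
  have "f' * p ^ N - f * (of_nat N * (p' * p ^ (N - Suc 0))) = p ^ M * (p * f' - of_nat N * f * p')"
    by (simp add: Suc right_diff_distrib mult_ac del: of_nat_Suc)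
  moreover have "p ^ N * p ^ N = p ^ M * p ^ Suc N"
    by (simp add: Suc mult_ac)
  ultimately show ?thesis using assms by (simp del: power_Suc)
qed simp

lemma log_derivative_numerator:
  fixes p :: complex
  assumes "p \<noteq> 0"
  shows "(D + s * u * p' / p) * p ^ Suc N = D * p ^ Suc N + s * (u * p ^ N) * p'"
  using assms by (simp add: distrib_right)

text \<open>The quotient rule with denominators cleared. Nothing is known about \<open>w\<close> at
  zeros of \<open>P\<close>, but on the coordinate line these keep away from the point, so near it
  \<open>w\<close> is the fraction.\<close>

lemma pd_quotient:
  assumes w: "\<And>v. mpoly_eval v P \<noteq> 0 \<Longrightarrow> w (rep_of Q \<beta> v) * mpoly_eval v P ^ N = mpoly_eval v F"
    and x: "x \<in> coords Q \<beta>" and v: "mpoly_eval v P \<noteq> 0"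
  shows "pd x w (rep_of Q \<beta> v) * mpoly_eval v P ^ Suc N =
    mpoly_eval v P * mpoly_eval v (pderiv_mp x F) - of_nat N * mpoly_eval v F * mpoly_eval v (pderiv_mp x P)"
proof -
  let ?g = "\<lambda>z. mpoly_eval (v(x := z)) F / mpoly_eval (v(x := z)) P ^ N"
  let ?D = "(mpoly_eval v (pderiv_mp x F) * mpoly_eval v P ^ N -
      mpoly_eval v F * (of_nat N * (mpoly_eval v (pderiv_mp x P) * mpoly_eval v P ^ (N - Suc 0)))) /
      (mpoly_eval v P ^ N * mpoly_eval v P ^ N)"
  note D = has_field_derivative_mpoly_eval[of v x]
  have "isCont (\<lambda>z. mpoly_eval (v(x := z)) P) (v x)"
    by (rule DERIV_isCont[OF D])
  then have "eventually (\<lambda>z. mpoly_eval (v(x := z)) P \<noteq> 0) (at (v x))"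
    using v by (intro tendsto_imp_eventually_ne[of _ "mpoly_eval v P"]) (auto simp: isCont_def)
  then have "eventually (\<lambda>z. mpoly_eval (v(x := z)) P \<noteq> 0) (nhds (v x))"
    using v by (simp add: eventually_nhds_conv_at)
  then have e: "eventually (\<lambda>z. w (rep_of Q \<beta> (v(x := z))) = ?g z) (nhds (v x))"
  proof (rule eventually_mono)
    fix z assume "mpoly_eval (v(x := z)) P \<noteq> 0"
    then show "w (rep_of Q \<beta> (v(x := z))) = ?g z"
      using w[of "v(x := z)"] by (simp add: eq_divide_eq)
  qed
  have "(?g has_field_derivative ?D) (at (v x))"
    using DERIV_divide[OF D[of F] DERIV_power[OF D[of P], of N]] v by simp
  then have "deriv ?g (v x) = ?D" by (rule DERIV_imp_deriv)
  then have *: "pd x w (rep_of Q \<beta> v) = ?D"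
    unfolding pd_rep_of[OF x] by (simp add: deriv_cong_ev[OF e refl])
  show ?thesis
    unfolding * by (rule quotient_rule_numerator[OF v])
qed

text \<open>The first operator acts on the coefficient \<open>u\<close> of \<open>u f\<^sup>s\<close>, the second one is the underlying
  element of \<open>D[s]\<close> acting on polynomials.\<close>

inductive weyl_pair ::
  "('v, 'a) pre_digraph \<Rightarrow> ('v \<Rightarrow> nat) \<Rightarrow> ('a rep \<Rightarrow> complex)
     \<Rightarrow> ((complex \<Rightarrow> 'a rep \<Rightarrow> complex) \<Rightarrow> complex \<Rightarrow> 'a rep \<Rightarrow> complex)
     \<Rightarrow> (complex \<Rightarrow> 'a coord mpoly \<Rightarrow> 'a coord mpoly) \<Rightarrow> bool"
  for Q :: "('v, 'a) pre_digraph" and \<beta> :: "'v \<Rightarrow> nat" and f :: "'a rep \<Rightarrow> complex" where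
  scalar: "weyl_pair Q \<beta> f (\<lambda>u s W. c * u s W) (\<lambda>s p. cst c * p)"
| svar: "weyl_pair Q \<beta> f (\<lambda>u s W. s * u s W) (\<lambda>s p. cst s * p)"
| coord: "x \<in> coords Q \<beta> \<Longrightarrow> weyl_pair Q \<beta> f (\<lambda>u s W. coord_fun x W * u s W) (\<lambda>s p. var x * p)"
| deriv: "x \<in> coords Q \<beta> \<Longrightarrow>
    weyl_pair Q \<beta> f (\<lambda>u s W. pd x (u s) W + s * u s W * pd x f W / f W) (\<lambda>s. pderiv_mp x)"
| add: "weyl_pair Q \<beta> f L T \<Longrightarrow> weyl_pair Q \<beta> f L' T' \<Longrightarrow>
    weyl_pair Q \<beta> f (L + L') (\<lambda>s p. T s p + T' s p)"
| comp: "weyl_pair Q \<beta> f L T \<Longrightarrow> weyl_pair Q \<beta> f L' T' \<Longrightarrow>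
    weyl_pair Q \<beta> f (L \<circ> L') (\<lambda>s p. T s (T' s p))"

lemma weyl_pair_weyl_s_ops: "weyl_pair Q \<beta> f L T \<Longrightarrow> L \<in> weyl_s_ops Q \<beta> f"
  by (induction rule: weyl_pair.induct) (blast intro: weyl_s_ops.intros)+

lemma weyl_s_ops_weyl_pair: "L \<in> weyl_s_ops Q \<beta> f \<Longrightarrow> \<exists>T. weyl_pair Q \<beta> f L T"
  by (induction rule: weyl_s_ops.induct) (blast intro: weyl_pair.intros)+

text \<open>Under the adjoint, coordinates and derivatives exchange places and compositions are
  reversed. At \<open>s = k\<close> the scalar is real, so multiplication by it is its own
  adjoint.\<close>

lemma weyl_pair_adjoint:
  assumes "weyl_pair Q \<beta> f L T"
  shows "\<exists>L' T'. weyl_pair Q \<beta> f L' T' \<and>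
    (\<forall>(k::nat) p q. fischer (T (of_nat k) p) q = fischer p (T' (of_nat k) q))"
  using assms
proof (induction rule: weyl_pair.induct)
  case (scalar c)
  then show ?case
    by (intro exI conjI, rule weyl_pair.scalar[of Q \<beta> f "cnj c"])
       (simp add: fischer_cst_left fischer_cst_right)
next
  case svar
  then show ?case
    by (intro exI conjI, rule weyl_pair.svar) (simp add: fischer_cst_left fischer_cst_right)
next
  case (coord x)
  then show ?case
    by (intro exI conjI, rule weyl_pair.deriv[of x]) (simp_all add: fischer_var_left)
next
  case (deriv x)
  then show ?case
    by (intro exI conjI, rule weyl_pair.coord[of x]) (simp_all add: fischer_var_right)
next
  case (add L T L' T')
  then obtain M S M' S' where "weyl_pair Q \<beta> f M S" "weyl_pair Q \<beta> f M' S'"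
    "\<forall>(k::nat) p q. fischer (T (of_nat k) p) q = fischer p (S (of_nat k) q)"
    "\<forall>(k::nat) p q. fischer (T' (of_nat k) p) q = fischer p (S' (of_nat k) q)" by blast
  then show ?case
    by (intro exI[of _ "M + M'"] exI[of _ "\<lambda>s p. S s p + S' s p"] conjI weyl_pair.add)
       (auto simp: fischer_add_left fischer_add_right)
next
  case (comp L T L' T')
  then obtain M S M' S' where "weyl_pair Q \<beta> f M S" "weyl_pair Q \<beta> f M' S'"
    "\<forall>(k::nat) p q. fischer (T (of_nat k) p) q = fischer p (S (of_nat k) q)"
    "\<forall>(k::nat) p q. fischer (T' (of_nat k) p) q = fischer p (S' (of_nat k) q)" by blast
  then show ?case
    by (intro exI[of _ "M' \<circ> M"] exI[of _ "\<lambda>s p. S' s (S s p)"] conjI weyl_pair.comp) auto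
qed

lemma weyl_pair_times:
  assumes "P \<in> mpolys_in (coords Q \<beta>)"
  shows "\<exists>L. weyl_pair Q \<beta> f L (\<lambda>s p. P * p)"
  using assms
proof (induction rule: mpoly_induct)
  case (cst c)
  then show ?case by (blast intro: weyl_pair.scalar)
next
  case (var x p)
  then obtain L where "weyl_pair Q \<beta> f L (\<lambda>s q. p * q)" by blast
  from weyl_pair.comp[OF weyl_pair.coord[OF var(1)] this] show ?case by (auto simp: mult.assoc)
next
  case (add p q)
  then obtain L L' where "weyl_pair Q \<beta> f L (\<lambda>s r. p * r)" "weyl_pair Q \<beta> f L' (\<lambda>s r. q * r)" by blast
  from weyl_pair.add[OF this] show ?case by (auto simp: distrib_right)
qed

lemma weyl_s_ops_poly: "(\<lambda>u s W. poly e s * u s W) \<in> weyl_s_ops Q \<beta> f"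
proof (induction e)
  case 0
  then show ?case using weyl_s_ops.scalar[of 0 Q \<beta> f] by simp
next
  case (pCons c e)
  have "(\<lambda>u s W. poly (pCons c e) s * u s W) =
     (\<lambda>u s W. c * u s W) + ((\<lambda>u s W. s * u s W) \<circ> (\<lambda>u s W. poly e s * u s W))"
    by (simp add: fun_eq_iff algebra_simps)
  also have "\<dots> \<in> weyl_s_ops Q \<beta> f"
    using pCons by (intro weyl_s_ops.add weyl_s_ops.comp weyl_s_ops.scalar weyl_s_ops.svar)
  finally show ?case .
qed

text \<open>At \<open>s = k\<close> the operators act on actual polynomials \<open>u f\<^sup>k\<close>.\<close>

lemma weyl_pair_eval:
  assumes P: "represents Q \<beta> P f" and "weyl_pair Q \<beta> f L T"
    and "\<And>v. mpoly_eval v P \<noteq> 0 \<Longrightarrow> u (of_nat k) (rep_of Q \<beta> v) * mpoly_eval v P ^ k = mpoly_eval v F"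
    and "mpoly_eval v P \<noteq> 0"
  shows "L u (of_nat k) (rep_of Q \<beta> v) * mpoly_eval v P ^ k = mpoly_eval v (T (of_nat k) F)"
  using assms(2-)
proof (induction arbitrary: u F v rule: weyl_pair.induct)
  case (scalar c)
  then show ?case by (simp add: mpoly_hom_simps mult.assoc)
next
  case svar
  then show ?case by (simp add: mpoly_hom_simps mult.assoc)
next
  case (coord x)
  then show ?case by (simp add: mpoly_hom_simps mult.assoc coord_fun_rep_of)
next
  case (deriv x)
  let ?e = "\<lambda>p. mpoly_eval v p" and ?W = "rep_of Q \<beta> v"
  have f: "f ?W = ?e P" using P by (simp add: represents_def)
  have "pd x (u (of_nat k)) ?W * ?e P ^ Suc k = ?e P * ?e (pderiv_mp x F) - of_nat k * ?e F * ?e (pderiv_mp x P)"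
    by (rule pd_quotient) (use deriv in auto)
  then have "(pd x (u (of_nat k)) ?W + of_nat k * u (of_nat k) ?W * pd x f ?W / f ?W) * ?e P ^ Suc k
     = ?e P * ?e (pderiv_mp x F) - of_nat k * ?e F * ?e (pderiv_mp x P)
       + of_nat k * (u (of_nat k) ?W * ?e P ^ k) * ?e (pderiv_mp x P)"
    unfolding f pd_represents[OF P deriv(1)] log_derivative_numerator[OF deriv(3)] by (simp only:)
  \<comment> \<open>The derivative of the symbol \<open>f ^ s\<close> at \<open>s = k\<close>
    cancels the correction term of the quotient rule.\<close>
  also have "\<dots> = ?e P * ?e (pderiv_mp x F)"
    using deriv(2)[OF deriv(3)] by simp
  finally show ?case using deriv(3) by (simp add: mult.left_commute)
next
  case (add L T L' T')
  then show ?case by (simp add: mpoly_hom_simps distrib_right)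
next
  case (comp L T L' T')
  have "L (L' u) (of_nat k) (rep_of Q \<beta> v) * mpoly_eval v P ^ k = mpoly_eval v (T (of_nat k) (T' (of_nat k) F))"
    by (rule comp.IH(1)) (use comp in auto)
  then show ?case by simp
qed

lemma poly_map_poly_pderiv_mp: "poly (map_poly (pderiv_mp x) H) (cst s) = pderiv_mp x (poly H (cst s))"
  by (induction H) (simp_all add: map_poly_pCons pderiv_mp_add pderiv_mp_mult)

lemma poly_map_poly_mpoly_eval: "poly (map_poly (mpoly_eval v) H) s = mpoly_eval v (poly H (cst s))"
  by (induction H) (simp_all add: map_poly_pCons mpoly_hom_simps)

text \<open>The coefficients stay in \<open>\<complex>[V]\<^sub>f[s]\<close>: the denominator is a power of \<open>f\<close> and the numerator a polynomial
  in \<open>s\<close> over the polynomial ring.\<close>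

lemma weyl_s_ops_fraction:
  assumes P: "represents Q \<beta> P f" and "L \<in> weyl_s_ops Q \<beta> f"
    and "\<And>s v. mpoly_eval v P \<noteq> 0 \<Longrightarrow>
      u s (rep_of Q \<beta> v) * mpoly_eval v P ^ N = mpoly_eval v (poly H (cst s))"
  shows "\<exists>N H. \<forall>s v. mpoly_eval v P \<noteq> 0 \<longrightarrow>
      L u s (rep_of Q \<beta> v) * mpoly_eval v P ^ N = mpoly_eval v (poly H (cst s))"
  using assms(2-)
proof (induction arbitrary: u N H rule: weyl_s_ops.induct)
  case (scalar c)
  then show ?case
    by (intro exI[of _ N] exI[of _ "smult (cst c) H"]) (simp add: mpoly_hom_simps mult.assoc)
next
  case svar
  then show ?case
    by (intro exI[of _ N] exI[of _ "pCons 0 H"]) (simp add: mpoly_hom_simps mult.assoc)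
next
  case (coord x)
  then show ?case
    by (intro exI[of _ N] exI[of _ "smult (var x) H"])
       (simp add: mpoly_hom_simps mult.assoc coord_fun_rep_of)
next
  case (deriv x)
  \<comment> \<open>The numerator over the denominator \<open>P ^ Suc N\<close>: two terms come from
    the quotient rule, the third from the logarithmic derivative of \<open>f\<close>, where
    \<open>pCons 0\<close> multiplies by \<open>s\<close>.\<close>
  let ?H = "smult P (map_poly (pderiv_mp x) H) - smult (of_nat N * pderiv_mp x P) H
      + pCons 0 (smult (pderiv_mp x P) H)"
  show ?case
  proof (intro exI[of _ "Suc N"] exI[of _ ?H] allI impI)
    fix s v assume v: "mpoly_eval v P \<noteq> 0"
    let ?e = "\<lambda>p. mpoly_eval v p" and ?W = "rep_of Q \<beta> v" and ?F = "poly H (cst s)"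
    have f: "f ?W = ?e P" using P by (simp add: represents_def)
    have "pd x (u s) ?W * ?e P ^ Suc N = ?e P * ?e (pderiv_mp x ?F) - of_nat N * ?e ?F * ?e (pderiv_mp x P)"
      by (rule pd_quotient) (use deriv v in auto)
    then have "(pd x (u s) ?W + s * u s ?W * pd x f ?W / f ?W) * ?e P ^ Suc N
       = ?e P * ?e (pderiv_mp x ?F) - of_nat N * ?e ?F * ?e (pderiv_mp x P)
         + s * (u s ?W * ?e P ^ N) * ?e (pderiv_mp x P)"
      unfolding f pd_represents[OF P deriv(1)] log_derivative_numerator[OF v] by (simp only:)
    also have "u s ?W * ?e P ^ N = ?e ?F" using deriv(2) v by blast
    finally show "(pd x (u s) ?W + s * u s ?W * pd x f ?W / f ?W) * ?e P ^ Suc N = ?e (poly ?H (cst s))"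
      by (simp add: mpoly_hom_simps poly_map_poly_pderiv_mp mult_ac flip: cst_of_nat)
  qed
next
  case (add L L')
  from add.IH(1)[OF add.prems] obtain N1 H1 where 1: "\<And>s v. mpoly_eval v P \<noteq> 0 \<Longrightarrow>
    L u s (rep_of Q \<beta> v) * mpoly_eval v P ^ N1 = mpoly_eval v (poly H1 (cst s))" by blast
  from add.IH(2)[OF add.prems] obtain N2 H2 where 2: "\<And>s v. mpoly_eval v P \<noteq> 0 \<Longrightarrow>
    L' u s (rep_of Q \<beta> v) * mpoly_eval v P ^ N2 = mpoly_eval v (poly H2 (cst s))" by blast
  show ?case
  proof (intro exI[of _ "N1 + N2"] exI[of _ "smult (P ^ N2) H1 + smult (P ^ N1) H2"] allI impI)
    fix s v assume v: "mpoly_eval v P \<noteq> 0"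
    have "(L + L') u s (rep_of Q \<beta> v) * mpoly_eval v P ^ (N1 + N2)
      = (L u s (rep_of Q \<beta> v) * mpoly_eval v P ^ N1) * mpoly_eval v P ^ N2
      + (L' u s (rep_of Q \<beta> v) * mpoly_eval v P ^ N2) * mpoly_eval v P ^ N1"
      by (simp add: algebra_simps power_add)
    then show "(L + L') u s (rep_of Q \<beta> v) * mpoly_eval v P ^ (N1 + N2) =
       mpoly_eval v (poly (smult (P ^ N2) H1 + smult (P ^ N1) H2) (cst s))"
      unfolding 1[OF v] 2[OF v] by (simp add: mpoly_hom_simps algebra_simps)
  qed
next
  case (comp L L')
  from comp.IH(2)[OF comp.prems] obtain N2 H2 where 2: "\<And>s v. mpoly_eval v P \<noteq> 0 \<Longrightarrow>
    L' u s (rep_of Q \<beta> v) * mpoly_eval v P ^ N2 = mpoly_eval v (poly H2 (cst s))" by blast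
  from comp.IH(1)[of "L' u", OF 2] show ?case by simp
qed

subsection \<open>The Bernstein-Sato ideal of a polynomial with a dual operator\<close>

text \<open>Some identities hold only for large \<open>k\<close>, where an exponent
  \<open>k - N\<close> is not truncated; infinitely many points still determine a
  polynomial.\<close>

lemma poly_eqI_nat:
  fixes p q :: "complex poly"
  assumes "\<And>k. k \<ge> k0 \<Longrightarrow> poly p (of_nat k) = poly q (of_nat k)"
  shows "p = q"
proof (rule ccontr)
  assume "p \<noteq> q"
  then have "finite {z. poly (p - q) z = 0}"
    by (intro poly_roots_finite) simp
  moreover have "of_nat ` {k0..} \<subseteq> {z. poly (p - q) z = 0}"
    using assms by auto
  ultimately have "finite ((of_nat :: nat \<Rightarrow> complex) ` {k0..})"
    by (rule rev_finite_subset)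
  then show False
    by (simp add: finite_image_iff inj_on_def infinite_Ici)
qed

definition norm_ratio :: "'c mpoly \<Rightarrow> nat \<Rightarrow> real" where
  "norm_ratio P k = fischer_norm (P ^ Suc k) / fischer_norm (P ^ k)"

text \<open>The constants of the hypothesis need no names: taking a power of \<open>P\<close> for
  \<open>p\<close> shows that they are quotients of consecutive norms, and their product
  telescopes.\<close>

lemma fischer_power_dual:
  assumes "\<And>k. \<exists>c. \<forall>p. fischer (P * p) (P ^ Suc k) = c * fischer p (P ^ k)"
  shows "fischer (P ^ j * p) (P ^ (k + j)) * fischer_norm (P ^ k) = fischer_norm (P ^ (k + j)) * fischer p (P ^ k)"
proof (induction j arbitrary: p)
  case (Suc j)
  obtain c where c: "\<And>p. fischer (P * p) (P ^ Suc (k + j)) = c * fischer p (P ^ (k + j))"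
    using assms by blast
  have n: "of_real (fischer_norm (P ^ (k + Suc j))) = c * of_real (fischer_norm (P ^ (k + j)))"
    using c[of "P ^ (k + j)"] by (simp flip: fischer_self)
  have "fischer (P ^ Suc j * p) (P ^ (k + Suc j)) = c * fischer (P ^ j * p) (P ^ (k + j))"
    using c[of "P ^ j * p"] by (simp add: mult.assoc)
  then show ?case
    using Suc[of p] n by simp
qed simp

theorem bernstein_sato_ideal_eq_multiples:
  assumes P: "represents Q \<beta> P f" and nz: "P \<noteq> 0"
    and dual: "\<And>k. \<exists>c. \<forall>p. fischer (P * p) (P ^ Suc k) = c * fischer p (P ^ k)"
  obtains b where "\<And>k. poly b (of_nat k) = of_real (norm_ratio P k)"
    and "bernstein_sato_ideal Q \<beta> f = {c. b dvd c}"
proof -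
  let ?\<rho> = "\<lambda>k. complex_of_real (norm_ratio P k)" and ?\<iota> = "rep_of Q \<beta>"
  have pos: "fischer_norm (P ^ k) > 0" for k using nz by simp
  have f: "f (?\<iota> v) = mpoly_eval v P" for v using P by (simp add: represents_def)
  have PC: "P \<in> mpolys_in (coords Q \<beta>)" using P by (simp add: represents_def)
  obtain v0 where v0: "mpoly_eval v0 P \<noteq> 0" using nz mpoly_eq_0I by blast

  from weyl_pair_times[OF PC] obtain L0 where "weyl_pair Q \<beta> f L0 (\<lambda>s p. P * p)" ..
  \<comment> \<open>This adjoint is the dual operator, with derivatives for the variables of
    \<open>P\<close> and conjugates for its coefficients.\<close>
  from weyl_pair_adjoint[OF this] obtain L T where L: "weyl_pair Q \<beta> f L T"
    and adj: "\<And>(k::nat) p q. fischer (P * p) q = fischer p (T (of_nat k) q)" by blast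
  have T: "T (of_nat k) (P ^ Suc k) = cst (?\<rho> k) * P ^ k" for k
  proof (rule fischer_eqI)
    fix p
    have "fischer (P * p) (P ^ Suc k) = ?\<rho> k * fischer p (P ^ k)"
      using fischer_power_dual[OF dual, of 1 p k] pos[of k] by (simp add: norm_ratio_def field_simps)
    then show "fischer p (T (of_nat k) (P ^ Suc k)) = fischer p (cst (?\<rho> k) * P ^ k)"
      unfolding adj[of p "P ^ Suc k" k, symmetric] by (simp add: fischer_cst_right)
  qed
  have LT: "L (\<lambda>s W. f W) (of_nat k) (?\<iota> v) = ?\<rho> k" if v: "mpoly_eval v P \<noteq> 0" for k v
  proof -
    have "L (\<lambda>s W. f W) (of_nat k) (?\<iota> v) * mpoly_eval v P ^ k = mpoly_eval v (T (of_nat k) (P ^ Suc k))"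
      by (rule weyl_pair_eval[OF P L]) (simp_all add: f mpoly_hom_simps v)
    then show ?thesis using v by (simp add: T mpoly_hom_simps del: power_Suc)
  qed
  obtain N H where NH: "\<And>s v. mpoly_eval v P \<noteq> 0 \<Longrightarrow>
      L (\<lambda>s W. f W) s (?\<iota> v) * mpoly_eval v P ^ N = mpoly_eval v (poly H (cst s))"
    using weyl_s_ops_fraction[OF P weyl_pair_weyl_s_ops[OF L], of "\<lambda>s W. f W" 0 "[:P:]"] by (auto simp: f)
  \<comment> \<open>One point off the zeros of \<open>f\<close> is enough. At natural numbers the
    value of the operator does not depend on the point, so the polynomial found at \<open>v0\<close>
    serves at all points and then for all \<open>s\<close>.\<close>
  define b where "b = smult (1 / mpoly_eval v0 P ^ N) (map_poly (mpoly_eval v0) H)"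
  have b: "poly b (of_nat k) = ?\<rho> k" for k
    using NH[OF v0, of "of_nat k"] v0 by (simp add: b_def poly_map_poly_mpoly_eval LT field_simps)
  have Lb: "L (\<lambda>s W. f W) s (?\<iota> v) = poly b s" if v: "mpoly_eval v P \<noteq> 0" for s v
  proof -
    have "smult (mpoly_eval v P ^ N) b = map_poly (mpoly_eval v) H"
      by (rule poly_eqI_nat[of 0]) (simp add: b poly_map_poly_mpoly_eval LT[OF v] NH[OF v, symmetric])
    then have "poly b s * mpoly_eval v P ^ N = L (\<lambda>s W. f W) s (?\<iota> v) * mpoly_eval v P ^ N"
      using NH[OF v, of s] by (metis poly_map_poly_mpoly_eval poly_smult mult.commute)
    then show ?thesis using v by simp
  qed

  have mult: "b * e \<in> bernstein_sato_ideal Q \<beta> f" for e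
    unfolding bernstein_sato_ideal_def mem_Collect_eq
  proof (intro bexI allI ballI impI)
    show "(\<lambda>u s W. poly e s * u s W) \<circ> L \<in> weyl_s_ops Q \<beta> f"
      by (intro weyl_s_ops.comp weyl_s_ops_poly weyl_pair_weyl_s_ops[OF L])
    fix s W assume W: "W \<in> Rep Q \<beta>" "f W \<noteq> 0"
    then have "W = ?\<iota> (\<lambda>x. coord_fun x W)" by (simp add: rep_of_coord_fun)
    with W Lb[of "\<lambda>x. coord_fun x W" s] f[of "\<lambda>x. coord_fun x W"]
    show "((\<lambda>u s W. poly e s * u s W) \<circ> L) (\<lambda>s W. f W) s W = poly (b * e) s"
      by (simp add: mult.commute)
  qed

  \<comment> \<open>Pairing with \<open>f\<^sup>k\<close> and moving the operator to the other side leaves only the component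
    of \<open>P\<^sup>* f\<^sup>k\<close> along \<open>f\<^sup>k\<^sup>+\<^sup>1\<close>, which depends polynomially on \<open>k\<close>.\<close>
  have dvd: "b dvd c" if "c \<in> bernstein_sato_ideal Q \<beta> f" for c
  proof -
    from that obtain M where M: "M \<in> weyl_s_ops Q \<beta> f"
      and Mc: "\<And>s W. W \<in> Rep Q \<beta> \<Longrightarrow> f W \<noteq> 0 \<Longrightarrow> M (\<lambda>s W. f W) s W = poly c s"
      unfolding bernstein_sato_ideal_def by blast
    from weyl_s_ops_weyl_pair[OF M] obtain S where S: "weyl_pair Q \<beta> f M S" ..
    from weyl_pair_adjoint[OF S] obtain M' S' where S': "weyl_pair Q \<beta> f M' S'"
      and SS': "\<And>(k::nat) p q. fischer (S (of_nat k) p) q = fischer p (S' (of_nat k) q)" by blast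
    have Sc: "S (of_nat k) (P ^ Suc k) = cst (poly c (of_nat k)) * P ^ k" for k
    proof (rule mpoly_eqI_off_zeros[OF nz])
      fix v assume v: "mpoly_eval v P \<noteq> 0"
      have "M (\<lambda>s W. f W) (of_nat k) (?\<iota> v) * mpoly_eval v P ^ k = mpoly_eval v (S (of_nat k) (P ^ Suc k))"
        by (rule weyl_pair_eval[OF P S]) (simp_all add: f mpoly_hom_simps v)
      then show "mpoly_eval v (S (of_nat k) (P ^ Suc k)) = mpoly_eval v (cst (poly c (of_nat k)) * P ^ k)"
        using v by (simp add: Mc f mpoly_hom_simps)
    qed
    \<comment> \<open>The adjoint operator is applied to \<open>f ^ s\<close> itself, whose
      coefficient is 1. The exponent \<open>N\<close> of the denominator does not depend on
      \<open>s\<close>.\<close>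
    obtain N H where NH: "\<And>s v. mpoly_eval v P \<noteq> 0 \<Longrightarrow>
        M' (\<lambda>s W. 1) s (?\<iota> v) * mpoly_eval v P ^ N = mpoly_eval v (poly H (cst s))"
      using weyl_s_ops_fraction[OF P weyl_pair_weyl_s_ops[OF S'], of "\<lambda>s W. 1" 0 "[:1:]"] by auto
    have S'P: "S' (of_nat k) (P ^ k) = P ^ (k - N) * poly H (cst (of_nat k))" if k: "k \<ge> N" for k
    proof -
      have "P ^ N * S' (of_nat k) (P ^ k) = P ^ N * (P ^ (k - N) * poly H (cst (of_nat k)))"
      proof (rule mpoly_eqI_off_zeros[OF nz])
        fix v assume v: "mpoly_eval v P \<noteq> 0"
        have "M' (\<lambda>s W. 1) (of_nat k) (?\<iota> v) * mpoly_eval v P ^ k = mpoly_eval v (S' (of_nat k) (P ^ k))"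
          by (rule weyl_pair_eval[OF P S']) (simp_all add: mpoly_hom_simps v)
        then have "mpoly_eval v (P ^ N * S' (of_nat k) (P ^ k)) =
           (M' (\<lambda>s W. 1) (of_nat k) (?\<iota> v) * mpoly_eval v P ^ N) * mpoly_eval v P ^ k"
          by (simp add: mpoly_hom_simps mult_ac)
        also have "\<dots> = mpoly_eval v (poly H (cst (of_nat k))) * mpoly_eval v P ^ (N + (k - N))"
          using k by (simp add: NH[OF v])
        finally show "mpoly_eval v (P ^ N * S' (of_nat k) (P ^ k)) =
            mpoly_eval v (P ^ N * (P ^ (k - N) * poly H (cst (of_nat k))))"
          by (simp add: mpoly_hom_simps mult_ac power_add del: le_add_diff_inverse)
      qed
      then show ?thesis using nz by (simp add: mpoly_mult_left_cancel)
    qed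
    \<comment> \<open>The pairing is conjugate linear in its second argument, so \<open>e\<close>
      interpolates it at real values of \<open>s\<close> only, which include the natural
      numbers.\<close>
    define e where "e = map_poly (fischer (P ^ Suc N)) H"
    have e: "poly e (of_nat k) = fischer (P ^ Suc N) (poly H (cst (of_nat k)))" for k
      unfolding e_def
      by (induction H) (simp_all add: map_poly_pCons fischer_add_right fischer_cst_right del: power_Suc)
    let ?K = "complex_of_real (fischer_norm (P ^ Suc N))"
    \<comment> \<open>Cancelling \<open>P ^ (k - N)\<close> against \<open>P ^ Suc k\<close> leaves
      a pairing with the fixed power \<open>P ^ Suc N\<close>. Its norm is the constant
      \<open>?K\<close>, and the norm of \<open>P ^ Suc k\<close> that appears in exchange produces
      the factor \<open>b\<close>.\<close>
    have "smult ?K c = b * e"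
    proof (rule poly_eqI_nat[of N])
      fix k assume k: "k \<ge> N"
      have "poly c (of_nat k) * of_real (fischer_norm (P ^ k)) = fischer (S (of_nat k) (P ^ Suc k)) (P ^ k)"
        by (simp add: Sc fischer_cst_left fischer_self del: power_Suc)
      also have "\<dots> = cnj (fischer (P ^ (k - N) * poly H (cst (of_nat k))) (P ^ (Suc N + (k - N))))"
        using k by (simp add: SS' S'P fischer_cnj del: power_Suc)
      finally have 1: "poly c (of_nat k) * of_real (fischer_norm (P ^ k)) = \<dots>" .
      have "?K * \<dots> = of_real (fischer_norm (P ^ (Suc N + (k - N)))) * poly e (of_nat k)"
        using arg_cong[OF fischer_power_dual[OF dual, of "k - N" "poly H (cst (of_nat k))" "Suc N"], of cnj]
        by (simp add: e fischer_cnj mult.commute del: power_Suc)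
      then have "?K * poly c (of_nat k) * of_real (fischer_norm (P ^ k))
          = of_real (fischer_norm (P ^ Suc k)) * poly e (of_nat k)"
        unfolding mult.assoc 1 using k by (simp del: power_Suc)
      then show "poly (smult ?K c) (of_nat k) = poly (b * e) (of_nat k)"
        using pos[of k] by (simp add: b norm_ratio_def field_simps del: power_Suc)
    qed
    moreover have "?K \<noteq> 0" using pos[of "Suc N"] by (simp del: power_Suc)
    ultimately show ?thesis by (metis dvd_smult_cancel dvd_triv_left)
  qed
  have "bernstein_sato_ideal Q \<beta> f = {c. b dvd c}"
  proof (intro equalityI subsetI)
    fix c assume "c \<in> {c. b dvd c}"
    then obtain e where "c = b * e" by (auto simp: dvd_def)
    then show "c \<in> bernstein_sato_ideal Q \<beta> f" using mult by simp
  qed (use dvd in simp)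
  with b show ?thesis by (rule that)
qed

lemma monic_dvd_antisym:
  fixes p q :: "'r :: idom poly"
  assumes "p dvd q" "q dvd p" "lead_coeff p = 1" "lead_coeff q = 1"
  shows "p = q"
proof -
  obtain k l where k: "q = p * k" and l: "p = q * l"
    using assms(1,2) unfolding dvd_def by blast
  have "p * (k * l) = p * 1" using k l by (metis mult.assoc mult.right_neutral)
  then have "k * l = 1" using assms(3) by (subst (asm) mult_left_cancel) auto
  then have "k dvd 1" by (metis dvd_triv_left)
  then obtain c where c: "k = [:c:]" by (auto simp: is_unit_poly_iff)
  then show ?thesis using assms(3,4) by (auto simp: k lead_coeff_mult split: if_splits)
qed

lemma bernstein_sato_poly_eq:
  assumes "bernstein_sato_ideal Q \<beta> f = {c. b dvd c}" "b \<noteq> 0"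
  shows "bernstein_sato_poly Q \<beta> f = smult (inverse (lead_coeff b)) b"
  unfolding bernstein_sato_poly_def
proof (rule the_equality)
  let ?b = "smult (inverse (lead_coeff b)) b"
  show "lead_coeff ?b = 1 \<and> bernstein_sato_ideal Q \<beta> f = {c. ?b dvd c}"
    using assms by (simp add: smult_dvd_iff)
  fix b' assume b': "lead_coeff b' = 1 \<and> bernstein_sato_ideal Q \<beta> f = {c. b' dvd c}"
  then have eq: "{c. b' dvd c} = {c. b dvd c}"
    using assms(1) by simp
  have iff: "b' dvd c \<longleftrightarrow> b dvd c" for c
    using arg_cong[OF eq, of "\<lambda>A. c \<in> A"] by simp
  have "b' dvd ?b" using iff[of ?b] by (simp add: dvd_smult)
  moreover have "?b dvd b'" using iff[of b'] assms(2) by (simp add: smult_dvd)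
  moreover have "lead_coeff ?b = 1" using assms(2) by simp
  ultimately show "b' = ?b" using b' by (intro monic_dvd_antisym) auto
qed

subsection \<open>Semi-invariants in coordinates\<close>

text \<open>Carrying a matrix together with its inverse keeps the inverse operations of the group
  records out of the computations.\<close>

definition mutually_inverse :: "nat \<Rightarrow> complex mat \<Rightarrow> complex mat \<Rightarrow> bool" where
  "mutually_inverse n A B \<longleftrightarrow> A \<in> carrier_mat n n \<and> B \<in> carrier_mat n n \<and> A * B = 1\<^sub>m n \<and> B * A = 1\<^sub>m n"

definition gl_pair ::
  "('v, 'a) pre_digraph \<Rightarrow> ('v \<Rightarrow> nat) \<Rightarrow> ('v \<Rightarrow> complex mat) \<Rightarrow> ('v \<Rightarrow> complex mat) \<Rightarrow> bool" where
  "gl_pair Q \<beta> g h \<longleftrightarrow> (\<forall>x\<in>verts Q. mutually_inverse (\<beta> x) (g x) (h x))"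

text \<open>The matrix in coordinates of \<open>W \<mapsto> h W g\<close>. For \<open>h\<close>
  inverse to \<open>g\<close> this is the action of the inverse of \<open>g\<close>, through which
  \<open>g\<close> acts on functions.\<close>

definition act_coeff ::
  "('v, 'a) pre_digraph \<Rightarrow> ('v \<Rightarrow> complex mat) \<Rightarrow> ('v \<Rightarrow> complex mat) \<Rightarrow> 'a coord \<Rightarrow> 'a coord \<Rightarrow> complex" where
  "act_coeff Q g h = (\<lambda>(b, i, j) (c, k, l). of_bool (b = c) * h (head Q b) $$ (i, k) * g (tail Q b) $$ (l, j))"

lemma GLn_simps:
  "carrier (GLn n) = Units (ring_mat TYPE(complex) n ())"
  "mult (GLn n) = (*)"
  "one (GLn n) = 1\<^sub>m n"
  by (simp_all add: units_of_carrier units_of_mult units_of_one ring_mat_simps)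

lemma group_GLn: "group (GLn n)"
  by (intro monoid.units_group ring.is_monoid ring_mat)

lemma mutually_inverse_GLn:
  assumes "mutually_inverse n A B"
  shows "A \<in> carrier (GLn n)" "B \<in> carrier (GLn n)" "inv\<^bsub>GLn n\<^esub> A = B" "inv\<^bsub>GLn n\<^esub> B = A"
proof -
  show A: "A \<in> carrier (GLn n)" and B: "B \<in> carrier (GLn n)"
    using assms by (auto simp: GLn_simps Units_def ring_mat_simps mutually_inverse_def)
  show "inv\<^bsub>GLn n\<^esub> A = B" "inv\<^bsub>GLn n\<^esub> B = A"
    using assms by (auto intro!: group.inv_equality[OF group_GLn] A B simp: GLn_simps(2,3) mutually_inverse_def)
qed

lemma GLn_mutually_inverse:
  assumes "A \<in> carrier (GLn n)"
  shows "mutually_inverse n A (inv\<^bsub>GLn n\<^esub> A)"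
  using assms group.inv_closed[OF group_GLn assms] group.l_inv[OF group_GLn assms]
    group.r_inv[OF group_GLn assms]
  by (auto simp: mutually_inverse_def GLn_simps(2,3)) (auto simp: GLn_simps Units_def ring_mat_simps)

lemma sum_act_coeff:
  assumes "finite (arcs Q)" "b \<in> arcs Q"
  shows "(\<Sum>y\<in>coords Q \<beta>. act_coeff Q g h (b, i, j) y * v y) =
    (\<Sum>l<\<beta> (tail Q b). \<Sum>k<\<beta> (head Q b). h (head Q b) $$ (i, k) * v (b, k, l) * g (tail Q b) $$ (l, j))"
proof -
  let ?A = "{b} \<times> {..<\<beta> (head Q b)} \<times> {..<\<beta> (tail Q b)}"
  have "(\<Sum>y\<in>coords Q \<beta>. act_coeff Q g h (b, i, j) y * v y) = (\<Sum>y\<in>?A. act_coeff Q g h (b, i, j) y * v y)"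
    using assms finite_coords[of Q \<beta>]
    by (intro sum.mono_neutral_right) (auto simp: coords_def act_coeff_def)
  also have "\<dots> = (\<Sum>k<\<beta> (head Q b). \<Sum>l<\<beta> (tail Q b).
      h (head Q b) $$ (i, k) * v (b, k, l) * g (tail Q b) $$ (l, j))"
  proof -
    have "?A = (\<lambda>(k, l). (b, k, l)) ` ({..<\<beta> (head Q b)} \<times> {..<\<beta> (tail Q b)})" by auto
    then show ?thesis
      by (simp add: sum.reindex inj_on_def sum.cartesian_product act_coeff_def case_prod_unfold mult_ac)
  qed
  also have "\<dots> = (\<Sum>l<\<beta> (tail Q b). \<Sum>k<\<beta> (head Q b).
      h (head Q b) $$ (i, k) * v (b, k, l) * g (tail Q b) $$ (l, j))"
    by (rule sum.swap)
  finally show ?thesis .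
qed

lemma rep_act_rep_of:
  assumes Q: "fin_digraph Q"
    and g: "\<And>x. x \<in> verts Q \<Longrightarrow> mutually_inverse (\<beta> x) (g x) (h x)"
    and k: "\<And>x. x \<in> verts Q \<Longrightarrow> k x = h x"
  shows "rep_act Q \<beta> k (rep_of Q \<beta> v) =
    rep_of Q \<beta> (\<lambda>x. \<Sum>y\<in>coords Q \<beta>. act_coeff Q g h x y * v y)"
proof (rule ext)
  interpret fin_digraph Q by (rule Q)
  fix b
  show "rep_act Q \<beta> k (rep_of Q \<beta> v) b =
    rep_of Q \<beta> (\<lambda>x. \<Sum>y\<in>coords Q \<beta>. act_coeff Q g h x y * v y) b"
  proof (cases "b \<in> arcs Q")
    case True
    let ?t = "tail Q b" and ?h = "head Q b"
    have t: "mutually_inverse (\<beta> ?t) (g ?t) (h ?t)" and hd: "mutually_inverse (\<beta> ?h) (g ?h) (h ?h)"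
      using g True by auto
    have "inv\<^bsub>GLn (\<beta> ?t)\<^esub> k ?t = g ?t"
      using mutually_inverse_GLn(4)[OF t] k True by simp
    moreover have "h ?h * mat (\<beta> ?h) (\<beta> ?t) (\<lambda>(i, j). v (b, i, j)) * g ?t =
        mat (\<beta> ?h) (\<beta> ?t) (\<lambda>(i, j). \<Sum>y\<in>coords Q \<beta>. act_coeff Q g h (b, i, j) y * v y)"
      using t hd True
      by (intro eq_matI)
         (auto simp: mutually_inverse_def sum_act_coeff scalar_prod_def atLeast0LessThan
           sum_distrib_right mult.assoc intro!: sum.cong)
    ultimately show ?thesis
      using True k by (simp add: rep_act_def rep_of_def)
  qed (simp add: rep_act_def rep_of_def)
qed

lemma weight_char_cong: "(\<And>x. x \<in> verts Q \<Longrightarrow> g x = g' x) \<Longrightarrow> weight_char Q \<sigma> g = weight_char Q \<sigma> g'"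
  by (simp add: weight_char_def)

lemma semi_invariants_iff:
  assumes Q: "fin_digraph Q" and P: "represents Q \<beta> P f" and off: "\<And>W. W \<notin> Rep Q \<beta> \<Longrightarrow> f W = 0"
  shows "f \<in> semi_invariants Q \<beta> \<sigma> \<longleftrightarrow> (\<forall>g h. gl_pair Q \<beta> g h \<longrightarrow>
    lin_subst (act_coeff Q g h) (coords Q \<beta>) P = cst (weight_char Q \<sigma> g) * P)"
proof -
  interpret fin_digraph Q by (rule Q)
  have ev: "mpoly_eval v P = f (rep_of Q \<beta> v)" for v
    using P by (simp add: represents_def)
  have grp: "\<And>x. group (GLn (\<beta> x))" by (rule group_GLn)
  show ?thesis
  proof (intro iffI allI impI)
    fix g h assume f: "f \<in> semi_invariants Q \<beta> \<sigma>" and gh: "gl_pair Q \<beta> g h"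
    let ?g = "\<lambda>x\<in>verts Q. g x"
    have inv: "x \<in> verts Q \<Longrightarrow> mutually_inverse (\<beta> x) (g x) (h x)" for x
      using gh by (simp add: gl_pair_def)
    have car: "?g \<in> carrier (GL Q \<beta>)"
      using inv mutually_inverse_GLn(1) by auto
    have "(inv\<^bsub>GL Q \<beta>\<^esub> ?g) x = h x" if "x \<in> verts Q" for x
      using car inv mutually_inverse_GLn(3) that by (subst inv_product_group) (auto simp: grp)
    then have "rep_act Q \<beta> (inv\<^bsub>GL Q \<beta>\<^esub> ?g) (rep_of Q \<beta> v) =
        rep_of Q \<beta> (\<lambda>x. \<Sum>y\<in>coords Q \<beta>. act_coeff Q g h x y * v y)" for v
      by (intro rep_act_rep_of[OF Q] inv)
    moreover have "f (rep_act Q \<beta> (inv\<^bsub>GL Q \<beta>\<^esub> ?g) (rep_of Q \<beta> v)) = weight_char Q \<sigma> ?g * f (rep_of Q \<beta> v)" for v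
      using f car by (auto simp: semi_invariants_def)
    moreover have "weight_char Q \<sigma> ?g = weight_char Q \<sigma> g"
      by (rule weight_char_cong) simp
    ultimately show "lin_subst (act_coeff Q g h) (coords Q \<beta>) P = cst (weight_char Q \<sigma> g) * P"
      by (intro mpoly_eqI) (simp add: mpoly_eval_lin_subst ev mpoly_hom_simps)
  next
    assume *: "\<forall>g h. gl_pair Q \<beta> g h \<longrightarrow>
        lin_subst (act_coeff Q g h) (coords Q \<beta>) P = cst (weight_char Q \<sigma> g) * P"
    have "f \<in> poly_funs Q \<beta>" using P off by (auto simp: poly_funs_iff)
    moreover have "f (rep_act Q \<beta> (inv\<^bsub>GL Q \<beta>\<^esub> g) W) = weight_char Q \<sigma> g * f W"
      if car: "g \<in> carrier (GL Q \<beta>)" and W: "W \<in> Rep Q \<beta>" for g W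
    proof -
      let ?h = "inv\<^bsub>GL Q \<beta>\<^esub> g" and ?v = "\<lambda>x. coord_fun x W"
      have "g x \<in> carrier (GLn (\<beta> x))" if "x \<in> verts Q" for x
        using car that by auto
      moreover have "?h x = inv\<^bsub>GLn (\<beta> x)\<^esub> (g x)" if "x \<in> verts Q" for x
        using car that by (subst inv_product_group) (auto simp: grp)
      ultimately have inv: "x \<in> verts Q \<Longrightarrow> mutually_inverse (\<beta> x) (g x) (?h x)" for x
        by (simp add: GLn_mutually_inverse)
      then have "gl_pair Q \<beta> g ?h" by (simp add: gl_pair_def)
      with * have "lin_subst (act_coeff Q g ?h) (coords Q \<beta>) P = cst (weight_char Q \<sigma> g) * P" by blast
      from arg_cong[OF this, of "mpoly_eval ?v"]
      have "f (rep_of Q \<beta> (\<lambda>x. \<Sum>y\<in>coords Q \<beta>. act_coeff Q g ?h x y * ?v y)) =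
          weight_char Q \<sigma> g * f (rep_of Q \<beta> ?v)"
        by (simp add: mpoly_eval_lin_subst ev mpoly_hom_simps)
      also have "rep_of Q \<beta> (\<lambda>x. \<Sum>y\<in>coords Q \<beta>. act_coeff Q g ?h x y * ?v y) = rep_act Q \<beta> ?h (rep_of Q \<beta> ?v)"
        by (rule rep_act_rep_of[OF Q inv refl, symmetric])
      finally show ?thesis using W by (simp add: rep_of_coord_fun)
    qed
    ultimately show "f \<in> semi_invariants Q \<beta> \<sigma>" by (simp add: semi_invariants_def)
  qed
qed

lemma semi_invariantsE:
  assumes "f \<in> semi_invariants Q \<beta> \<sigma>"
  obtains P where "represents Q \<beta> P f" "\<And>W. W \<notin> Rep Q \<beta> \<Longrightarrow> f W = 0"
  using assms by (auto simp: semi_invariants_def poly_funs_iff)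

lemma semi_invariant_off: "f \<in> semi_invariants Q \<beta> \<sigma> \<Longrightarrow> W \<notin> Rep Q \<beta> \<Longrightarrow> f W = 0"
  by (auto simp: semi_invariants_def poly_funs_iff)

lemma semi_invariant_lin_subst:
  assumes "fin_digraph Q" "represents Q \<beta> P f" "f \<in> semi_invariants Q \<beta> \<sigma>" "gl_pair Q \<beta> g h"
  shows "lin_subst (act_coeff Q g h) (coords Q \<beta>) P = cst (weight_char Q \<sigma> g) * P"
  using semi_invariants_iff[OF assms(1,2) semi_invariant_off[OF assms(3)]] assms(3,4) by blast

lemma represents_on_Rep:
  assumes "P \<in> mpolys_in (coords Q \<beta>)"
  shows "represents Q \<beta> P (on_Rep Q \<beta> (\<lambda>W. mpoly_eval (\<lambda>x. coord_fun x W) P))"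
proof -
  have "mpoly_eval (\<lambda>x. coord_fun x (rep_of Q \<beta> v)) P = mpoly_eval v P" for v
    by (rule mpoly_hom_cong[OF assms]) (rule coord_fun_rep_of)
  then show ?thesis using assms by (simp add: represents_def on_Rep_def)
qed

lemma represents_eqI:
  assumes "represents Q \<beta> P f" "represents Q \<beta> P g"
    and "\<And>W. W \<notin> Rep Q \<beta> \<Longrightarrow> f W = 0" "\<And>W. W \<notin> Rep Q \<beta> \<Longrightarrow> g W = 0"
  shows "f = g"
proof
  fix W
  show "f W = g W"
    using assms rep_of_coord_fun[of W Q \<beta>] unfolding represents_def by (cases "W \<in> Rep Q \<beta>") metis+
qed

lemma weight_char_scale: "weight_char Q (\<lambda>x. int k * \<sigma> x) g = weight_char Q \<sigma> g ^ k"
  unfolding weight_char_def prod_power_distrib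
  by (intro prod.cong refl) (simp add: power_int_mult mult.commute[of "int k"])

lemma semi_invariants_power:
  assumes Q: "fin_digraph Q" and P: "represents Q \<beta> P f" and f: "f \<in> semi_invariants Q \<beta> \<sigma>"
  shows "on_Rep Q \<beta> (\<lambda>W. mpoly_eval (\<lambda>x. coord_fun x W) (P ^ k)) \<in> semi_invariants Q \<beta> (\<lambda>x. int k * \<sigma> x)"
proof -
  have C: "P ^ k \<in> mpolys_in (coords Q \<beta>)" using P by (simp add: represents_def)
  show ?thesis
  proof (subst semi_invariants_iff[OF Q represents_on_Rep[OF C]])
    show "\<forall>g h. gl_pair Q \<beta> g h \<longrightarrow> lin_subst (act_coeff Q g h) (coords Q \<beta>) (P ^ k) =
        cst (weight_char Q (\<lambda>x. int k * \<sigma> x) g) * P ^ k"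
    proof (intro allI impI)
      fix g h assume "gl_pair Q \<beta> g h"
      then have "lin_subst (act_coeff Q g h) (coords Q \<beta>) P = cst (weight_char Q \<sigma> g) * P"
        by (rule semi_invariant_lin_subst[OF Q P f])
      then show "lin_subst (act_coeff Q g h) (coords Q \<beta>) (P ^ k) =
          cst (weight_char Q (\<lambda>x. int k * \<sigma> x) g) * P ^ k"
        by (simp add: lin_subst_simps weight_char_scale power_mult_distrib cst_power)
    qed
  qed (simp add: on_Rep_def)
qed

subsection \<open>Multiplicity-free weights\<close>

interpretation fun_vs: vector_space "fun_scale :: complex \<Rightarrow> ('c \<Rightarrow> complex) \<Rightarrow> 'c \<Rightarrow> complex"
  by (rule vector_space_fun_scale)

lemma dim_eq_1_iff:
  fixes S :: "('c \<Rightarrow> complex) set"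
  assumes "u \<in> S" "u \<noteq> (\<lambda>_. 0)"
  shows "vector_space.dim fun_scale S = 1 \<longleftrightarrow> (\<forall>w\<in>S. \<exists>c. w = fun_scale c u)"
proof
  assume dim: "vector_space.dim fun_scale S = 1"
  obtain B where B: "B \<subseteq> S" "fun_vs.independent B" "S \<subseteq> fun_vs.span B" "card B = fun_vs.dim S"
    using fun_vs.basis_exists[of S] by metis
  then obtain b where b: "B = {b}" using dim by (auto simp: card_1_singleton_iff)
  have mul: "\<exists>c. w = fun_scale c b" if "w \<in> S" for w
    using that B(3) by (auto simp: b fun_vs.span_singleton)
  show "\<forall>w\<in>S. \<exists>c. w = fun_scale c u"
  proof
    fix w assume w: "w \<in> S"
    obtain c d where c: "u = fun_scale c b" and d: "w = fun_scale d b" using mul w assms(1) by metis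
    have "c \<noteq> 0" using assms(2) c by auto
    then have "w = fun_scale (d / c) u" by (simp add: c d)
    then show "\<exists>c. w = fun_scale c u" ..
  qed
next
  assume *: "\<forall>w\<in>S. \<exists>c. w = fun_scale c u"
  have "u \<noteq> 0" using assms(2) by (simp add: zero_fun_def)
  then have "fun_vs.independent {u}" by simp
  moreover have "S \<subseteq> fun_vs.span {u}"
    using * by (auto simp: fun_vs.span_singleton)
  ultimately show "vector_space.dim fun_scale S = 1"
    using assms(1) by (intro fun_vs.dim_unique[of "{u}"]) auto
qed

text \<open>\<open>P ^ k\<close> is a nonzero semi-invariant of the weight in question, so
  one-dimensionality amounts to proportionality to it.\<close>

lemma multiplicity_free_iff:
  assumes Q: "fin_digraph Q" and P: "represents Q \<beta> P f" and f: "f \<in> semi_invariants Q \<beta> \<sigma>"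
    and nz: "P \<noteq> 0"
  shows "multiplicity_free Q \<beta> \<sigma> \<longleftrightarrow>
    (\<forall>k. \<forall>w\<in>semi_invariants Q \<beta> (\<lambda>x. int k * \<sigma> x). \<forall>R. represents Q \<beta> R w \<longrightarrow> (\<exists>c. R = cst c * P ^ k))"
proof -
  define F where "F k = on_Rep Q \<beta> (\<lambda>W. mpoly_eval (\<lambda>x. coord_fun x W) (P ^ k))" for k
  have FS: "F k \<in> semi_invariants Q \<beta> (\<lambda>x. int k * \<sigma> x)" for k
    unfolding F_def by (rule semi_invariants_power[OF Q P f])
  have PF: "represents Q \<beta> (P ^ k) (F k)" for k
    unfolding F_def by (rule represents_on_Rep) (use P in \<open>simp add: represents_def\<close>)
  have off: "W \<notin> Rep Q \<beta> \<Longrightarrow> F k W = 0" for k W by (simp add: F_def on_Rep_def)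
  have "F k \<noteq> (\<lambda>_. 0)" for k
    using represents_eq_0_iff[OF PF off] nz by simp
  note dim = dim_eq_1_iff[OF FS this]
  have "(\<exists>c. w = fun_scale c (F k)) \<longleftrightarrow> (\<forall>R. represents Q \<beta> R w \<longrightarrow> (\<exists>c. R = cst c * P ^ k))"
    if w: "w \<in> semi_invariants Q \<beta> (\<lambda>x. int k * \<sigma> x)" for w k
  proof
    assume "\<exists>c. w = fun_scale c (F k)"
    then obtain c where c: "w = fun_scale c (F k)" ..
    show "\<forall>R. represents Q \<beta> R w \<longrightarrow> (\<exists>c. R = cst c * P ^ k)"
    proof (intro allI impI exI)
      fix R assume "represents Q \<beta> R w"
      then show "R = cst c * P ^ k"
        using PF[of k] by (intro mpoly_eqI) (simp add: represents_def c mpoly_hom_mult flip: mpoly_hom_power)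
    qed
  next
    assume *: "\<forall>R. represents Q \<beta> R w \<longrightarrow> (\<exists>c. R = cst c * P ^ k)"
    from w obtain R where R: "represents Q \<beta> R w" and woff: "\<And>W. W \<notin> Rep Q \<beta> \<Longrightarrow> w W = 0"
      by (rule semi_invariantsE) blast
    with * obtain c where c: "R = cst c * P ^ k" by blast
    have "w = fun_scale c (F k)"
      by (rule represents_eqI[OF R])
         (use PF[of k] R off woff in \<open>auto simp: represents_def c mpoly_hom_mult\<close>)
    then show "\<exists>c. w = fun_scale c (F k)" ..
  qed
  then show ?thesis
    unfolding multiplicity_free_def dim by blast
qed

section \<open>Conjugate transposes and the dual operator\<close>

definition adjoint_mat :: "nat \<Rightarrow> complex mat \<Rightarrow> complex mat" where
  "adjoint_mat n A = mat n n (\<lambda>(i, j). cnj (A $$ (j, i)))"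

lemma det_adjoint_mat:
  assumes "A \<in> carrier_mat n n"
  shows "det (adjoint_mat n A) = cnj (det A)"
proof -
  interpret cnj_hom: comm_ring_hom cnj by standard auto
  have "adjoint_mat n A = map_mat cnj (transpose_mat A)"
    using assms by (intro eq_matI) (auto simp: adjoint_mat_def)
  then show ?thesis using assms by (simp add: cnj_hom.hom_det det_transpose)
qed

lemma adjoint_mat_mult:
  assumes "A \<in> carrier_mat n n" "B \<in> carrier_mat n n"
  shows "adjoint_mat n (A * B) = adjoint_mat n B * adjoint_mat n A"
  using assms by (intro eq_matI) (auto simp: adjoint_mat_def scalar_prod_def mult.commute)

lemma mutually_inverse_adjoint:
  assumes "mutually_inverse n A B"
  shows "mutually_inverse n (adjoint_mat n A) (adjoint_mat n B)"
proof -
  have "adjoint_mat n (1\<^sub>m n) = 1\<^sub>m n"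
    by (intro eq_matI) (auto simp: adjoint_mat_def)
  with assms show ?thesis
    unfolding mutually_inverse_def by (metis adjoint_mat_mult adjoint_mat_def mat_carrier)
qed

lemma weight_char_adjoint:
  assumes "gl_pair Q \<beta> g h"
  shows "weight_char Q \<sigma> (\<lambda>x. adjoint_mat (\<beta> x) (g x)) = cnj (weight_char Q \<sigma> g)"
  unfolding weight_char_def cnj_prod
proof (rule prod.cong[OF refl])
  fix x assume "x \<in> verts Q"
  then have "g x \<in> carrier_mat (\<beta> x) (\<beta> x)"
    using assms by (simp add: gl_pair_def mutually_inverse_def)
  then show "det (adjoint_mat (\<beta> x) (g x)) powi \<sigma> x = cnj (det (g x) powi \<sigma> x)"
    by (simp add: det_adjoint_mat)
qed

lemma weight_char_nonzero:
  assumes "finite (verts Q)" "gl_pair Q \<beta> g h"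
  shows "weight_char Q \<sigma> g \<noteq> 0"
proof -
  have "det (g x) \<noteq> 0" if "x \<in> verts Q" for x
  proof -
    have "mutually_inverse (\<beta> x) (g x) (h x)" using assms(2) that by (simp add: gl_pair_def)
    then have "det (g x) * det (h x) = 1"
      unfolding mutually_inverse_def by (metis det_mult det_one)
    then show ?thesis by auto
  qed
  then show ?thesis using assms(1) by (simp add: weight_char_def)
qed

text \<open>Since the group is stable under conjugate transpose, the dual operator \<open>f\<^sup>*(\<partial>)\<close> maps
  semi-invariants to semi-invariants.\<close>

lemma multiplicity_free_dual:
  assumes Q: "fin_digraph Q" and P: "represents Q \<beta> P f" and f: "f \<in> semi_invariants Q \<beta> \<sigma>"
    and nz: "P \<noteq> 0" and mf: "multiplicity_free Q \<beta> \<sigma>"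
  shows "\<exists>c. \<forall>p. fischer (P * p) (P ^ Suc k) = c * fischer p (P ^ k)"
proof -
  interpret fin_digraph Q by (rule Q)
  let ?C = "coords Q \<beta>"
  have fin: "finite ?C" by (simp add: finite_coords)
  have PC: "P \<in> mpolys_in ?C" using P by (simp add: represents_def)
  from weyl_pair_times[OF PC] obtain L0 where "weyl_pair Q \<beta> f L0 (\<lambda>s p. P * p)" ..
  from weyl_pair_adjoint[OF this] obtain L T where L: "weyl_pair Q \<beta> f L T"
    and adj: "\<And>(k::nat) p q. fischer (P * p) q = fischer p (T (of_nat k) q)" by blast
  define G where "G = T (of_nat k) (P ^ Suc k)"
  have T_in: "T s p \<in> mpolys_in ?C" if "p \<in> mpolys_in ?C" for s p
    using L that by (induction arbitrary: p rule: weyl_pair.induct) auto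
  have GC: "G \<in> mpolys_in ?C" unfolding G_def by (rule T_in) (use PC in simp)
  have G: "fischer p G = fischer (P * p) (P ^ Suc k)" for p
    unfolding G_def by (rule adj[symmetric])
  have Gtrans: "lin_subst (act_coeff Q g h) ?C G = cst (weight_char Q (\<lambda>x. int k * \<sigma> x) g) * G"
    if gh: "gl_pair Q \<beta> g h" for g h
  proof (rule fischer_eqI_in)
    let ?a = "act_coeff Q g h" and ?\<theta> = "weight_char Q \<sigma> g"
    let ?g = "\<lambda>x. adjoint_mat (\<beta> x) (g x)" and ?h = "\<lambda>x. adjoint_mat (\<beta> x) (h x)"
    let ?S = "lin_subst (\<lambda>y x. cnj (?a x y)) ?C"
    have gh': "gl_pair Q \<beta> ?g ?h"
      using gh by (simp add: gl_pair_def mutually_inverse_adjoint)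
    have S: "?S q = lin_subst (act_coeff Q ?g ?h) ?C q" if q: "q \<in> mpolys_in ?C" for q
      unfolding lin_subst_def
    proof (rule mpoly_hom_cong[OF q], rule sum.cong[OF refl])
      fix x y assume "x \<in> ?C" "y \<in> ?C"
      then have "cnj (?a y x) = act_coeff Q ?g ?h x y"
        by (auto simp: coords_def act_coeff_def adjoint_mat_def)
      then show "cst (cnj (?a y x)) * var y = cst (act_coeff Q ?g ?h x y) * var y" by simp
    qed
    have tr: "lin_subst ?a ?C P = cst ?\<theta> * P"
      by (rule semi_invariant_lin_subst[OF Q P f gh])
    have "lin_subst (act_coeff Q ?g ?h) ?C P = cst (weight_char Q \<sigma> ?g) * P"
      by (rule semi_invariant_lin_subst[OF Q P f gh'])
    then have tr': "?S P = cst (cnj ?\<theta>) * P"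
      by (simp add: S[OF PC] weight_char_adjoint[OF gh])
    fix p :: "'b coord mpoly" assume p: "p \<in> mpolys_in ?C"
    have Sp: "?S p \<in> mpolys_in ?C" by (rule lin_subst_in)
    have nz': "?\<theta> \<noteq> 0" using gh by (intro weight_char_nonzero) auto
    have adjS: "fischer (?S p) q = fischer p (lin_subst ?a ?C q)" if "p \<in> mpolys_in ?C" "q \<in> mpolys_in ?C" for p q
      using fischer_lin_subst[OF that fin fin, of "\<lambda>y x. cnj (?a x y)"] by simp
    \<comment> \<open>The substitution \<open>?S\<close> is multiplicative and scales
      \<open>P\<close> by the conjugate character, so this factor is absorbed into
      \<open>?S (P * p)\<close>. Back on the other side \<open>P ^ Suc k\<close> contributes k + 1
      factors; one cancels, and the character of weight \<open>k\<close> is left.\<close>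
    have "cnj ?\<theta> * fischer p (lin_subst ?a ?C G) = cnj ?\<theta> * fischer (?S p) G"
      by (simp add: adjS[OF p GC])
    also have "\<dots> = fischer (cst (cnj ?\<theta>) * P * ?S p) (P ^ Suc k)"
      by (simp add: G mult.assoc fischer_cst_left del: power_Suc)
    also have "\<dots> = fischer (?S (P * p)) (P ^ Suc k)"
      by (simp only: lin_subst_simps tr')
    also have "\<dots> = fischer (P * p) (lin_subst ?a ?C (P ^ Suc k))"
      by (rule adjS) (use p PC in simp_all)
    also have "\<dots> = cnj (?\<theta> ^ Suc k) * fischer p G"
      by (simp only: lin_subst_simps tr power_mult_distrib cst_power[symmetric] fischer_cst_right G)
    finally have "fischer p (lin_subst ?a ?C G) = cnj (?\<theta> ^ k) * fischer p G"
      using nz' by simp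
    then show "fischer p (lin_subst ?a ?C G) = fischer p (cst (weight_char Q (\<lambda>x. int k * \<sigma> x) g) * G)"
      by (simp add: fischer_cst_right weight_char_scale)
  qed (use GC in \<open>auto simp: lin_subst_in\<close>)
  let ?w = "on_Rep Q \<beta> (\<lambda>W. mpoly_eval (\<lambda>x. coord_fun x W) G)"
  have Gw: "represents Q \<beta> G ?w" by (rule represents_on_Rep[OF GC])
  have "?w \<in> semi_invariants Q \<beta> (\<lambda>x. int k * \<sigma> x)"
    by (subst semi_invariants_iff[OF Q Gw]) (auto simp: on_Rep_def Gtrans)
  with mf Gw obtain c where "G = cst c * P ^ k"
    unfolding multiplicity_free_iff[OF Q P f nz] by blast
  then have "\<forall>p. fischer (P * p) (P ^ Suc k) = cnj c * fischer p (P ^ k)"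
    by (simp add: G[symmetric] fischer_cst_right del: power_Suc)
  then show ?thesis ..
qed

subsection \<open>Infinitesimal invariance\<close>

text \<open>The matrix in coordinates of left multiplication by the elementary matrix E_rs on arrows
  into \<open>x\<close>; \<open>tail_unit\<close> is right multiplication by E_sr on arrows out of
  \<open>x\<close>. In both, the entry with index \<open>r\<close> receives the one with index
  \<open>s\<close>.\<close>

definition head_unit :: "('v, 'a) pre_digraph \<Rightarrow> 'v \<Rightarrow> nat \<Rightarrow> nat \<Rightarrow> 'a coord \<Rightarrow> 'a coord \<Rightarrow> complex" where
  "head_unit Q x r s u w = of_bool (head Q (fst u) = x \<and> fst (snd u) = r \<and> w = (fst u, s, snd (snd u)))"

definition tail_unit :: "('v, 'a) pre_digraph \<Rightarrow> 'v \<Rightarrow> nat \<Rightarrow> nat \<Rightarrow> 'a coord \<Rightarrow> 'a coord \<Rightarrow> complex" where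
  "tail_unit Q x r s u w = of_bool (tail Q (fst u) = x \<and> snd (snd u) = r \<and> w = (fst u, fst (snd u), s))"

lemma unit_adjoint:
  "cnj (head_unit Q x r s u w) = head_unit Q x s r w u"
  "cnj (tail_unit Q x r s u w) = tail_unit Q x s r w u"
  by (auto simp: head_unit_def tail_unit_def prod_eq_iff)

text \<open>The matrix \<open>1 + t E_rs\<close>. On the diagonal its inverse is not affine in t, so
  the entries of \<open>B\<close> are given for \<open>r \<noteq> s\<close>.\<close>

lemma elementary_matrices:
  assumes "r < n" "s < n" "t \<noteq> -1"
  obtains A B where "mutually_inverse n A B" "det A = (if r = s then 1 + t else 1)"
    "det B = inverse (det A)"
    "\<And>i j. i < n \<Longrightarrow> j < n \<Longrightarrow> A $$ (i, j) = of_bool (i = j) + t * of_bool (i = r \<and> j = s)"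
    "r \<noteq> s \<Longrightarrow> (\<And>i j. i < n \<Longrightarrow> j < n \<Longrightarrow> B $$ (i, j) = of_bool (i = j) - t * of_bool (i = r \<and> j = s))"
proof (cases "r = s")
  case True
  have t: "1 + t \<noteq> 0" using assms(3) by (metis add.commute eq_neg_iff_add_eq_0)
  show ?thesis
  proof (rule that[of "multrow_mat n r (1 + t)" "multrow_mat n r (inverse (1 + t))"])
    show "mutually_inverse n (multrow_mat n r (1 + t)) (multrow_mat n r (inverse (1 + t)))"
      using multrow_mat_inv[OF assms(1) t] multrow_mat_inv[OF assms(1), of "inverse (1 + t)"] t
      by (simp add: mutually_inverse_def)
  qed (use True assms(1) in \<open>auto simp: det_multrow_mat\<close>)
next
  case False
  show ?thesis
  proof (rule that[of "addrow_mat n t r s" "addrow_mat n (- t) r s"])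
    show "mutually_inverse n (addrow_mat n t r s) (addrow_mat n (- t) r s)"
      using addrow_mat_inv[OF assms(1,2) False, of t] addrow_mat_inv[OF assms(1,2) False, of "- t"]
      by (simp add: mutually_inverse_def)
  qed (use False assms(1,2) in \<open>auto simp: det_addrow_mat\<close>)
qed

lemma gl_pair_at:
  assumes "mutually_inverse (\<beta> x) A B"
  shows "gl_pair Q \<beta> ((\<lambda>y. 1\<^sub>m (\<beta> y))(x := A)) ((\<lambda>y. 1\<^sub>m (\<beta> y))(x := B))"
  using assms by (auto simp: gl_pair_def mutually_inverse_def)

lemma weight_char_at:
  assumes "finite (verts Q)" "x \<in> verts Q"
  shows "weight_char Q \<sigma> ((\<lambda>y. 1\<^sub>m (\<beta> y))(x := A)) = det A powi \<sigma> x"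
proof -
  have "weight_char Q \<sigma> ((\<lambda>y. 1\<^sub>m (\<beta> y))(x := A)) = (\<Prod>y\<in>verts Q. if y = x then det A powi \<sigma> x else 1)"
    unfolding weight_char_def by (intro prod.cong refl) auto
  then show ?thesis using assms by (simp add: prod.delta)
qed

lemma sum_act_coeff_at:
  assumes "finite (arcs Q)" "(b, i, j) \<in> coords Q \<beta>"
    and "\<And>b. b \<in> arcs Q \<Longrightarrow> \<not> (tail Q b = x \<and> head Q b = x)"
  shows "(\<Sum>y\<in>coords Q \<beta>. act_coeff Q ((\<lambda>y. 1\<^sub>m (\<beta> y))(x := A)) ((\<lambda>y. 1\<^sub>m (\<beta> y))(x := B)) (b, i, j) y * v y) =
    (if tail Q b = x then \<Sum>l<\<beta> x. v (b, i, l) * A $$ (l, j)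
     else if head Q b = x then \<Sum>k<\<beta> x. B $$ (i, k) * v (b, k, j)
     else v (b, i, j))"
proof -
  have b: "b \<in> arcs Q" "i < \<beta> (head Q b)" "j < \<beta> (tail Q b)" using assms(2) by (auto simp: coords_def)
  have 1: "(\<Sum>k<n. (if i = k then 1 else 0) * F k) = F i" if "i < n" for n i and F :: "nat \<Rightarrow> complex"
  proof -
    have "(\<Sum>k<n. (if i = k then 1 else 0) * F k) = (\<Sum>k<n. if k = i then F k else 0)"
      by (intro sum.cong refl) auto
    then show ?thesis using that by (simp add: sum.delta)
  qed
  have 2: "(\<Sum>k<n. F k * (if k = j then 1 else 0)) = F j" if "j < n" for n j and F :: "nat \<Rightarrow> complex"
  proof -
    have "(\<Sum>k<n. F k * (if k = j then 1 else 0)) = (\<Sum>k<n. if k = j then F k else 0)"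
      by (intro sum.cong refl) auto
    then show ?thesis using that by (simp add: sum.delta)
  qed
  show ?thesis
    using assms(3)[OF b(1)] b
    by (auto simp: sum_act_coeff[OF assms(1) b(1)] 1 2 simp flip: sum_distrib_right cong: sum.cong_simp)
qed

lemma sum_of_bool_eq:
  assumes "finite C" "c \<Longrightarrow> w0 \<in> C"
  shows "(\<Sum>w\<in>C. cst (of_bool (c \<and> w = w0)) * (var w * Z)) = (if c then var w0 * Z else 0)"
    and "(\<Sum>w\<in>C. of_bool (c \<and> w = w0) * v w) = (if c then v w0 else (0 :: complex))"
proof -
  have "(\<Sum>w\<in>C. cst (of_bool (c \<and> w = w0)) * (var w * Z)) = (\<Sum>w\<in>C. if w = w0 then if c then var w * Z else 0 else 0)"
    "(\<Sum>w\<in>C. of_bool (c \<and> w = w0) * v w) = (\<Sum>w\<in>C. if w = w0 then if c then v w else 0 else 0)"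
    by (auto intro!: sum.cong)
  then show "(\<Sum>w\<in>C. cst (of_bool (c \<and> w = w0)) * (var w * Z)) = (if c then var w0 * Z else 0)"
    "(\<Sum>w\<in>C. of_bool (c \<and> w = w0) * v w) = (if c then v w0 else 0)"
    using assms by (auto simp: sum.delta)
qed

lemma sum_head_unit:
  assumes "finite (arcs Q)" "u \<in> coords Q \<beta>" "s < \<beta> x"
  shows "(\<Sum>w\<in>coords Q \<beta>. cst (head_unit Q x r s u w) * (var w * Z)) =
    (if head Q (fst u) = x \<and> fst (snd u) = r then var (fst u, s, snd (snd u)) * Z else 0)"
    and "(\<Sum>w\<in>coords Q \<beta>. head_unit Q x r s u w * v w) =
    (if head Q (fst u) = x \<and> fst (snd u) = r then v (fst u, s, snd (snd u)) else 0)"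
  unfolding head_unit_def conj_assoc[symmetric]
  by (rule sum_of_bool_eq[OF finite_coords[OF assms(1)]]; use assms in \<open>auto simp: coords_def\<close>)+

lemma sum_tail_unit:
  assumes "finite (arcs Q)" "u \<in> coords Q \<beta>" "s < \<beta> x"
  shows "(\<Sum>w\<in>coords Q \<beta>. cst (tail_unit Q x r s u w) * (var w * Z)) =
    (if tail Q (fst u) = x \<and> snd (snd u) = r then var (fst u, fst (snd u), s) * Z else 0)"
    and "(\<Sum>w\<in>coords Q \<beta>. tail_unit Q x r s u w * v w) =
    (if tail Q (fst u) = x \<and> snd (snd u) = r then v (fst u, fst (snd u), s) else 0)"
  unfolding tail_unit_def conj_assoc[symmetric]
  by (rule sum_of_bool_eq[OF finite_coords[OF assms(1)]]; use assms in \<open>auto simp: coords_def\<close>)+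

text \<open>These are the derivatives at t = 0 of the invariance under \<open>1 + t E_rs\<close> at
  \<open>x\<close>. Off the diagonal the determinant is 1 and the derivative vanishes. On the
  diagonal the weight appears, with the opposite sign for arrows into \<open>x\<close>, on which the
  inverse acts. At a loop the action would not be affine in t.\<close>

lemma semi_invariant_lin_field:
  assumes Q: "fin_digraph Q" and P: "represents Q \<beta> P f" and f: "f \<in> semi_invariants Q \<beta> \<sigma>"
    and x: "x \<in> verts Q" and rs: "r < \<beta> x" "s < \<beta> x"
    and nl: "\<And>b. b \<in> arcs Q \<Longrightarrow> \<not> (tail Q b = x \<and> head Q b = x)"
  shows "r \<noteq> s \<Longrightarrow> lin_field (\<lambda>u w. head_unit Q x r s u w - tail_unit Q x s r u w) (coords Q \<beta>) P = 0"
    and "(\<And>b. b \<in> arcs Q \<Longrightarrow> head Q b \<noteq> x) \<Longrightarrow>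
      lin_field (tail_unit Q x r s) (coords Q \<beta>) P = (if r = s then cst (of_int (\<sigma> x)) * P else 0)"
    and "(\<And>b. b \<in> arcs Q \<Longrightarrow> tail Q b \<noteq> x) \<Longrightarrow>
      lin_field (head_unit Q x r s) (coords Q \<beta>) P = (if r = s then cst (of_int (- \<sigma> x)) * P else 0)"
proof -
  interpret fin_digraph Q by (rule Q)
  let ?C = "coords Q \<beta>"
  have fin: "finite (arcs Q)" and finC: "finite ?C" by (simp_all add: finite_coords)
  have PC: "P \<in> mpolys_in ?C" using P by (simp add: represents_def)
  let ?g = "\<lambda>A. (\<lambda>y. 1\<^sub>m (\<beta> y))(x := A) :: 'a \<Rightarrow> complex mat"
  have inv: "mpoly_eval v' P = det A powi \<sigma> x * mpoly_eval v P"
    if AB: "mutually_inverse (\<beta> x) A B" and v': "\<And>b i j. (b, i, j) \<in> ?C \<Longrightarrow>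
      v' (b, i, j) = (\<Sum>y\<in>?C. act_coeff Q (?g A) (?g B) (b, i, j) y * v y)" for A B v v'
  proof -
    have "lin_subst (act_coeff Q (?g A) (?g B)) ?C P = cst (weight_char Q \<sigma> (?g A)) * P"
      by (rule semi_invariant_lin_subst[OF Q P f gl_pair_at[of \<beta> x A B, OF AB]])
    then have "mpoly_eval v (lin_subst (act_coeff Q (?g A) (?g B)) ?C P) = det A powi \<sigma> x * mpoly_eval v P"
      using x by (simp add: weight_char_at mpoly_hom_simps)
    moreover have "mpoly_eval v' P = mpoly_eval v (lin_subst (act_coeff Q (?g A) (?g B)) ?C P)"
      unfolding mpoly_eval_lin_subst by (rule mpoly_hom_cong[OF PC]) (use v' in auto)
    ultimately show ?thesis by simp
  qed
  have dl: "(\<Sum>k<n. (of_bool (i = k) + t * of_bool (i = r \<and> k = s)) * F k) = F i + t * (of_bool (i = r) * F s)"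
    if "i < n" "s < n" for n i r s :: nat and t :: complex and F
  proof -
    have "(\<Sum>k<n. (of_bool (i = k) + t * of_bool (i = r \<and> k = s)) * F k) =
      (\<Sum>k<n. if k = i then F k else 0) + (\<Sum>k<n. if k = s then t * (of_bool (i = r) * F k) else 0)"
      unfolding sum.distrib[symmetric] by (intro sum.cong refl) (auto simp: algebra_simps)
    then show ?thesis using that by (simp add: sum.delta)
  qed
  have dr: "(\<Sum>k<n. F k * (of_bool (k = j) + t * of_bool (k = s \<and> j = r))) = F j + t * (of_bool (j = r) * F s)"
    if "j < n" "s < n" for n j r s :: nat and t :: complex and F
  proof -
    have "(\<Sum>k<n. F k * (of_bool (k = j) + t * of_bool (k = s \<and> j = r))) =
      (\<Sum>k<n. if k = j then F k else 0) + (\<Sum>k<n. if k = s then t * (of_bool (j = r) * F k) else 0)"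
      unfolding sum.distrib[symmetric] by (intro sum.cong refl) (auto simp: algebra_simps)
    then show ?thesis using that by (simp add: sum.delta)
  qed
  have dl1: "(\<Sum>k<n. (of_bool (r = k) + t * of_bool (k = s)) * F k) = F r + t * F s"
    if "r < n" "s < n" for n r s :: nat and t :: complex and F
    using dl[where i = r and r = r and s = s and n = n and t = t and F = F] that by simp
  have dr1: "(\<Sum>k<n. F k * (of_bool (k = r) + t * of_bool (k = s))) = F r + t * F s"
    if "r < n" "s < n" for n r s :: nat and t :: complex and F
    using dr[where j = r and r = r and s = s and n = n and t = t and F = F] that by simp
  have powi: "((\<lambda>t :: complex. (1 + t) powi k) has_field_derivative of_int k) (at 0)" for k
    by (auto intro!: derivative_eq_intros)
  show "lin_field (\<lambda>u w. head_unit Q x r s u w - tail_unit Q x s r u w) ?C P = 0" if "r \<noteq> s"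
  proof -
    have "mpoly_eval (\<lambda>u. v u + t * (\<Sum>w\<in>?C. (head_unit Q x r s u w - tail_unit Q x s r u w) * v w)) P
        = 1 * mpoly_eval v P" if t: "t \<noteq> -1" for t v
    proof -
      \<comment> \<open>Arrows into \<open>x\<close> are multiplied by the inverse of the group
        element, so the inverse \<open>B\<close> is chosen as \<open>1 + t E_rs\<close>; arrows out
        of \<open>x\<close> then see \<open>A = 1 - t E_rs\<close>.\<close>
      obtain B A where BA: "mutually_inverse (\<beta> x) B A" "det B = 1" "det A = inverse (det B)"
        and B: "\<And>i j. i < \<beta> x \<Longrightarrow> j < \<beta> x \<Longrightarrow> B $$ (i, j) = of_bool (i = j) + t * of_bool (i = r \<and> j = s)"
        and A: "\<And>i j. i < \<beta> x \<Longrightarrow> j < \<beta> x \<Longrightarrow> A $$ (i, j) = of_bool (i = j) - t * of_bool (i = r \<and> j = s)"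
        using elementary_matrices[OF rs t] \<open>r \<noteq> s\<close> by metis
      have "mutually_inverse (\<beta> x) A B" using BA by (simp add: mutually_inverse_def)
      then have "mpoly_eval (\<lambda>u. v u + t * (\<Sum>w\<in>?C. (head_unit Q x r s u w - tail_unit Q x s r u w) * v w)) P
          = det A powi \<sigma> x * mpoly_eval v P"
      proof (rule inv)
        fix b i j assume u: "(b, i, j) \<in> ?C"
        then have b: "b \<in> arcs Q" "i < \<beta> (head Q b)" "j < \<beta> (tail Q b)" by (auto simp: coords_def)
        have dr': "(\<Sum>l<\<beta> x. v (b, i, l) * (of_bool (l = j) - t * of_bool (l = r \<and> j = s))) =
            v (b, i, j) - t * (of_bool (j = s) * v (b, i, r))" if "j < \<beta> x"
          using dr[OF that rs(1), of "\<lambda>l. v (b, i, l)" "- t" s] by simp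
        have dr1': "(\<Sum>l<\<beta> x. v (b, i, l) * (of_bool (l = s) - t * of_bool (l = r))) =
            v (b, i, s) - t * v (b, i, r)"
          using dr1[OF rs(2,1), of "\<lambda>l. v (b, i, l)" "- t"] by simp
        show "v (b, i, j) + t * (\<Sum>w\<in>?C. (head_unit Q x r s (b, i, j) w - tail_unit Q x s r (b, i, j) w) * v w)
            = (\<Sum>y\<in>?C. act_coeff Q (?g A) (?g B) (b, i, j) y * v y)"
          using b rs nl
          by (auto simp: left_diff_distrib sum_subtractf sum_head_unit[OF fin u] sum_tail_unit[OF fin u]
              sum_act_coeff_at[OF fin u nl] A B dl dr' dl1 dr1' cong: sum.cong_simp)
      qed
      then show ?thesis using BA by simp
    qed
    from lin_field_eq_cst_mult[OF PC finC this DERIV_const] show ?thesis by simp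
  qed
  show "lin_field (tail_unit Q x r s) ?C P = (if r = s then cst (of_int (\<sigma> x)) * P else 0)"
    if nh: "\<And>b. b \<in> arcs Q \<Longrightarrow> head Q b \<noteq> x"
  proof -
    have ev: "mpoly_eval (\<lambda>u. v u + t * (\<Sum>w\<in>?C. tail_unit Q x r s u w * v w)) P
        = (if r = s then 1 + t else 1) powi \<sigma> x * mpoly_eval v P" if t: "t \<noteq> -1" for t v
    proof -
      obtain A B where AB: "mutually_inverse (\<beta> x) A B" "det A = (if s = r then 1 + t else 1)"
        and A: "\<And>i j. i < \<beta> x \<Longrightarrow> j < \<beta> x \<Longrightarrow> A $$ (i, j) = of_bool (i = j) + t * of_bool (i = s \<and> j = r)"
        using elementary_matrices[OF rs(2,1) t] by metis
      from AB(1) have "mpoly_eval (\<lambda>u. v u + t * (\<Sum>w\<in>?C. tail_unit Q x r s u w * v w)) P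
          = det A powi \<sigma> x * mpoly_eval v P"
      proof (rule inv)
        fix b i j assume u: "(b, i, j) \<in> ?C"
        then have b: "b \<in> arcs Q" "i < \<beta> (head Q b)" "j < \<beta> (tail Q b)" by (auto simp: coords_def)
        show "v (b, i, j) + t * (\<Sum>w\<in>?C. tail_unit Q x r s (b, i, j) w * v w)
            = (\<Sum>y\<in>?C. act_coeff Q (?g A) (?g B) (b, i, j) y * v y)"
          using b rs nh
          by (auto simp: sum_tail_unit[OF fin u] sum_act_coeff_at[OF fin u nl] A dr dr1 cong: sum.cong_simp)
      qed
      then show ?thesis using AB by auto
    qed
    have "((\<lambda>t :: complex. (if r = s then 1 + t else 1) powi \<sigma> x) has_field_derivative
        (if r = s then of_int (\<sigma> x) else 0)) (at 0)"
      using powi[of "\<sigma> x"] by (cases "r = s") auto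
    from lin_field_eq_cst_mult[OF PC finC ev this] show ?thesis by auto
  qed
  show "lin_field (head_unit Q x r s) ?C P = (if r = s then cst (of_int (- \<sigma> x)) * P else 0)"
    if nt: "\<And>b. b \<in> arcs Q \<Longrightarrow> tail Q b \<noteq> x"
  proof -
    have ev: "mpoly_eval (\<lambda>u. v u + t * (\<Sum>w\<in>?C. head_unit Q x r s u w * v w)) P
        = (if r = s then 1 + t else 1) powi (- \<sigma> x) * mpoly_eval v P" if t: "t \<noteq> -1" for t v
    proof -
      obtain B A where BA: "mutually_inverse (\<beta> x) B A" "det B = (if r = s then 1 + t else 1)" "det A = inverse (det B)"
        and B: "\<And>i j. i < \<beta> x \<Longrightarrow> j < \<beta> x \<Longrightarrow> B $$ (i, j) = of_bool (i = j) + t * of_bool (i = r \<and> j = s)"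
        using elementary_matrices[OF rs t] by metis
      have "mutually_inverse (\<beta> x) A B" using BA by (simp add: mutually_inverse_def)
      then have "mpoly_eval (\<lambda>u. v u + t * (\<Sum>w\<in>?C. head_unit Q x r s u w * v w)) P
          = det A powi \<sigma> x * mpoly_eval v P"
      proof (rule inv)
        fix b i j assume u: "(b, i, j) \<in> ?C"
        then have b: "b \<in> arcs Q" "i < \<beta> (head Q b)" "j < \<beta> (tail Q b)" by (auto simp: coords_def)
        show "v (b, i, j) + t * (\<Sum>w\<in>?C. head_unit Q x r s (b, i, j) w * v w)
            = (\<Sum>y\<in>?C. act_coeff Q (?g A) (?g B) (b, i, j) y * v y)"
          using b rs nt
          by (auto simp: sum_head_unit[OF fin u] sum_act_coeff_at[OF fin u nl] B dl dl1 cong: sum.cong_simp)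
      qed
      then show ?thesis using BA by (simp add: power_int_minus power_int_inverse)
    qed
    have "((\<lambda>t :: complex. (if r = s then 1 + t else 1) powi (- \<sigma> x)) has_field_derivative
        (if r = s then of_int (- \<sigma> x) else 0)) (at 0)"
      using powi[of "- \<sigma> x"] by (cases "r = s") auto
    from lin_field_eq_cst_mult[OF PC finC ev this] show ?thesis by auto
  qed
qed

subsection \<open>The slice at an arrow\<close>

lemma lin_field_cong:
  "(\<And>u w. u \<in> C \<Longrightarrow> w \<in> C \<Longrightarrow> N u w = N' u w) \<Longrightarrow> lin_field N C p = lin_field N' C p"
  by (simp add: lin_field_def cong: sum.cong_simp)

lemma lin_field_add: "lin_field (\<lambda>u w. N u w + N' u w) C p = lin_field N C p + lin_field N' C p"
  by (simp add: lin_field_def cst_add distrib_right sum.distrib)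

lemma lin_field_uminus: "lin_field (\<lambda>u w. - N u w) C p = - lin_field N C p"
  by (simp add: lin_field_def cst_uminus sum_negf)

lemma slice_quiver_simps [simp]:
  "verts (slice_quiver Q a p q) = verts Q"
  "arcs (slice_quiver Q a p q) = Inl ` (arcs Q - {a}) \<union> Inr ` {b \<in> arcs Q - {a}. tail Q b = q \<or> head Q b = q}"
  "tail (slice_quiver Q a p q) (Inl b) = tail Q b" "head (slice_quiver Q a p q) (Inl b) = head Q b"
  "tail (slice_quiver Q a p q) (Inr b) = (if tail Q b = q then p else tail Q b)"
  "head (slice_quiver Q a p q) (Inr b) = (if head Q b = q then p else head Q b)"
  by (simp_all add: slice_quiver_def)

text \<open>The source and the sink case are treated together. They differ by a transposition of the
  matrix at \<open>a\<close> and by the sign of the weight at \<open>p\<close>; only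
  \<open>ends\<close> leaves the orientation open.\<close>

locale slice_data =
  fixes Q :: "('v, 'a) pre_digraph" and \<beta> :: "'v \<Rightarrow> nat" and a :: 'a and p q :: 'v
  assumes Q: "fin_digraph Q"
    and a: "a \<in> arcs Q"
    and ends: "tail Q a = p \<and> head Q a = q \<or> head Q a = p \<and> tail Q a = q"
    and pq: "p \<noteq> q"
    and no_loop: "b \<in> arcs Q \<Longrightarrow> \<not> (tail Q b = q \<and> head Q b = q)"
    and only: "b \<in> arcs Q \<Longrightarrow> b \<noteq> a \<Longrightarrow> tail Q b \<noteq> p \<and> head Q b \<noteq> p"
    and le: "\<beta> p \<le> \<beta> q"
begin

sublocale fin_digraph Q by (rule Q)

abbreviation "Qa \<equiv> slice_quiver Q a p q"
abbreviation "\<beta>a \<equiv> slice_dim \<beta> p q"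

text \<open>The matrix at \<open>a\<close> is transposed if \<open>a\<close> points to
  \<open>p\<close>, so that rows always belong to \<open>q\<close> and columns to
  \<open>p\<close>.\<close>

definition arm :: "nat \<Rightarrow> nat \<Rightarrow> 'a coord" where
  "arm i c = (if head Q a = q then (a, i, c) else (a, c, i))"

definition relabel :: "'a coord \<Rightarrow> ('a + 'a) coord" where
  "relabel = (\<lambda>(b, i, j).
     if tail Q b = q then if j < \<beta> p then (Inr b, i, j) else (Inl b, i, j - \<beta> p)
     else if head Q b = q then if i < \<beta> p then (Inr b, i, j) else (Inl b, i - \<beta> p, j)
     else (Inl b, i, j))"

definition slice_subst :: "'a coord \<Rightarrow> ('a + 'a) coord mpoly" where
  "slice_subst x = (if fst x = a then cst (of_bool (fst (snd x) = snd (snd x))) else var (relabel x))"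

abbreviation "slice_poly \<equiv> mpoly_subst slice_subst"

lemma p_q_verts: "p \<in> verts Q" "q \<in> verts Q"
  using ends a by auto

lemma slice_dims: "\<beta>a p = \<beta> p" "\<beta>a q = \<beta> q - \<beta> p" "x \<noteq> q \<Longrightarrow> \<beta>a x = \<beta> x"
  using pq by (auto simp: slice_dim_def)

lemma fin_digraph_slice: "fin_digraph Qa"
  by unfold_locales (use p_q_verts in \<open>auto split: if_splits\<close>)

lemma relabel_in:
  assumes "x \<in> coords Q \<beta>" "fst x \<noteq> a"
  shows "relabel x \<in> coords Qa \<beta>a"
proof -
  obtain b i j where x: "x = (b, i, j)" by (cases x) auto
  show ?thesis
    using assms only[of b] no_loop[of b] le
    by (auto simp: x relabel_def coords_def slice_dims split: if_splits)
qed

lemma relabel_inj: "inj_on relabel {x \<in> coords Q \<beta>. fst x \<noteq> a}"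
proof (rule inj_onI)
  fix x y assume "x \<in> {x \<in> coords Q \<beta>. fst x \<noteq> a}" "y \<in> {x \<in> coords Q \<beta>. fst x \<noteq> a}" "relabel x = relabel y"
  then show "x = y"
    by (cases x; cases y) (auto simp: relabel_def split: if_splits)
qed

lemma slice_subst_in:
  assumes "P \<in> mpolys_in (coords Q \<beta>)"
  shows "slice_poly P \<in> mpolys_in (coords Qa \<beta>a)"
  by (rule mpoly_subst_in[OF assms]) (auto simp: slice_subst_def relabel_in)

lemma slice_point:
  "rep_plus Q (slice_base Q \<beta> a) (slice_embed Q \<beta> a q (rep_of Qa \<beta>a w)) =
   rep_of Q \<beta> (\<lambda>x. mpoly_eval w (slice_subst x))"
proof (rule ext)
  fix b
  let ?W = "rep_of Qa \<beta>a w"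
  let ?h = "\<beta> (head Q b)" and ?t = "\<beta> (tail Q b)"
  consider "b \<notin> arcs Q" | "b = a" | "b \<in> arcs Q" "b \<noteq> a" by blast
  then show "rep_plus Q (slice_base Q \<beta> a) (slice_embed Q \<beta> a q ?W) b =
      rep_of Q \<beta> (\<lambda>x. mpoly_eval w (slice_subst x)) b"
  proof cases
    case 1
    then show ?thesis by (simp add: rep_plus_def rep_of_def)
  next
    case 2
    then show ?thesis using a
      by (intro eq_matI) (auto simp: rep_plus_def rep_of_def slice_base_def slice_embed_def slice_subst_def)
  next
    case 3
    have b: "tail Q b \<noteq> p" "head Q b \<noteq> p" "\<not> (tail Q b = q \<and> head Q b = q)"
      using only[OF 3] no_loop[OF 3(1)] by auto
    have l: "?W (Inl b) = mat (\<beta>a (head Q b)) (\<beta>a (tail Q b)) (\<lambda>(i, j). w (Inl b, i, j))"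
      using 3 by (simp add: rep_of_def)
    have r: "?W (Inr b) = mat (\<beta>a (if head Q b = q then p else head Q b))
        (\<beta>a (if tail Q b = q then p else tail Q b)) (\<lambda>(i, j). w (Inr b, i, j))"
      if "tail Q b = q \<or> head Q b = q"
      using 3 that by (simp add: rep_of_def)
    have "slice_embed Q \<beta> a q ?W b = mat ?h ?t (\<lambda>(i, j). w (relabel (b, i, j)))"
    proof -
      consider "tail Q b = q" | "head Q b = q" "tail Q b \<noteq> q" | "tail Q b \<noteq> q" "head Q b \<noteq> q" by blast
      then show ?thesis
      proof cases
        case t: 1
        with b(3) have "head Q b \<noteq> q" by simp
        then show ?thesis
          using 3 t le r
          by (intro eq_matI) (auto simp: slice_embed_def l slice_dims relabel_def)
      next
        case h: 2
        then show ?thesis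
          using 3 le r
          by (intro eq_matI) (auto simp: slice_embed_def append_rows_def l slice_dims relabel_def)
      next
        case n: 3
        then show ?thesis
          using 3 by (intro eq_matI) (auto simp: slice_embed_def l slice_dims relabel_def)
      qed
    qed
    then show ?thesis
      using 3 by (intro eq_matI) (auto simp: rep_plus_def slice_base_def rep_of_def slice_subst_def)
  qed
qed

lemma slice_fun_represents:
  assumes "represents Q \<beta> P f"
  shows "represents Qa \<beta>a (slice_poly P) (slice_fun Q \<beta> a p q f)"
  using assms
  by (simp add: represents_def slice_fun_def on_Rep_def slice_point mpoly_eval_subst slice_subst_in)

lemma arm_coords: "(\<lambda>(i, c). arm i c) ` ({..<\<beta> q} \<times> {..<\<beta> p}) = {x \<in> coords Q \<beta>. fst x = a}"
proof (intro equalityI subsetI)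
  fix x assume "x \<in> (\<lambda>(i, c). arm i c) ` ({..<\<beta> q} \<times> {..<\<beta> p})"
  then show "x \<in> {x \<in> coords Q \<beta>. fst x = a}"
    using a ends pq by (auto simp: arm_def coords_def)
next
  fix x assume "x \<in> {x \<in> coords Q \<beta>. fst x = a}"
  then obtain i j where "x = (a, i, j)" "i < \<beta> (head Q a)" "j < \<beta> (tail Q a)"
    by (auto simp: coords_def)
  then show "x \<in> (\<lambda>(i, c). arm i c) ` ({..<\<beta> q} \<times> {..<\<beta> p})"
    using ends pq by (auto simp: arm_def image_iff Bex_def)
qed

text \<open>The row operation at \<open>q\<close> on the arrows other than \<open>a\<close>. Sign
  and index order are such that on \<open>a\<close> itself, in either orientation, the operation is
  a polarization with sign +1; exchanging \<open>r\<close> and \<open>s\<close> gives the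
  adjoint.\<close>

definition rest_field :: "nat \<Rightarrow> nat \<Rightarrow> 'a coord \<Rightarrow> 'a coord \<Rightarrow> complex" where
  "rest_field r s u w = (if fst u = a then 0
     else if head Q a = q then head_unit Q q r s u w - tail_unit Q q s r u w
     else tail_unit Q q r s u w - head_unit Q q s r u w)"

lemma lin_field_head_unit:
  assumes "s < \<beta> x"
  shows "lin_field (head_unit Q x r s) (coords Q \<beta>) P =
    (\<Sum>u\<in>coords Q \<beta>. if head Q (fst u) = x \<and> fst (snd u) = r then var (fst u, s, snd (snd u)) * pderiv_mp u P else 0)"
  unfolding lin_field_def using assms by (intro sum.cong refl sum_head_unit) auto

lemma lin_field_tail_unit:
  assumes "s < \<beta> x"
  shows "lin_field (tail_unit Q x r s) (coords Q \<beta>) P =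
    (\<Sum>u\<in>coords Q \<beta>. if tail Q (fst u) = x \<and> snd (snd u) = r then var (fst u, fst (snd u), s) * pderiv_mp u P else 0)"
  unfolding lin_field_def using assms by (intro sum.cong refl sum_tail_unit) auto

lemma sum_arm_row:
  assumes "r < \<beta> q"
  shows "(\<Sum>u\<in>coords Q \<beta>. if fst u = a \<and> (if head Q a = q then fst (snd u) else snd (snd u)) = r then F u else 0) =
    (\<Sum>c<\<beta> p. F (arm r c))"
proof -
  have "(\<Sum>u\<in>coords Q \<beta>. if fst u = a \<and> (if head Q a = q then fst (snd u) else snd (snd u)) = r then F u else 0) =
    (\<Sum>u\<in>arm r ` {..<\<beta> p}. F u)"
    by (rule sum.mono_neutral_cong_right[OF finite_coords[OF finite_arcs]])
       (use a ends pq assms in \<open>auto simp: arm_def coords_def image_iff split: if_splits\<close>)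
  also have "\<dots> = (\<Sum>c<\<beta> p. F (arm r c))"
    by (subst sum.reindex) (auto simp: arm_def inj_on_def)
  finally show ?thesis .
qed

lemma sum_arm_col:
  assumes "c < \<beta> p"
  shows "(\<Sum>u\<in>coords Q \<beta>. if fst u = a \<and> (if head Q a = q then snd (snd u) else fst (snd u)) = c then F u else 0) =
    (\<Sum>i<\<beta> q. F (arm i c))"
proof -
  have "(\<Sum>u\<in>coords Q \<beta>. if fst u = a \<and> (if head Q a = q then snd (snd u) else fst (snd u)) = c then F u else 0) =
    (\<Sum>u\<in>(\<lambda>i. arm i c) ` {..<\<beta> q}. F u)"
    by (rule sum.mono_neutral_cong_right[OF finite_coords[OF finite_arcs]])
       (use a ends pq assms in \<open>auto simp: arm_def coords_def image_iff split: if_splits\<close>)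
  also have "\<dots> = (\<Sum>i<\<beta> q. F (arm i c))"
    by (subst sum.reindex) (auto simp: arm_def inj_on_def)
  finally show ?thesis .
qed

context
  fixes P f \<sigma>
  assumes P: "represents Q \<beta> P f" and f: "f \<in> semi_invariants Q \<beta> \<sigma>"
begin

lemma arm_rows:
  assumes "r < \<beta> q" "s < \<beta> q" "r \<noteq> s"
  shows "polarize {..<\<beta> p} (arm s) (arm r) P + lin_field (rest_field r s) (coords Q \<beta>) P = 0"
proof -
  let ?C = "coords Q \<beta>"
  define arm_field where "arm_field u w = (if fst u = a then if head Q a = q then head_unit Q q r s u w
      else tail_unit Q q r s u w else 0)" for u w
  have "lin_field (\<lambda>u w. arm_field u w + rest_field r s u w) ?C P = 0"
  proof (cases "head Q a = q")
    case True
    have "lin_field (\<lambda>u w. arm_field u w + rest_field r s u w) ?C P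
        = lin_field (\<lambda>u w. head_unit Q q r s u w - tail_unit Q q s r u w) ?C P"
      using True ends pq
      by (intro lin_field_cong) (auto simp: arm_field_def rest_field_def tail_unit_def)
    also have "\<dots> = 0"
      using semi_invariant_lin_field(1)[OF Q P f p_q_verts(2) assms(1,2) no_loop assms(3)] .
    finally show ?thesis .
  next
    case False
    \<comment> \<open>Now \<open>a\<close> leaves \<open>q\<close>, where the group acts from the
      right and without inverse, hence the sign and the exchange of \<open>r\<close> and
      \<open>s\<close>.\<close>
    have "lin_field (\<lambda>u w. arm_field u w + rest_field r s u w) ?C P
        = lin_field (\<lambda>u w. - (head_unit Q q s r u w - tail_unit Q q r s u w)) ?C P"
      using False ends pq
      by (intro lin_field_cong) (auto simp: arm_field_def rest_field_def head_unit_def)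
    also have "\<dots> = 0"
      using semi_invariant_lin_field(1)[OF Q P f p_q_verts(2) assms(2,1) no_loop assms(3)[symmetric]]
      by (simp only: lin_field_uminus) simp
    finally show ?thesis .
  qed
  moreover have "lin_field arm_field ?C P = polarize {..<\<beta> p} (arm s) (arm r) P"
  proof -
    have "lin_field arm_field ?C P = (\<Sum>u\<in>?C. if fst u = a \<and> (if head Q a = q then fst (snd u) else snd (snd u)) = r
        then var (if head Q a = q then (a, s, snd (snd u)) else (a, fst (snd u), s)) * pderiv_mp u P else 0)"
      unfolding lin_field_def
    proof (rule sum.cong[OF refl])
      fix u assume u: "u \<in> ?C"
      show "(\<Sum>w\<in>?C. cst (arm_field u w) * (var w * pderiv_mp u P)) =
        (if fst u = a \<and> (if head Q a = q then fst (snd u) else snd (snd u)) = r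
        then var (if head Q a = q then (a, s, snd (snd u)) else (a, fst (snd u), s)) * pderiv_mp u P else 0)"
      proof (cases "fst u = a")
        case u_a: True
        show ?thesis
        proof (cases "head Q a = q")
          case True
          with u_a have "arm_field u w = head_unit Q q r s u w" for w by (simp add: arm_field_def)
          then show ?thesis
            using True u_a sum_head_unit(1)[OF finite_arcs u assms(2)] by simp
        next
          case False
          with u_a have "arm_field u w = tail_unit Q q r s u w" for w by (simp add: arm_field_def)
          then show ?thesis
            using False u_a ends sum_tail_unit(1)[OF finite_arcs u assms(2)] by simp
        qed
      qed (simp add: arm_field_def)
    qed
    also have "\<dots> = polarize {..<\<beta> p} (arm s) (arm r) P"
      unfolding polarize_def sum_arm_row[OF assms(1)] by (intro sum.cong refl) (auto simp: arm_def)
    finally show ?thesis .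
  qed
  ultimately show ?thesis by (simp add: lin_field_add)
qed

text \<open>No other arrow meets \<open>p\<close>, so the whole infinitesimal action at
  \<open>p\<close> takes place in the columns of the matrix at \<open>a\<close>. The orientation
  decides the sign of the degree.\<close>

lemma arm_cols:
  assumes "c < \<beta> p" "e < \<beta> p"
  shows "polarize {..<\<beta> q} (\<lambda>i. arm i c) (\<lambda>i. arm i e) P =
    (if c = e then cst (of_int (if head Q a = q then \<sigma> p else - \<sigma> p)) * P else 0)"
proof -
  let ?C = "coords Q \<beta>"
  have pol: "polarize {..<\<beta> q} (\<lambda>i. arm i c) (\<lambda>i. arm i e) P =
    (\<Sum>u\<in>?C. if fst u = a \<and> (if head Q a = q then snd (snd u) else fst (snd u)) = e
      then var (if head Q a = q then (a, fst (snd u), c) else (a, c, snd (snd u))) * pderiv_mp u P else 0)"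
    unfolding polarize_def sum_arm_col[OF assms(2)] by (intro sum.cong refl) (auto simp: arm_def)
  have nl: "\<not> (tail Q b = p \<and> head Q b = p)" if "b \<in> arcs Q" for b
    using only[OF that] ends pq by (cases "b = a") auto
  show ?thesis
  proof (cases "head Q a = q")
    case True
    have nh: "head Q b \<noteq> p" if "b \<in> arcs Q" for b
      using only[OF that] pq True by (cases "b = a") auto
    have iff: "tail Q b = p \<longleftrightarrow> b = a" if "b \<in> arcs Q" for b
      using only[OF that] ends pq True by auto
    have "polarize {..<\<beta> q} (\<lambda>i. arm i c) (\<lambda>i. arm i e) P = lin_field (tail_unit Q p e c) ?C P"
      unfolding pol lin_field_tail_unit[OF assms(1)]
    proof (rule sum.cong[OF refl])
      fix u assume "u \<in> ?C"
      then have "fst u \<in> arcs Q" by (auto simp: coords_def)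
      from iff[OF this] show "(if fst u = a \<and> (if head Q a = q then snd (snd u) else fst (snd u)) = e
          then var (if head Q a = q then (a, fst (snd u), c) else (a, c, snd (snd u))) * pderiv_mp u P else 0) =
        (if tail Q (fst u) = p \<and> snd (snd u) = e
          then var (fst u, fst (snd u), c) * pderiv_mp u P else 0)"
        using True by auto
    qed
    also have "\<dots> = (if e = c then cst (of_int (\<sigma> p)) * P else 0)"
      by (rule semi_invariant_lin_field(2)[OF Q P f p_q_verts(1) assms(2,1) nl nh])
    finally show ?thesis using True by auto
  next
    case False
    then have ha: "head Q a = p" using ends by auto
    have nt: "tail Q b \<noteq> p" if "b \<in> arcs Q" for b
      using only[OF that] pq ends False by (cases "b = a") auto
    have iff: "head Q b = p \<longleftrightarrow> b = a" if "b \<in> arcs Q" for b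
      using only[OF that] ha by auto
    have "polarize {..<\<beta> q} (\<lambda>i. arm i c) (\<lambda>i. arm i e) P = lin_field (head_unit Q p e c) ?C P"
      unfolding pol lin_field_head_unit[OF assms(1)]
    proof (rule sum.cong[OF refl])
      fix u assume "u \<in> ?C"
      then have "fst u \<in> arcs Q" by (auto simp: coords_def)
      from iff[OF this] show "(if fst u = a \<and> (if head Q a = q then snd (snd u) else fst (snd u)) = e
          then var (if head Q a = q then (a, fst (snd u), c) else (a, c, snd (snd u))) * pderiv_mp u P else 0) =
        (if head Q (fst u) = p \<and> fst (snd u) = e
          then var (fst u, c, snd (snd u)) * pderiv_mp u P else 0)"
        using False by auto
    qed
    also have "\<dots> = (if e = c then cst (of_int (- \<sigma> p)) * P else 0)"
      by (rule semi_invariant_lin_field(3)[OF Q P f p_q_verts(1) assms(2,1) nl nt])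
    finally show ?thesis using False by auto
  qed
qed

lemma fischer_norm_slice_subst:
  "fischer_norm P = fischer_norm (slice_poly P) *
     (\<Prod>i<\<beta> p. pochhammer (of_nat (\<beta> q - i)) (nat \<bar>\<sigma> p\<bar>))"
proof -
  let ?C = "coords Q \<beta>" and ?d = "nat \<bar>\<sigma> p\<bar>" and ?k = "if head Q a = q then \<sigma> p else - \<sigma> p"
  have fin: "finite ?C" by (simp add: finite_coords)
  have PC: "P \<in> mpolys_in ?C" using P by (simp add: represents_def)
  have arm_inj: "arm i c = arm j e \<longleftrightarrow> i = j \<and> c = e" for i c j e
    by (auto simp: arm_def)
  show ?thesis
  \<comment> \<open>If there is a column and its degree would be negative, then \<open>P\<close> is
    zero and both sides vanish. Otherwise either the degree is the absolute value of
    \<open>\<sigma> p\<close>, or there is no column and the product is empty.\<close>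
  proof (cases "\<beta> p = 0 \<or> ?k \<ge> 0")
    case False
    have "euler_op ((\<lambda>i. arm i 0) ` {..<\<beta> q}) P = polarize {..<\<beta> q} (\<lambda>i. arm i 0) (\<lambda>i. arm i 0) P"
      by (simp add: polarize_def sum.reindex inj_on_def arm_inj)
    also have "\<dots> = cst (of_int ?k) * P"
      using False by (subst arm_cols) auto
    finally have "P = 0"
      by (rule euler_op_neg_eigen) (use False in auto)
    then show ?thesis by simp
  next
    case True
    interpret column_slice "\<beta> q" "\<beta> p" ?d arm "\<lambda>r s. lin_field (rest_field r s) ?C" P
    proof
      show "fischer (lin_field (rest_field i j) ?C p) q = fischer p (lin_field (rest_field j i) ?C q)" for i j p q
      proof -
        have "cnj (rest_field i j w u) = rest_field j i u w" for u w
        proof (cases "fst u = fst w")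
          case True
          then show ?thesis by (simp add: rest_field_def unit_adjoint)
        next
          case False
          have "head_unit Q y k l u w = 0" "tail_unit Q y k l u w = 0"
            "head_unit Q y k l w u = 0" "tail_unit Q y k l w u = 0" for y k l
            using False by (auto simp: head_unit_def tail_unit_def)
          then show ?thesis by (simp add: rest_field_def)
        qed
        then show ?thesis by (simp add: fischer_lin_field)
      qed
      show "pderiv_mp (arm k c) (lin_field (rest_field i j) ?C p) = lin_field (rest_field i j) ?C (pderiv_mp (arm k c) p)"
        for k c i j p
        by (rule pderiv_lin_field) (auto simp: rest_field_def arm_def head_unit_def tail_unit_def)
      show "polarize {..<\<beta> q} (\<lambda>i. arm i c) (\<lambda>i. arm i e) P = (if c = e then cst (of_nat ?d) * P else 0)"
        if "c < \<beta> p" "e < \<beta> p" for c e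
      proof -
        have "(of_int ?k :: complex) = of_nat ?d"
          using True that by (auto split: if_splits)
        then show ?thesis using arm_cols[OF that] by simp
      qed
    qed (use le arm_inj arm_rows in auto)
    show ?thesis
    proof (rule fischer_norm_slice[OF PC fin refl])
      have eq: "?C - (\<lambda>(i, c). arm i c) ` ({..<\<beta> q} \<times> {..<\<beta> p}) = {x \<in> ?C. fst x \<noteq> a}"
        unfolding arm_coords by auto
      show "inj_on relabel (?C - (\<lambda>(i, c). arm i c) ` ({..<\<beta> q} \<times> {..<\<beta> p}))"
        unfolding eq by (rule relabel_inj)
      show "slice_subst x = var (relabel x)"
        if "x \<in> ?C - (\<lambda>(i, c). arm i c) ` ({..<\<beta> q} \<times> {..<\<beta> p})" for x
        using that unfolding eq by (simp add: slice_subst_def)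
      show "slice_subst (arm i c) = of_bool (i = c)" for i c
        by (auto simp: slice_subst_def arm_def)
    qed
  qed
qed

end

end

section \<open>Block-diagonal matrices and the lift of the slice group\<close>

lemma sum_lessThan_add: "(\<Sum>l<n + m. F l) = (\<Sum>l<n. F l) + (\<Sum>l<m. F (n + l))"
  for F :: "nat \<Rightarrow> 'r :: comm_monoid_add"
  by (induction m) (simp_all add: add.assoc)

definition block_diag :: "nat \<Rightarrow> nat \<Rightarrow> complex mat \<Rightarrow> complex mat \<Rightarrow> complex mat" where
  "block_diag n m A B = four_block_mat A (0\<^sub>m n m) (0\<^sub>m m n) B"

lemma block_diag_sums:
  assumes "A \<in> carrier_mat n n" "B \<in> carrier_mat m m"
  shows "j < n + m \<Longrightarrow> (\<Sum>l<n + m. F l * block_diag n m A B $$ (l, j)) =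
      (if j < n then \<Sum>l<n. F l * A $$ (l, j) else \<Sum>l<m. F (n + l) * B $$ (l, j - n))"
    and "i < n + m \<Longrightarrow> (\<Sum>l<n + m. block_diag n m A B $$ (i, l) * F l) =
      (if i < n then \<Sum>l<n. A $$ (i, l) * F l else \<Sum>l<m. B $$ (i - n, l) * F (n + l))"
  using assms by (auto simp: sum_lessThan_add block_diag_def cong: sum.cong_simp)

lemma mutually_inverse_block_diag:
  assumes "mutually_inverse n A A'" "mutually_inverse m B B'"
  shows "mutually_inverse (n + m) (block_diag n m A B) (block_diag n m A' B')"
proof -
  have *: "block_diag n m A B * block_diag n m A' B' = 1\<^sub>m (n + m)"
    if "mutually_inverse n A A'" "mutually_inverse m B B'" for A A' B B'
    using that unfolding mutually_inverse_def block_diag_def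
    by (subst mult_four_block_mat[of _ n n _ m _ m]) auto
  have "mutually_inverse n A' A" "mutually_inverse m B' B"
    using assms by (auto simp: mutually_inverse_def)
  from *[OF assms] *[OF this] show ?thesis
    using assms by (auto simp: mutually_inverse_def block_diag_def)
qed

lemma det_block_diag:
  assumes "A \<in> carrier_mat n n" "B \<in> carrier_mat m m"
  shows "det (block_diag n m A B) = det A * det B"
  unfolding block_diag_def
  by (rule det_four_block_mat_lower_left_zero[of _ n _ m]) (use assms in auto)

lemma mutually_inverse_sum:
  assumes "mutually_inverse n A B" "i < n" "j < n"
  shows "(\<Sum>l<n. B $$ (i, l) * A $$ (l, j)) = of_bool (i = j)"
proof -
  have "(\<Sum>l<n. B $$ (i, l) * A $$ (l, j)) = (B * A) $$ (i, j)"
    using assms(2,3) conjunct1[OF assms(1)[unfolded mutually_inverse_def]]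
      conjunct1[OF conjunct2[OF assms(1)[unfolded mutually_inverse_def]]]
    by (auto simp: scalar_prod_def atLeast0LessThan)
  then show ?thesis using assms by (simp add: mutually_inverse_def)
qed

context slice_data
begin

text \<open>Embeds the slice group into the stabilizer of the base matrix: the block
  \<open>g p\<close> at \<open>q\<close> cancels against \<open>g p\<close> at
  \<open>p\<close>.\<close>

definition lift_gl :: "('v \<Rightarrow> complex mat) \<Rightarrow> 'v \<Rightarrow> complex mat" where
  "lift_gl g = g(q := block_diag (\<beta> p) (\<beta> q - \<beta> p) (g p) (g q))"

lemma lift_gl_pair:
  assumes "gl_pair Qa \<beta>a g h"
  shows "gl_pair Q \<beta> (lift_gl g) (lift_gl h)"
  unfolding gl_pair_def
proof
  fix x assume x: "x \<in> verts Q"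
  have *: "mutually_inverse (\<beta>a y) (g y) (h y)" if "y \<in> verts Q" for y
    using assms that by (simp add: gl_pair_def)
  show "mutually_inverse (\<beta> x) (lift_gl g x) (lift_gl h x)"
  proof (cases "x = q")
    case True
    then show ?thesis
      using mutually_inverse_block_diag[OF *[OF p_q_verts(1)] *[OF p_q_verts(2)]] le
      by (simp add: lift_gl_def slice_dims)
  qed (use *[OF x] in \<open>simp add: lift_gl_def slice_dims\<close>)
qed

text \<open>The determinant at \<open>q\<close> is a product of those of \<open>g p\<close> and
  \<open>g q\<close>, which adds the exponent \<open>\<sigma> q\<close> at \<open>p\<close>. This is
  the origin of the weight of the slice.\<close>

lemma weight_char_lift_gl:
  assumes "gl_pair Qa \<beta>a g h"
  shows "weight_char Q \<sigma> (lift_gl g) = weight_char Qa (\<sigma>(p := \<sigma> p + \<sigma> q)) g"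
proof -
  have *: "mutually_inverse (\<beta>a y) (g y) (h y)" if "y \<in> verts Q" for y
    using assms that by (simp add: gl_pair_def)
  note gp = *[OF p_q_verts(1)] and gq = *[OF p_q_verts(2)]
  have d: "det (lift_gl g q) = det (g p) * det (g q)"
    using gp gq by (simp add: lift_gl_def slice_dims mutually_inverse_def det_block_diag)
  have "det (g p) * det (h p) = 1"
    using gp unfolding mutually_inverse_def by (metis det_mult det_one)
  then have nz: "det (g p) \<noteq> 0" by auto
  have split: "(\<Prod>x\<in>verts Q. F x) = F p * (F q * (\<Prod>x\<in>verts Q - {p} - {q}. F x))" for F :: "'v \<Rightarrow> complex"
    using p_q_verts pq by (subst prod.remove[of _ p], simp_all) (subst prod.remove[of _ q], simp_all)
  have "(\<Prod>x\<in>verts Q - {p} - {q}. det (lift_gl g x) powi \<sigma> x) =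
      (\<Prod>x\<in>verts Q - {p} - {q}. det (g x) powi (\<sigma>(p := \<sigma> p + \<sigma> q)) x)"
    by (intro prod.cong refl) (auto simp: lift_gl_def)
  moreover have "det (lift_gl g p) = det (g p)" using pq by (simp add: lift_gl_def)
  ultimately show ?thesis
    using pq nz by (simp add: weight_char_def split d power_int_add power_int_mult_distrib)
qed

lemma slice_subst_equivariant:
  assumes gh: "gl_pair Qa \<beta>a g h" and x: "x \<in> coords Q \<beta>"
  shows "mpoly_eval (\<lambda>z. \<Sum>y\<in>coords Qa \<beta>a. act_coeff Qa g h z y * w y) (slice_subst x) =
    (\<Sum>y\<in>coords Q \<beta>. act_coeff Q (lift_gl g) (lift_gl h) x y * mpoly_eval w (slice_subst y))"
proof -
  interpret S: fin_digraph Qa by (rule fin_digraph_slice)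
  obtain b i j where x': "x = (b, i, j)" by (cases x) auto
  have b: "b \<in> arcs Q" "i < \<beta> (head Q b)" "j < \<beta> (tail Q b)"
    using x by (auto simp: x' coords_def)
  have inv: "mutually_inverse (\<beta>a y) (g y) (h y)" if "y \<in> verts Q" for y
    using gh that by (simp add: gl_pair_def)
  have gp: "mutually_inverse (\<beta> p) (g p) (h p)" and gq: "mutually_inverse (\<beta> q - \<beta> p) (g q) (h q)"
    using inv[OF p_q_verts(1)] inv[OF p_q_verts(2)] by (simp_all add: slice_dims)
  have car: "g p \<in> carrier_mat (\<beta> p) (\<beta> p)" "h p \<in> carrier_mat (\<beta> p) (\<beta> p)"
    "g q \<in> carrier_mat (\<beta> q - \<beta> p) (\<beta> q - \<beta> p)" "h q \<in> carrier_mat (\<beta> q - \<beta> p) (\<beta> q - \<beta> p)"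
    using gp gq by (auto simp: mutually_inverse_def)
  have N: "\<beta> q = \<beta> p + (\<beta> q - \<beta> p)" using le by simp
  have right: "(\<Sum>l<\<beta> q. F l * lift_gl g q $$ (l, j)) =
      (if j < \<beta> p then \<Sum>l<\<beta> p. F l * g p $$ (l, j)
       else \<Sum>l<\<beta> q - \<beta> p. F (\<beta> p + l) * g q $$ (l, j - \<beta> p))" if "j < \<beta> q" for F j
    using block_diag_sums(1)[OF car(1,3), of j F] that le by (simp add: lift_gl_def)
  have left: "(\<Sum>l<\<beta> q. lift_gl h q $$ (i, l) * F l) =
      (if i < \<beta> p then \<Sum>l<\<beta> p. h p $$ (i, l) * F l
       else \<Sum>l<\<beta> q - \<beta> p. h q $$ (i - \<beta> p, l) * F (\<beta> p + l))" if "i < \<beta> q" for F i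
    using block_diag_sums(2)[OF car(2,4), of i F] that le by (simp add: lift_gl_def)
  have lift: "lift_gl k y = k y" if "y \<noteq> q" for k y using that by (simp add: lift_gl_def)
  note sums = sum_act_coeff[OF finite_arcs b(1)] sum_act_coeff[OF S.finite_arcs]
  show ?thesis
  proof (cases "b = a")
    case True
    have delta: "(\<Sum>k<n. F k * of_bool (k = l)) = F l" "(\<Sum>k<n. of_bool (l = k) * F k) = F l"
      if "l < n" for F :: "nat \<Rightarrow> complex" and l n
      using that by (simp_all add: of_bool_def if_distrib[of "\<lambda>z. _ * z"] if_distrib[of "\<lambda>z. z * _"]
          sum.delta sum.delta' cong: if_cong)
    \<comment> \<open>On \<open>a\<close> the lifted element fixes the base matrix: only the block
      \<open>g p\<close> at \<open>q\<close> meets the identity, and it cancels with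
      \<open>g p\<close> at \<open>p\<close>.\<close>
    have "(\<Sum>l<\<beta> (tail Q a). \<Sum>k<\<beta> (head Q a). lift_gl h (head Q a) $$ (i, k) * of_bool (k = l) * lift_gl g (tail Q a) $$ (l, j))
        = of_bool (i = j)"
    proof (cases "head Q a = q")
      case hq: True
      then have t: "tail Q a = p" using ends by auto
      have "(\<Sum>l<\<beta> p. \<Sum>k<\<beta> q. lift_gl h q $$ (i, k) * of_bool (k = l) * g p $$ (l, j))
          = (\<Sum>l<\<beta> p. lift_gl h q $$ (i, l) * g p $$ (l, j))"
        using le by (intro sum.cong refl) (simp add: delta sum_distrib_right[symmetric])
      also have "\<dots> = (if i < \<beta> p then \<Sum>l<\<beta> p. h p $$ (i, l) * g p $$ (l, j) else 0)"
        using b(2) True hq car le by (auto simp: lift_gl_def block_diag_def intro!: sum.neutral sum.cong)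
      also have "\<dots> = of_bool (i = j)"
        using b True hq t by (auto simp: mutually_inverse_sum[OF gp])
      finally show ?thesis using hq t pq by (simp add: lift)
    next
      case False
      then have ht: "head Q a = p" "tail Q a = q" using ends by auto
      have "(\<Sum>l<\<beta> q. \<Sum>k<\<beta> p. h p $$ (i, k) * of_bool (k = l) * lift_gl g q $$ (l, j))
          = (\<Sum>k<\<beta> p. \<Sum>l<\<beta> q. h p $$ (i, k) * (of_bool (k = l) * lift_gl g q $$ (l, j)))"
        by (subst sum.swap) (simp add: mult.assoc)
      also have "\<dots> = (\<Sum>k<\<beta> p. h p $$ (i, k) * lift_gl g q $$ (k, j))"
        using le by (intro sum.cong refl) (simp add: delta sum_distrib_left[symmetric])
      also have "\<dots> = (if j < \<beta> p then \<Sum>k<\<beta> p. h p $$ (i, k) * g p $$ (k, j) else 0)"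
        using b(3) True ht car le by (auto simp: lift_gl_def block_diag_def intro!: sum.neutral sum.cong)
      also have "\<dots> = of_bool (i = j)"
        using b True ht by (auto simp: mutually_inverse_sum[OF gp])
      finally show ?thesis using ht pq by (simp add: lift)
    qed
    then show ?thesis
      unfolding x' sums(1) using True by (simp add: slice_subst_def)
  next
    case False
    note only = only[OF b(1) False]
    have arcsQa: "Inl b \<in> arcs Qa" "tail Q b = q \<or> head Q b = q \<Longrightarrow> Inr b \<in> arcs Qa"
      using False b(1) by auto
    note sums = sums(1) sums(2)[OF arcsQa(1)] sums(2)[OF arcsQa(2)]
    \<comment> \<open>A block-diagonal matrix at \<open>q\<close> keeps the first
      \<open>\<beta> p\<close> coordinates apart from the others, just as an arrow at
      \<open>q\<close> splits into its \<open>Inr\<close> and \<open>Inl\<close> copies.\<close>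
    consider "tail Q b = q" "head Q b \<noteq> q" | "head Q b = q" "tail Q b \<noteq> q" | "tail Q b \<noteq> q" "head Q b \<noteq> q"
      using no_loop[OF b(1)] by blast
    then show ?thesis
    proof cases
      case 1
      have "(\<Sum>y\<in>coords Q \<beta>. act_coeff Q (lift_gl g) (lift_gl h) x y * mpoly_eval w (slice_subst y)) =
        (\<Sum>l<\<beta> q. (\<Sum>k<\<beta> (head Q b). h (head Q b) $$ (i, k) * w (relabel (b, k, l))) * lift_gl g q $$ (l, j))"
        using 1 False by (simp add: x' sums(1) lift slice_subst_def sum_distrib_right)
      also have "\<dots> = (if j < \<beta> p
          then \<Sum>l<\<beta> p. (\<Sum>k<\<beta> (head Q b). h (head Q b) $$ (i, k) * w (Inr b, k, l)) * g p $$ (l, j)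
          else \<Sum>l<\<beta> q - \<beta> p. (\<Sum>k<\<beta> (head Q b). h (head Q b) $$ (i, k) * w (Inl b, k, l)) * g q $$ (l, j - \<beta> p))"
        using b(3) 1 by (simp add: right relabel_def cong: sum.cong_simp)
      also have "\<dots> = mpoly_eval (\<lambda>z. \<Sum>y\<in>coords Qa \<beta>a. act_coeff Qa g h z y * w y) (slice_subst x)"
        using 1 False by (simp add: x' slice_subst_def relabel_def sums slice_dims sum_distrib_right)
      finally show ?thesis ..
    next
      case 2
      have "(\<Sum>y\<in>coords Q \<beta>. act_coeff Q (lift_gl g) (lift_gl h) x y * mpoly_eval w (slice_subst y)) =
        (\<Sum>l<\<beta> (tail Q b). (\<Sum>k<\<beta> q. lift_gl h q $$ (i, k) * w (relabel (b, k, l))) * g (tail Q b) $$ (l, j))"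
        using 2 False by (simp add: x' sums(1) lift slice_subst_def sum_distrib_right)
      also have "\<dots> = (if i < \<beta> p
          then \<Sum>l<\<beta> (tail Q b). (\<Sum>k<\<beta> p. h p $$ (i, k) * w (Inr b, k, l)) * g (tail Q b) $$ (l, j)
          else \<Sum>l<\<beta> (tail Q b). (\<Sum>k<\<beta> q - \<beta> p. h q $$ (i - \<beta> p, k) * w (Inl b, k, l)) * g (tail Q b) $$ (l, j))"
        using b(2) 2 by (simp add: left relabel_def cong: sum.cong_simp)
      also have "\<dots> = mpoly_eval (\<lambda>z. \<Sum>y\<in>coords Qa \<beta>a. act_coeff Qa g h z y * w y) (slice_subst x)"
        using 2 False by (simp add: x' slice_subst_def relabel_def sums slice_dims sum_distrib_right)
      finally show ?thesis ..
    next
      case 3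
      then show ?thesis
        using False by (simp add: x' slice_subst_def relabel_def sums slice_dims lift)
    qed
  qed
qed

lemma slice_semi_invariant:
  assumes P: "represents Q \<beta> P f" and f: "f \<in> semi_invariants Q \<beta> \<sigma>"
  shows "slice_fun Q \<beta> a p q f \<in> semi_invariants Qa \<beta>a (\<sigma>(p := \<sigma> p + \<sigma> q))"
proof (subst semi_invariants_iff[OF fin_digraph_slice slice_fun_represents[OF P]])
  have PC: "P \<in> mpolys_in (coords Q \<beta>)" using P by (simp add: represents_def)
  show "\<forall>g h. gl_pair Qa \<beta>a g h \<longrightarrow>
      lin_subst (act_coeff Qa g h) (coords Qa \<beta>a) (slice_poly P) =
      cst (weight_char Qa (\<sigma>(p := \<sigma> p + \<sigma> q)) g) * slice_poly P"
  proof (intro allI impI mpoly_eqI)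
    fix g h w assume gh: "gl_pair Qa \<beta>a g h"
    have "lin_subst (act_coeff Q (lift_gl g) (lift_gl h)) (coords Q \<beta>) P = cst (weight_char Q \<sigma> (lift_gl g)) * P"
      by (rule semi_invariant_lin_subst[OF Q P f lift_gl_pair[OF gh]])
    from arg_cong[OF this, of "mpoly_eval (\<lambda>x. mpoly_eval w (slice_subst x))"]
    have "mpoly_eval (\<lambda>x. \<Sum>y\<in>coords Q \<beta>. act_coeff Q (lift_gl g) (lift_gl h) x y * mpoly_eval w (slice_subst y)) P
        = weight_char Qa (\<sigma>(p := \<sigma> p + \<sigma> q)) g * mpoly_eval w (slice_poly P)"
      by (simp add: mpoly_eval_lin_subst mpoly_hom_simps mpoly_eval_subst weight_char_lift_gl[OF gh])
    also have "mpoly_eval (\<lambda>x. \<Sum>y\<in>coords Q \<beta>. act_coeff Q (lift_gl g) (lift_gl h) x y * mpoly_eval w (slice_subst y)) P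
        = mpoly_eval (\<lambda>x. mpoly_eval (\<lambda>z. \<Sum>y\<in>coords Qa \<beta>a. act_coeff Qa g h z y * w y) (slice_subst x)) P"
      by (rule mpoly_hom_cong[OF PC]) (rule slice_subst_equivariant[OF gh, symmetric])
    finally show "mpoly_eval w (lin_subst (act_coeff Qa g h) (coords Qa \<beta>a) (slice_poly P)) =
        mpoly_eval w (cst (weight_char Qa (\<sigma>(p := \<sigma> p + \<sigma> q)) g) * slice_poly P)"
      by (simp add: mpoly_eval_lin_subst mpoly_hom_simps mpoly_eval_subst fun_upd_def)
  qed
qed (simp add: slice_fun_def on_Rep_def)

end

subsection \<open>Weights of acyclic quivers\<close>

lemma euler_weight_eq:
  assumes "fin_digraph Q"
  shows "euler_weight Q \<alpha> x =
    (if x \<in> verts Q then \<alpha> x else 0) - (\<Sum>b\<in>{b \<in> arcs Q. head Q b = x}. \<alpha> (tail Q b))"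
proof -
  interpret fin_digraph Q by fact
  have "(\<Sum>y\<in>verts Q. \<alpha> y * of_bool (y = x)) = (if x \<in> verts Q then \<alpha> x else 0)"
    by (simp add: of_bool_def if_distrib[of "\<lambda>z. _ * z"] sum.delta del: sum_mult_of_bool_eq cong: if_cong)
  moreover have "(\<Sum>b\<in>arcs Q. \<alpha> (tail Q b) * of_bool (head Q b = x)) =
      (\<Sum>b\<in>{b \<in> arcs Q. head Q b = x}. \<alpha> (tail Q b))"
    by (rule sum.mono_neutral_cong_right) auto
  ultimately show ?thesis by (simp add: euler_weight_def euler_form_def)
qed

text \<open>The equation expresses the value at a vertex through values at vertices of smaller
  level, so it is solved level by level. An Euler weight is zero off the vertices, and
  \<open>\<tau>\<close> has to be zero there as well.\<close>

lemma euler_weight_surj: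
  assumes Q: "fin_digraph Q" and level: "\<And>b. b \<in> arcs Q \<Longrightarrow> level (tail Q b) < (level (head Q b) :: nat)"
    and \<tau>: "\<And>x. x \<notin> verts Q \<Longrightarrow> \<tau> x = 0"
  shows "\<exists>\<alpha>. \<tau> = euler_weight Q \<alpha>"
proof -
  interpret fin_digraph Q by (rule Q)
  have ex: "\<exists>\<alpha>. \<forall>x\<in>verts Q. level x < n \<longrightarrow>
      \<alpha> x = \<tau> x + (\<Sum>b\<in>{b \<in> arcs Q. head Q b = x}. \<alpha> (tail Q b))" for n
  proof (induction n)
    case (Suc n)
    then obtain \<alpha> where \<alpha>: "\<And>x. x \<in> verts Q \<Longrightarrow> level x < n \<Longrightarrow>
        \<alpha> x = \<tau> x + (\<Sum>b\<in>{b \<in> arcs Q. head Q b = x}. \<alpha> (tail Q b))" by blast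
    let ?\<alpha> = "\<lambda>x. if level x < n then \<alpha> x else \<tau> x + (\<Sum>b\<in>{b \<in> arcs Q. head Q b = x}. \<alpha> (tail Q b))"
    have "(\<Sum>b\<in>{b \<in> arcs Q. head Q b = x}. ?\<alpha> (tail Q b)) = (\<Sum>b\<in>{b \<in> arcs Q. head Q b = x}. \<alpha> (tail Q b))"
      if "level x < Suc n" for x
      using that level by (intro sum.cong refl) fastforce
    then show ?case using \<alpha> by (intro exI[of _ ?\<alpha>]) auto
  qed simp
  have "finite (level ` verts Q)" by simp
  then obtain n where n: "\<And>x. x \<in> verts Q \<Longrightarrow> level x < n"
    by (metis finite_nat_iff_bounded imageI lessThan_iff subsetD)
  with ex[of n] obtain \<alpha> where \<alpha>: "\<And>x. x \<in> verts Q \<Longrightarrow>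
      \<alpha> x = \<tau> x + (\<Sum>b\<in>{b \<in> arcs Q. head Q b = x}. \<alpha> (tail Q b))" by blast
  have "\<tau> x = euler_weight Q \<alpha> x" for x
  proof (cases "x \<in> verts Q")
    case False
    then have "(\<Sum>b\<in>{b \<in> arcs Q. head Q b = x}. \<alpha> (tail Q b)) = 0"
      by (intro sum.neutral) auto
    with False \<tau> show ?thesis by (simp add: euler_weight_eq[OF Q])
  qed (simp add: euler_weight_eq[OF Q] \<alpha>)
  then show ?thesis by blast
qed

text \<open>The level of a vertex counts the vertices from which a nonempty path leads to it. Along
  an arrow this set grows strictly, because its tail is not among its own predecessors.\<close>

lemma acyclic_level:
  assumes "fin_digraph Q" "no_oriented_cycles Q"
  obtains level :: "'v \<Rightarrow> nat" where "\<And>b. b \<in> arcs Q \<Longrightarrow> level (tail Q b) < level (head Q b)"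
proof -
  interpret fin_digraph Q by fact
  let ?R = "(arcs_ends Q)\<^sup>+"
  have irr: "(x, x) \<notin> ?R" for x
  proof
    assume "(x, x) \<in> ?R"
    then obtain w where "awalk x w x" "w \<noteq> []" by (auto simp: reachable1_awalk)
    then have "closed_w w" by (auto simp: closed_w_def)
    then show False
      using closed_w_imp_cycle assms(2) by (auto simp: no_oriented_cycles_def)
  qed
  show ?thesis
  proof (rule that[of "\<lambda>x. card {y. (y, x) \<in> ?R}"])
    fix b assume b: "b \<in> arcs Q"
    then have e: "(tail Q b, head Q b) \<in> ?R" by (auto simp: arcs_ends_conv)
    show "card {y. (y, tail Q b) \<in> ?R} < card {y. (y, head Q b) \<in> ?R}"
    proof (rule psubset_card_mono)
      show "finite {y. (y, head Q b) \<in> ?R}"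
        by (rule finite_subset[of _ "verts Q"]) (auto dest: reachable1_in_verts)
      show "{y. (y, tail Q b) \<in> ?R} \<subset> {y. (y, head Q b) \<in> ?R}"
        using e irr[of "tail Q b"] by (auto intro: trancl_trans)
    qed
  qed
qed

subsection \<open>The slice formula\<close>

text \<open>A rising factorial of length (k + 1) d is one of length k d times d further factors,
  which are the linear factors of \<open>bracket_poly\<close> at \<open>k\<close>. The factor
  \<open>i\<close> of the bracket corresponds to \<open>n - i\<close> on the other side.\<close>

lemma poly_bracket_poly:
  assumes "m \<le> n"
  shows "poly (bracket_poly d (n - m) n) (of_nat k) * of_real (\<Prod>i<m. pochhammer (of_nat (n - i)) (k * d)) =
    of_real (\<Prod>i<m. pochhammer (of_nat (n - i)) (Suc k * d))"
proof -
  have "poly (bracket_poly d (n - m) n) (of_nat k) =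
      (\<Prod>i\<in>{n - m + 1..n}. \<Prod>j<d. of_nat (i + j) + of_nat k * of_nat d)"
    by (simp add: bracket_poly_def poly_prod)
  also have "\<dots> = (\<Prod>i<m. \<Prod>j<d. of_nat (n - i + j) + of_nat k * of_nat d)"
    by (rule prod.reindex_bij_witness[of _ "\<lambda>i. n - i" "\<lambda>i. n - i"]) (use assms in auto)
  also have "\<dots> = (\<Prod>i<m. pochhammer (of_nat (n - i) + of_nat (k * d)) d)"
    by (simp add: pochhammer_prod atLeast0LessThan add_ac)
  finally have 1: "poly (bracket_poly d (n - m) n) (of_nat k) =
      (\<Prod>i<m. pochhammer (of_nat (n - i) + of_nat (k * d)) d :: complex)" .
  have 2: "complex_of_real (pochhammer (of_nat l) e) = pochhammer (of_nat l) e" for l e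
    by (simp add: pochhammer_of_real[symmetric])
  have 3: "pochhammer (of_nat l :: complex) (Suc k * d) =
      pochhammer (of_nat l) (k * d) * pochhammer (of_nat l + of_nat (k * d)) d" for l
    using pochhammer_product'[of "of_nat l :: complex" "k * d" d] by (simp add: add.commute)
  show ?thesis
    unfolding of_real_prod 2 3 prod.distrib 1 by (rule mult.commute)
qed

context slice_data
begin

text \<open>The norm formula is applied to \<open>P ^ k\<close>, whose weight at \<open>p\<close> is
  k times that of \<open>P\<close> and whose slice is the \<open>k\<close>-th power of the
  slice.\<close>

lemma norm_ratio_slice:
  assumes P: "represents Q \<beta> P f" and f: "f \<in> semi_invariants Q \<beta> \<sigma>" and nz: "P \<noteq> 0"
  shows "of_real (norm_ratio P k) = of_real (norm_ratio (slice_poly P) k) *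
    poly (bracket_poly (nat \<bar>\<sigma> p\<bar>) (\<beta> q - \<beta> p) (\<beta> q)) (of_nat k)"
proof -
  let ?d = "nat \<bar>\<sigma> p\<bar>" and ?Pa = "slice_poly P"
  define N where "N k = (\<Prod>i<\<beta> p. pochhammer (real (\<beta> q - i)) (k * ?d))" for k
  have pos: "N k > 0" for k
    unfolding N_def by (intro prod_pos pochhammer_pos) (use le in auto)
  have norm: "fischer_norm (P ^ k) = fischer_norm (?Pa ^ k) * N k" for k
  proof -
    have PC: "P ^ k \<in> mpolys_in (coords Q \<beta>)" using P by (simp add: represents_def)
    have "nat \<bar>int k * \<sigma> p\<bar> = k * ?d" by (simp add: abs_mult nat_mult_distrib)
    then show ?thesis
      using fischer_norm_slice_subst[OF represents_on_Rep[OF PC] semi_invariants_power[OF Q P f, of k]]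
      by (simp add: N_def mpoly_hom_power)
  qed
  have "fischer_norm (P ^ k) \<noteq> 0" using nz by simp
  then have nza: "fischer_norm (?Pa ^ k) \<noteq> 0" unfolding norm by auto
  have "norm_ratio P k = norm_ratio ?Pa k * (N (Suc k) / N k)"
    unfolding norm_ratio_def norm by simp
  moreover have "poly (bracket_poly ?d (\<beta> q - \<beta> p) (\<beta> q)) (of_nat k) = complex_of_real (N (Suc k) / N k)"
    using poly_bracket_poly[OF le, of ?d k] pos[of k] unfolding N_def[symmetric]
    by (simp add: eq_divide_eq)
  ultimately show ?thesis by simp
qed

lemma slice_subst_eq_0_iff:
  assumes P: "represents Q \<beta> P f" and f: "f \<in> semi_invariants Q \<beta> \<sigma>"
  shows "slice_poly P = 0 \<longleftrightarrow> P = 0"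
proof
  assume "slice_poly P = 0"
  with fischer_norm_slice_subst[OF P f] show "P = 0" by simp
qed simp

text \<open>From a semi-invariant of weight \<open>k \<sigma>\<close> subtract the multiple of
  \<open>P ^ k\<close> with the same slice; the difference is a semi-invariant with slice zero and
  hence zero.\<close>

lemma multiplicity_free_slice:
  assumes P: "represents Q \<beta> P f" and f: "f \<in> semi_invariants Q \<beta> \<sigma>" and nz: "P \<noteq> 0"
    and mf: "multiplicity_free Qa \<beta>a (\<sigma>(p := \<sigma> p + \<sigma> q))"
  shows "multiplicity_free Q \<beta> \<sigma>"
  unfolding multiplicity_free_iff[OF Q P f nz]
proof (intro allI ballI impI)
  fix k w R
  let ?\<tau> = "\<lambda>x. int k * \<sigma> x" and ?C = "coords Q \<beta>"
  assume w: "w \<in> semi_invariants Q \<beta> ?\<tau>" and R: "represents Q \<beta> R w"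
  let ?Pa = "slice_poly P"
  have nza: "?Pa \<noteq> 0" using slice_subst_eq_0_iff[OF P f] nz by simp
  have "?\<tau>(p := ?\<tau> p + ?\<tau> q) = (\<lambda>x. int k * (\<sigma>(p := \<sigma> p + \<sigma> q)) x)"
    by (auto simp: algebra_simps)
  then have "slice_fun Q \<beta> a p q w \<in> semi_invariants Qa \<beta>a (\<lambda>x. int k * (\<sigma>(p := \<sigma> p + \<sigma> q)) x)"
    using slice_semi_invariant[OF R w] by simp
  with mf slice_fun_represents[OF R] obtain c where c: "slice_poly R = cst c * ?Pa ^ k"
    unfolding multiplicity_free_iff[OF fin_digraph_slice slice_fun_represents[OF P]
        slice_semi_invariant[OF P f] nza] by blast
  define D where "D = R - cst c * P ^ k"
  have DC: "D \<in> mpolys_in ?C" using R P by (simp add: D_def represents_def)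
  let ?u = "on_Rep Q \<beta> (\<lambda>W. mpoly_eval (\<lambda>x. coord_fun x W) D)"
  have D: "represents Q \<beta> D ?u" by (rule represents_on_Rep[OF DC])
  have PkC: "P ^ k \<in> mpolys_in ?C" using P by (simp add: represents_def)
  have "?u \<in> semi_invariants Q \<beta> ?\<tau>"
  proof (subst semi_invariants_iff[OF Q D])
    show "\<forall>g h. gl_pair Q \<beta> g h \<longrightarrow> lin_subst (act_coeff Q g h) ?C D = cst (weight_char Q ?\<tau> g) * D"
    proof (intro allI impI)
      fix g h assume gh: "gl_pair Q \<beta> g h"
      have "lin_subst (act_coeff Q g h) ?C R = cst (weight_char Q ?\<tau> g) * R"
        by (rule semi_invariant_lin_subst[OF Q R w gh])
      moreover have "lin_subst (act_coeff Q g h) ?C (P ^ k) = cst (weight_char Q ?\<tau> g) * P ^ k"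
        by (rule semi_invariant_lin_subst[OF Q represents_on_Rep[OF PkC] semi_invariants_power[OF Q P f] gh])
      ultimately show "lin_subst (act_coeff Q g h) ?C D = cst (weight_char Q ?\<tau> g) * D"
        by (simp add: D_def lin_subst_def mpoly_hom_simps algebra_simps)
    qed
  qed (simp add: on_Rep_def)
  from slice_subst_eq_0_iff[OF D this] have "D = 0"
    by (simp add: D_def mpoly_hom_simps c)
  then show "\<exists>c. R = cst c * P ^ k" by (auto simp: D_def)
qed

text \<open>The generators of both ideals are known by their values at natural numbers. The constant
  comes from making them monic; it is the inverse of the leading coefficient of
  \<open>bracket_poly\<close>.\<close>

lemma bernstein_sato_poly_slice:
  assumes P: "represents Q \<beta> P f" and f: "f \<in> semi_invariants Q \<beta> \<sigma>" and nz: "P \<noteq> 0"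
    and mf: "multiplicity_free Qa \<beta>a (\<sigma>(p := \<sigma> p + \<sigma> q))"
  shows "\<exists>c. c \<noteq> 0 \<and> bernstein_sato_poly Q \<beta> f =
    smult c (bernstein_sato_poly Qa \<beta>a (slice_fun Q \<beta> a p q f) *
      bracket_poly (nat \<bar>\<sigma> p\<bar>) (\<beta> q - \<beta> p) (\<beta> q))"
proof -
  let ?Pa = "slice_poly P" and ?br = "bracket_poly (nat \<bar>\<sigma> p\<bar>) (\<beta> q - \<beta> p) (\<beta> q)"
  note Pa = slice_fun_represents[OF P] and fa = slice_semi_invariant[OF P f]
  have nza: "?Pa \<noteq> 0" using slice_subst_eq_0_iff[OF P f] nz by simp
  obtain b where b: "\<And>k. poly b (of_nat k) = of_real (norm_ratio P k)"
    and ideal: "bernstein_sato_ideal Q \<beta> f = {c. b dvd c}"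
    using bernstein_sato_ideal_eq_multiples[OF P nz
        multiplicity_free_dual[OF Q P f nz multiplicity_free_slice[OF assms]]] by blast
  obtain b' where b': "\<And>k. poly b' (of_nat k) = of_real (norm_ratio ?Pa k)"
    and ideal': "bernstein_sato_ideal Qa \<beta>a (slice_fun Q \<beta> a p q f) = {c. b' dvd c}"
    using bernstein_sato_ideal_eq_multiples[OF Pa nza
        multiplicity_free_dual[OF fin_digraph_slice Pa fa nza mf]] by blast
  have eq: "b = b' * ?br"
    by (rule poly_eqI_nat[of 0]) (simp add: b b' norm_ratio_slice[OF P f nz])
  have "norm_ratio P 0 \<noteq> 0" using nz by (simp add: norm_ratio_def)
  then have "b \<noteq> 0" using b[of 0] by auto
  moreover from this have "b' \<noteq> 0" using eq by auto
  ultimately have scalar: "lead_coeff b' * inverse (lead_coeff b) * inverse (lead_coeff b') = inverse (lead_coeff b)"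
    by (simp add: mult.commute)
  show ?thesis
  proof (intro exI conjI)
    show "lead_coeff b' * inverse (lead_coeff b) \<noteq> 0"
      using \<open>b \<noteq> 0\<close> \<open>b' \<noteq> 0\<close> by simp
    show "bernstein_sato_poly Q \<beta> f = smult (lead_coeff b' * inverse (lead_coeff b))
        (bernstein_sato_poly Qa \<beta>a (slice_fun Q \<beta> a p q f) * ?br)"
      unfolding bernstein_sato_poly_eq[OF ideal \<open>b \<noteq> 0\<close>] bernstein_sato_poly_eq[OF ideal' \<open>b' \<noteq> 0\<close>]
        mult_smult_left eq[symmetric] smult_smult scalar ..
  qed
qed

end

theorem theorem3p6:
  fixes Q :: "('v, 'a) pre_digraph"
    and \<beta> :: "'v \<Rightarrow> nat"
    and a :: 'a
    and p q :: 'v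
    and \<alpha> \<sigma> :: "'v \<Rightarrow> int"
    and f :: "'a rep \<Rightarrow> complex"
    and Qa :: "('v, 'a + 'a) pre_digraph"
    and \<beta>a :: "'v \<Rightarrow> nat"
    and fa :: "('a + 'a) rep \<Rightarrow> complex"
  assumes "fin_digraph Q"
    and "no_oriented_cycles Q"
    and "one_source Q a \<and> p = tail Q a \<and> q = head Q a \<or>
         one_sink Q a \<and> p = head Q a \<and> q = tail Q a"
    and "\<beta> p \<le> \<beta> q"
    and "\<sigma> = euler_weight Q \<alpha>"
    and "f \<in> semi_invariants Q \<beta> \<sigma>" and "f \<noteq> (\<lambda>_. 0)"
    and "Qa = slice_quiver Q a p q"
    and "\<beta>a = slice_dim \<beta> p q"
    and "fa = slice_fun Q \<beta> a p q f"
  shows "\<exists>\<alpha>a \<sigma>a. \<sigma>a = euler_weight Qa \<alpha>a \<and>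
           fa \<in> semi_invariants Qa \<beta>a \<sigma>a \<and> fa \<noteq> (\<lambda>_. 0) \<and>
           (\<forall>x\<in>verts Q - {p}. \<sigma>a x = \<sigma> x) \<and> \<sigma>a p = \<sigma> p + \<sigma> q \<and>
           (multiplicity_free Qa \<beta>a \<sigma>a \<longrightarrow>
              multiplicity_free Q \<beta> \<sigma> \<and>
              (\<exists>c. c \<noteq> 0 \<and>
                 bernstein_sato_poly Q \<beta> f =
                   smult c (bernstein_sato_poly Qa \<beta>a fa *
                            bracket_poly (nat \<bar>\<sigma> p\<bar>) (\<beta> q - \<beta> p) (\<beta> q))))"
proof -
  obtain level :: "'v \<Rightarrow> nat" where level: "\<And>b. b \<in> arcs Q \<Longrightarrow> level (tail Q b) < level (head Q b)"
    using acyclic_level[OF assms(1,2)] by blast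
  have a: "a \<in> arcs Q" using assms(3) by (auto simp: one_source_def one_sink_def)
  interpret slice_data Q \<beta> a p q
  proof (rule slice_data.intro)
    show "p \<noteq> q" using level[OF a] assms(3) by auto
    show "\<not> (tail Q b = q \<and> head Q b = q)" if "b \<in> arcs Q" for b
      using level[OF that] by auto
    show "tail Q b \<noteq> p \<and> head Q b \<noteq> p" if "b \<in> arcs Q" "b \<noteq> a" for b
      using assms(3) that by (auto simp: one_source_def one_sink_def)
  qed (use assms a in auto)
  obtain P where P: "represents Q \<beta> P f" and off: "\<And>W. W \<notin> Rep Q \<beta> \<Longrightarrow> f W = 0"
    using semi_invariantsE[OF assms(6)] by blast
  have nz: "P \<noteq> 0" using represents_eq_0_iff[OF P off] assms(7) by simp
  let ?\<sigma>a = "\<sigma>(p := \<sigma> p + \<sigma> q)"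
  have "\<exists>\<alpha>a. ?\<sigma>a = euler_weight Qa \<alpha>a"
    unfolding assms(8)
  proof (rule euler_weight_surj[OF fin_digraph_slice])
    \<comment> \<open>In the slice quiver \<open>a\<close> is gone and the arrows at
      \<open>p\<close> are copies of arrows at \<open>q\<close>, so giving \<open>p\<close> the
      level of \<open>q\<close> keeps tails below heads.\<close>
    let ?level = "level(p := level q)"
    have ne: "tail Q c \<noteq> head Q c" if "c \<in> arcs Q" for c
      using level[OF that] by auto
    show "?level (tail (slice_quiver Q a p q) b) < ?level (head (slice_quiver Q a p q) b)"
      if "b \<in> arcs (slice_quiver Q a p q)" for b
      using that level only by (auto split: if_splits simp: ne ne[symmetric])
    fix x assume x: "x \<notin> verts (slice_quiver Q a p q)"
    then have "(\<Sum>b\<in>{b \<in> arcs Q. head Q b = x}. \<alpha> (tail Q b)) = 0"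
      by (intro sum.neutral) auto
    moreover have "x \<noteq> p" using x p_q_verts by auto
    ultimately show "?\<sigma>a x = 0"
      using x by (simp add: assms(5) euler_weight_eq[OF assms(1)])
  qed
  then obtain \<alpha>a where "?\<sigma>a = euler_weight Qa \<alpha>a" ..
  moreover have "fa \<in> semi_invariants Qa \<beta>a ?\<sigma>a"
    unfolding assms(8-10) by (rule slice_semi_invariant[OF P assms(6)])
  moreover have "fa \<noteq> (\<lambda>_. 0)"
  proof -
    have "slice_fun Q \<beta> a p q f W = 0" if "W \<notin> Rep (slice_quiver Q a p q) (slice_dim \<beta> p q)" for W
      using that by (simp add: slice_fun_def on_Rep_def)
    from represents_eq_0_iff[OF slice_fun_represents[OF P] this] show ?thesis
      using slice_subst_eq_0_iff[OF P assms(6)] nz by (simp add: assms(10))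
  qed
  moreover have "multiplicity_free Qa \<beta>a ?\<sigma>a \<longrightarrow> multiplicity_free Q \<beta> \<sigma> \<and>
      (\<exists>c. c \<noteq> 0 \<and> bernstein_sato_poly Q \<beta> f =
        smult c (bernstein_sato_poly Qa \<beta>a fa * bracket_poly (nat \<bar>\<sigma> p\<bar>) (\<beta> q - \<beta> p) (\<beta> q)))"
    unfolding assms(8-10)
    using multiplicity_free_slice[OF P assms(6) nz] bernstein_sato_poly_slice[OF P assms(6) nz] by blast
  moreover have "\<forall>x\<in>verts Q - {p}. ?\<sigma>a x = \<sigma> x" "?\<sigma>a p = \<sigma> p + \<sigma> q" by simp_all
  ultimately show ?thesis by blast
qed

end
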